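(* Let $\mathbb{D}$ be the open unit disc in $\mathbb{C}$. For $r\in(0,1)$ and $0\le s<t\le 1$ define \[ \mathbb{D}^2_r=\Big\{(z_1,z_2)\in\mathbb{D}^2: \Big|\frac{z_1-z_2}{1-\overline{z_1}z_2}\Big|<r\Big\},\qquad \mathbb{D}^2_{s,t}=\Big\{(z_1,z_2)\in\mathbb{D}^2: s<\Big|\frac{z_1-z_2}{1-\overline{z_1}z_2}\Big|<t\Big\}. \] Let $G_{\mathbb{D}}=\{\Phi_\varphi:\varphi\in Aut(\mathbb{D})\}$, where $\Phi_\varphi(z_1,z_2)=(\varphi(z_1),\varphi(z_2))$, and let $\sigma(z_1,z_2)=(z_2,z_1)$. Then for all such $r,s,t$, both the holomorphic automorphism group $Aut(\mathbb{D}^2_r)$ and $Aut(\mathbb{D}^2_{s,t})$ are equal to $\{\Phi,\ \Phi\circ\sigma:\Phi\in G_{\mathbb{D}}\}$.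
   Context: $Aut(\mathbb{D})$ denotes the group of biholomorphic self-maps of the unit disc. *)

theory Defs
  imports "HOL-Complex_Analysis.Complex_Analysis"
begin

definition unit_disc :: "complex set" where
  "unit_disc = ball 0 1"

definition aut_disc :: "(complex \<Rightarrow> complex) set" where
  "aut_disc = {\<phi>. \<phi> holomorphic_on unit_disc \<and> bij_betw \<phi> unit_disc unit_disc
                 \<and> (inv_into unit_disc \<phi>) holomorphic_on unit_disc}"

definition pdist :: "complex \<Rightarrow> complex \<Rightarrow> real" where
  "pdist z1 z2 = cmod ((z1 - z2) / (1 - cnj z1 * z2))"

definition Dr :: "real \<Rightarrow> (complex \<times> complex) set" where
  "Dr r = {(z1, z2). z1 \<in> unit_disc \<and> z2 \<in> unit_disc \<and> pdist z1 z2 < r}"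

definition Dst :: "real \<Rightarrow> real \<Rightarrow> (complex \<times> complex) set" where
  "Dst s t = {(z1, z2). z1 \<in> unit_disc \<and> z2 \<in> unit_disc \<and> s < pdist z1 z2 \<and> pdist z1 z2 < t}"

definition holo2_on :: "(complex \<times> complex \<Rightarrow> complex \<times> complex) \<Rightarrow> (complex \<times> complex) set \<Rightarrow> bool" where
  "holo2_on F U \<longleftrightarrow> (\<forall>z\<in>U. \<exists>L. (F has_derivative L) (at z) \<and>
      (\<forall>c::complex. \<forall>w1 w2. L (c * w1, c * w2) = (c * fst (L (w1, w2)), c * snd (L (w1, w2)))))"

definition aut2 :: "(complex \<times> complex) set \<Rightarrow> (complex \<times> complex \<Rightarrow> complex \<times> complex) set" where
  "aut2 U = {F. holo2_on F U \<and> bij_betw F U U \<and> holo2_on (inv_into U F) U}"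

definition diag_map :: "(complex \<Rightarrow> complex) \<Rightarrow> complex \<times> complex \<Rightarrow> complex \<times> complex" where
  "diag_map \<phi> = (\<lambda>(z1, z2). (\<phi> z1, \<phi> z2))"

definition sigma :: "complex \<times> complex \<Rightarrow> complex \<times> complex" where
  "sigma = (\<lambda>(z1, z2). (z2, z1))"

end

(* An automorphism F of Dr r moves the diagonal to the diagonal. Indeed, both coordinate functions
   restrict to the identity on the diagonal disc, so the origin carries two different extremal
   functions for one complex geodesic. Near a boundary point with pdist = r the domain is squeezed
   between two almost equal ellipsoids, where an extremal function is almost determined to first
   order; hence the orbit of the origin stays in some set pdist <= x0 < r. Therefore F (z, z) can
   tend to the boundary only through the boundary of the diagonal, and the two components of
   F (z, z) agree by the maximum principle. After composing with a diagonal automorphism, F fixes 0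
   and is linear by Cartan's theorem, and linear automorphisms are found by hand.

   For Dst s t, bounded holomorphic functions extend to Dr t: the principal part of the Laurent
   expansion in the fibre over z depends holomorphically on z and tends to 0 as |z| tends to 1,
   because the fibres shrink. This reduces the claim to Dr t, or to the bidisc if t = 1. *)

theory Submission
  imports Defs
begin

subsection \<open>The pseudohyperbolic distance\<close>

text \<open>One affine coordinate makes the squeezing quantitative. The fibre of \<open>Dr r\<close>
  over z is a Euclidean disc with centre \<open>(1 - r^2) * z\<close> up to a cubic error. With q =
  (w - (1 - r^2) z) / r the domain is trapped between |q| < 1 - (1 - r^2) |z|^2 / (1 - r |z|) and
  the same bound with 1 + r |z|; the two agree to second order at z = 0. The outer bound also yields
  the separating functions of the extension argument.

  Two extremal functions are contradictory for a Hilbert space reason. Adding t (1, -1) or its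
  negative to (1, 1) raises one coordinate to 1 + t, a first order gain, while by the parallelogram
  law the mean squared norm grows only by order t^2. So no Hilbert norm close to 1 at (1, 1) and
  bounded at (1, -1) dominates both coordinates.

  For t = 1 the automorphisms of the bidisc may use different maps \<phi>, \<psi> in the two
  factors. Since points over the hole cannot enter \<open>Dst s 1\<close>,
  \<open>pdist (\<phi> z) (\<psi> z)\<close> is at most s, and the boundary argument used for the
  diagonal gives \<phi> = \<psi>.\<close>

lemma unit_disc_iff [simp]: "z \<in> unit_disc \<longleftrightarrow> cmod z < 1"
  by (simp add: unit_disc_def)

lemma open_unit_disc [simp]: "open unit_disc"
  by (simp add: unit_disc_def)

lemma pdist_denom_nonzero:
  assumes "cmod z \<le> 1" "cmod w < 1"
  shows "1 - cnj z * w \<noteq> 0"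
proof
  assume "1 - cnj z * w = 0"
  hence "cmod z * cmod w = 1"
    by (metis complex_mod_cnj eq_iff_diff_eq_0 norm_mult norm_one)
  moreover have "cmod z * cmod w \<le> 1 * cmod w"
    by (rule mult_right_mono) (use assms in auto)
  ultimately show False using assms by simp
qed

text \<open>For \<open>z\<close> inside the unit disc the sign of the right side tells on which side
  of the circle \<open>w\<close> lies: inside it gives \<open>pdist z w < 1\<close>, outside the
  numerator of \<open>pdist\<close> dominates the denominator.\<close>

lemma cmod_diff_identity:
  "(cmod (1 - cnj z * w))^2 - (cmod (z - w))^2 = (1 - (cmod z)^2) * (1 - (cmod w)^2)"
  unfolding cmod_power2 by (simp add: algebra_simps power2_eq_square)

lemma one_minus_square_le:
  fixes x :: real
  shows "1 - x^2 \<le> 2 * (1 - x)"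
  using zero_le_power2[of "1 - x"] by (simp add: power2_eq_square algebra_simps)

lemma pdist_nonneg [simp]: "0 \<le> pdist z w"
  by (simp add: pdist_def)

lemma pdist_sym: "pdist z w = pdist w z"
proof -
  have "cmod (1 - cnj z * w) = cmod (1 - cnj w * z)"
    by (metis complex_cnj_cnj complex_cnj_diff complex_cnj_mult complex_cnj_one
        complex_mod_cnj mult.commute)
  thus ?thesis by (simp add: pdist_def norm_divide norm_minus_commute)
qed

lemma pdist_less_iff:
  assumes "cmod z < 1" "cmod w < 1"
  shows "pdist z w < r \<longleftrightarrow> cmod (z - w) < r * cmod (1 - cnj z * w)"
  using pdist_denom_nonzero[of z w] assms by (simp add: pdist_def norm_divide divide_less_eq)

lemma pdist_less_1:
  assumes "cmod z < 1" "cmod w < 1"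
  shows "pdist z w < 1"
proof -
  have "0 < (1 - (cmod z)^2) * (1 - (cmod w)^2)"
    using assms by (simp add: power_less_one_iff)
  hence "(cmod (z - w))^2 < (cmod (1 - cnj z * w))^2"
    using cmod_diff_identity[of z w] by linarith
  hence "cmod (z - w) < cmod (1 - cnj z * w)" by (rule power_less_imp_less_base) simp
  thus ?thesis using pdist_less_iff[OF assms, of 1] by simp
qed

lemma pdist_square:
  assumes "cmod z < 1" "cmod w < 1"
  shows "1 - (pdist z w)^2 = (1 - (cmod z)^2) * (1 - (cmod w)^2) / (cmod (1 - cnj z * w))^2"
proof -
  have "cmod (1 - cnj z * w) \<noteq> 0" using pdist_denom_nonzero[of z w] assms by simp
  moreover have "(pdist z w)^2 = (cmod (z - w))^2 / (cmod (1 - cnj z * w))^2"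
    by (simp add: pdist_def norm_divide power_divide)
  ultimately show ?thesis unfolding cmod_diff_identity[symmetric]
    by (simp add: diff_divide_distrib)
qed

text \<open>A bound on \<open>pdist\<close> below 1 forces the Euclidean distance to 0 as
  \<open>z\<close> approaches the unit circle. This turns bounded \<open>pdist\<close> between two
  holomorphic functions into equality once one of them is known to tend to the circle.\<close>

lemma cmod_diff_le_of_pdist:
  assumes "cmod z < 1" "cmod w < 1" "pdist z w \<le> r" "r < 1"
  shows "(cmod (z - w))^2 \<le> (1 - (cmod z)^2) / (1 - r^2)"
proof -
  have r0: "0 \<le> r" using assms(3) pdist_nonneg order_trans by blast
  have nz: "1 - cnj z * w \<noteq> 0" using assms pdist_denom_nonzero by simp
  have "cmod (z - w) \<le> r * cmod (1 - cnj z * w)"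
    using assms(3) nz by (simp add: pdist_def norm_divide divide_le_eq)
  hence "(cmod (z - w))^2 \<le> r^2 * (cmod (1 - cnj z * w))^2"
    by (metis norm_ge_zero power_mono power_mult_distrib)
  also have "\<dots> = r^2 * ((1 - (cmod z)^2) * (1 - (cmod w)^2)) + r^2 * (cmod (z - w))^2"
    unfolding cmod_diff_identity[symmetric] by (simp add: algebra_simps)
  finally have "(1 - r^2) * (cmod (z - w))^2 \<le> r^2 * ((1 - (cmod z)^2) * (1 - (cmod w)^2))"
    by (simp add: algebra_simps)
  also have "\<dots> \<le> 1 * ((1 - (cmod z)^2) * 1)"
    using assms r0 by (intro mult_mono) (auto simp: abs_square_le_1 power_le_one)
  finally show ?thesis using assms r0
    by (simp add: field_simps power_less_one_iff)
qed

lemma continuous_on_pdist: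
  "continuous_on (unit_disc \<times> unit_disc) (\<lambda>p. pdist (fst p) (snd p))"
  unfolding pdist_def
  by (intro continuous_intros) (use pdist_denom_nonzero in \<open>auto simp: less_imp_le\<close>)

lemma Dr_iff: "(z, w) \<in> Dr r \<longleftrightarrow> cmod z < 1 \<and> cmod w < 1 \<and> pdist z w < r"
  by (simp add: Dr_def)

lemma Dst_iff:
  "(z, w) \<in> Dst s t \<longleftrightarrow> cmod z < 1 \<and> cmod w < 1 \<and> s < pdist z w \<and> pdist z w < t"
  by (simp add: Dst_def)

lemma Dst_mono: "s' \<ge> s \<Longrightarrow> t' \<le> t \<Longrightarrow> Dst s' t' \<subseteq> Dst s t"
  by (auto simp: Dst_def)

lemma open_Dr: "open (Dr r)"
proof -
  have "Dr r = (unit_disc \<times> unit_disc) \<inter> (\<lambda>p. pdist (fst p) (snd p)) -` {..<r}"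
    by (auto simp: Dr_def)
  thus ?thesis
    using continuous_on_open_vimage[THEN iffD1, OF _ continuous_on_pdist, rule_format, of "{..<r}"]
    by (simp add: open_Times Int_commute)
qed

lemma open_Dst: "open (Dst s t)"
proof -
  have "Dst s t = (unit_disc \<times> unit_disc) \<inter> (\<lambda>p. pdist (fst p) (snd p)) -` {s<..<t}"
    by (auto simp: Dst_def)
  thus ?thesis
    using continuous_on_open_vimage[THEN iffD1, OF _ continuous_on_pdist, rule_format, of "{s<..<t}"]
    by (simp add: open_Times Int_commute)
qed

subsection \<open>Pseudohyperbolic discs are Euclidean discs\<close>

definition disc_center :: "real \<Rightarrow> complex \<Rightarrow> complex" where
  "disc_center r z = of_real ((1 - r^2) / (1 - r^2 * (cmod z)^2)) * z"

definition disc_radius :: "real \<Rightarrow> complex \<Rightarrow> real" where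
  "disc_radius r z = r * (1 - (cmod z)^2) / (1 - r^2 * (cmod z)^2)"

lemma disc_denom_pos:
  assumes "0 \<le> r" "r < 1" "cmod z \<le> 1"
  shows "0 < 1 - r^2 * (cmod z)^2"
proof -
  have "(r * cmod z)^2 < 1"
    using assms by (intro power_less_one_iff[THEN iffD2])
      (auto intro: le_less_trans[OF mult_left_le])
  thus ?thesis by (simp add: power_mult_distrib)
qed

text \<open>Completing the square in \<open>w\<close>; the coefficient of |w|^2 on the left is minus
  \<open>1 - r^2 * (cmod z)^2\<close>. The identity holds for every \<open>w\<close>, so it can also
  be read outside the unit disc.\<close>

lemma disc_identity:
  assumes "0 \<le> r" "r < 1" "cmod z \<le> 1"
  shows "r^2 * (cmod (1 - cnj z * w))^2 - (cmod (z - w))^2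
     = (1 - r^2 * (cmod z)^2) * ((disc_radius r z)^2 - (cmod (w - disc_center r z))^2)"
proof -
  define D where "D = 1 - r^2 * (cmod z)^2"
  have D: "D > 0" using disc_denom_pos[OF assms] by (simp add: D_def)
  define X where "X = Re w * Re z + Im w * Im z"
  have 1: "(cmod (w - of_real k * z))^2 = (cmod w)^2 - 2 * k * X + k^2 * (cmod z)^2" for k
    unfolding cmod_power2 X_def by (simp add: algebra_simps power2_eq_square)
  have 2: "(cmod (z - w))^2 = (cmod w)^2 - 2 * X + (cmod z)^2"
    unfolding cmod_power2 X_def by (simp add: algebra_simps power2_eq_square)
  have 3: "(cmod (1 - cnj z * w))^2 = 1 - 2 * X + (cmod z)^2 * (cmod w)^2"
    unfolding cmod_power2 X_def by (simp add: algebra_simps power2_eq_square)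
  have "D * ((disc_radius r z)^2 - (cmod (w - disc_center r z))^2)
     = (r^2 * (1 - (cmod z)^2)^2 - (1 - r^2)^2 * (cmod z)^2) / D - D * (cmod w)^2 + 2 * (1 - r^2) * X"
    using D unfolding disc_radius_def disc_center_def 1 D_def[symmetric]
    by (simp add: field_simps power2_eq_square)
  also have "r^2 * (1 - (cmod z)^2)^2 - (1 - r^2)^2 * (cmod z)^2 = (r^2 - (cmod z)^2) * D"
    unfolding D_def by (simp add: algebra_simps power2_eq_square)
  also have "(r^2 - (cmod z)^2) * D / D = r^2 - (cmod z)^2" using D by simp
  finally have "D * ((disc_radius r z)^2 - (cmod (w - disc_center r z))^2)
     = r^2 - (cmod z)^2 - D * (cmod w)^2 + 2 * (1 - r^2) * X" .
  moreover have "r^2 * (cmod (1 - cnj z * w))^2 - (cmod (z - w))^2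
     = r^2 - (cmod z)^2 - D * (cmod w)^2 + 2 * (1 - r^2) * X"
    unfolding 2 3 D_def by (simp add: algebra_simps)
  ultimately show ?thesis by (simp add: D_def)
qed

lemma disc_radius_nonneg:
  assumes "0 \<le> r" "r < 1" "cmod z \<le> 1"
  shows "0 \<le> disc_radius r z"
  using assms disc_denom_pos[OF assms] by (simp add: disc_radius_def power_le_one)

lemma disc_radius_pos:
  assumes "0 < r" "r < 1" "cmod z < 1"
  shows "0 < disc_radius r z"
  using assms disc_denom_pos[of r z] by (simp add: disc_radius_def power_less_one_iff)

lemma cmod_ge_imp_cmod_diff_ge:
  assumes "cmod z < 1" "1 \<le> cmod w"
  shows "cmod (1 - cnj z * w) \<le> cmod (z - w)"
proof -
  have "(1 - (cmod z)^2) * (1 - (cmod w)^2) \<le> 0"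
    using assms by (intro mult_nonneg_nonpos) (auto simp: power_le_one)
  hence "(cmod (1 - cnj z * w))^2 \<le> (cmod (z - w))^2"
    using cmod_diff_identity[of z w] by linarith
  thus ?thesis by (rule power2_le_imp_le) simp
qed

text \<open>For \<open>w\<close> outside the unit disc
  \<open>cmod (1 - cnj z * w) \<le> cmod (z - w)\<close>, which with \<open>r < 1\<close> would
  force \<open>z = w\<close>. This is why \<open>mem_Dr_iff_disc\<close> needs no condition on
  \<open>cmod w\<close>.\<close>

lemma mem_disc_imp_cmod_less_1:
  assumes "0 \<le> r" "r < 1" "cmod z < 1" "cmod (w - disc_center r z) \<le> disc_radius r z"
  shows "cmod w < 1"
proof (rule ccontr)
  assume "\<not> cmod w < 1"
  hence w: "1 \<le> cmod w" by simp
  have zw: "z \<noteq> w" using assms w by auto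
  have "(cmod (w - disc_center r z))^2 \<le> (disc_radius r z)^2"
    using assms by (intro power_mono) auto
  hence "0 \<le> r^2 * (cmod (1 - cnj z * w))^2 - (cmod (z - w))^2"
    unfolding disc_identity[OF assms(1,2) less_imp_le[OF assms(3)]]
    using disc_denom_pos[of r z] assms by simp
  moreover have "r^2 * (cmod (1 - cnj z * w))^2 \<le> r^2 * (cmod (z - w))^2"
    using cmod_ge_imp_cmod_diff_ge[OF assms(3) w] by (intro mult_left_mono power_mono) auto
  moreover have "r^2 * (cmod (z - w))^2 < 1 * (cmod (z - w))^2"
    using assms zw by (intro mult_strict_right_mono) (auto simp: power_less_one_iff)
  ultimately show False by simp
qed

lemma sq_less_iff:
  fixes a b :: real
  assumes "0 \<le> a" "0 \<le> b"
  shows "a < b \<longleftrightarrow> a^2 < b^2"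
  using assms by (meson power2_less_imp_less power_strict_mono zero_less_numeral)

lemma pdist_less_iff_disc:
  assumes "0 < r" "r < 1" "cmod z < 1" "cmod w < 1"
  shows "pdist z w < r \<longleftrightarrow> cmod (w - disc_center r z) < disc_radius r z"
proof -
  have D: "0 < 1 - r^2 * (cmod z)^2" using disc_denom_pos[of r z] assms by simp
  have "pdist z w < r \<longleftrightarrow> (cmod (z - w))^2 < (r * cmod (1 - cnj z * w))^2"
    using assms by (subst pdist_less_iff) (auto intro!: sq_less_iff)
  also have "\<dots> \<longleftrightarrow> 0 < r^2 * (cmod (1 - cnj z * w))^2 - (cmod (z - w))^2"
    by (simp add: power_mult_distrib)
  also have "\<dots> \<longleftrightarrow> (cmod (w - disc_center r z))^2 < (disc_radius r z)^2"
    using disc_identity[of r z w] assms D by (simp add: zero_less_mult_iff)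
  also have "\<dots> \<longleftrightarrow> cmod (w - disc_center r z) < disc_radius r z"
    using disc_radius_nonneg[of r z] assms by (auto intro!: sq_less_iff[symmetric])
  finally show ?thesis .
qed

lemma pdist_eq_iff_disc:
  assumes "0 < r" "r < 1" "cmod z < 1" "cmod w < 1"
  shows "pdist z w = r \<longleftrightarrow> cmod (w - disc_center r z) = disc_radius r z"
proof -
  have D: "0 < 1 - r^2 * (cmod z)^2" using disc_denom_pos[of r z] assms by simp
  have "pdist z w = r \<longleftrightarrow> cmod (z - w) = r * cmod (1 - cnj z * w)"
    using assms pdist_denom_nonzero[of z w] by (simp add: pdist_def norm_divide divide_eq_eq)
  also have "\<dots> \<longleftrightarrow> (cmod (z - w))^2 = (r * cmod (1 - cnj z * w))^2"
    using assms by (simp add: power2_eq_iff_nonneg)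
  also have "\<dots> \<longleftrightarrow> 0 = r^2 * (cmod (1 - cnj z * w))^2 - (cmod (z - w))^2"
    by (auto simp: power_mult_distrib)
  also have "\<dots> \<longleftrightarrow> (cmod (w - disc_center r z))^2 = (disc_radius r z)^2"
    using disc_identity[of r z w] assms D by auto
  also have "\<dots> \<longleftrightarrow> cmod (w - disc_center r z) = disc_radius r z"
    using disc_radius_nonneg[of r z] assms by (simp add: power2_eq_iff_nonneg)
  finally show ?thesis .
qed

lemma mem_Dr_iff_disc:
  assumes "0 < r" "r < 1"
  shows "(z, w) \<in> Dr r \<longleftrightarrow> cmod z < 1 \<and> cmod (w - disc_center r z) < disc_radius r z"
  using assms pdist_less_iff_disc[OF assms] mem_disc_imp_cmod_less_1[of r z w]
  by (auto simp: Dr_iff)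

section \<open>Comparison with discs whose centre is linear in z\<close>

text \<open>The linear part of the centre is singled out because it is holomorphic in
  \<open>z\<close>; the remainder is of order |z|^3, below the quadratic terms that shape the domain
  near \<open>z = 0\<close>.\<close>

lemma center_shift:
  assumes "0 \<le> r" "r < 1" "cmod z \<le> 1"
  shows "disc_center r z - of_real (1 - r^2) * z = of_real ((1 - r^2) * r^2 * (cmod z)^2 / (1 - r^2 * (cmod z)^2)) * z"
proof -
  define D where "D = 1 - r^2 * (cmod z)^2"
  have D: "D > 0" using disc_denom_pos[OF assms] by (simp add: D_def)
  have 1: "(1 - r^2) / D - (1 - r^2) = (1 - r^2) * r^2 * (cmod z)^2 / D"
    using D by (simp add: field_simps) (simp add: D_def algebra_simps)
  have "disc_center r z - of_real (1 - r^2) * z = of_real ((1 - r^2) / D - (1 - r^2)) * z"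
    by (simp add: disc_center_def D_def algebra_simps)
  thus ?thesis unfolding 1 by (simp add: D_def)
qed

lemma norm_center_shift:
  assumes "0 \<le> r" "r < 1" "cmod z \<le> 1"
  shows "cmod (disc_center r z - of_real (1 - r^2) * z)
    = (1 - r^2) * r^2 * (cmod z)^3 / (1 - r^2 * (cmod z)^2)"
proof -
  have "0 \<le> (1 - r^2) * r^2 * (cmod z)^2 / (1 - r^2 * (cmod z)^2)"
    using disc_denom_pos[OF assms] assms by (intro divide_nonneg_pos mult_nonneg_nonneg) (auto simp: power_le_one)
  thus ?thesis unfolding center_shift[OF assms] norm_mult norm_of_real
    by (simp only: abs_of_nonneg) (simp add: power3_eq_cube power2_eq_square)
qed

text \<open>Error of the centre plus radius: the numerator contains the factor
  \<open>1 - r * x\<close>, which cancels against \<open>1 - r^2 * x^2\<close>. For radius minus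
  error, in \<open>inner_bound_identity\<close>, the factor is \<open>1 + r * x\<close>.\<close>

lemma outer_bound_identity:
  fixes r x :: real
  assumes "0 \<le> r" "r < 1" "0 \<le> x" "x \<le> 1"
  shows "(1 - r^2) * r^2 * x^3 / (1 - r^2 * x^2) + r * (1 - x^2) / (1 - r^2 * x^2)
     = r * (1 - (1 - r^2) * x^2 / (1 + r * x))"
proof -
  have "r * x \<le> r" using assms mult_left_le by blast
  hence 1: "1 - r * x \<noteq> 0" using assms by simp
  have "0 \<le> r * x" using assms by simp
  hence 2: "1 + r * x \<noteq> 0" by simp
  have 3: "1 - r^2 * x^2 = (1 - r * x) * (1 + r * x)" by (simp add: algebra_simps power2_eq_square)
  have "(1 - r^2) * r^2 * x^3 + r * (1 - x^2) = r * (1 - r * x) * (1 + r * x - (1 - r^2) * x^2)"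
    by (simp add: algebra_simps power2_eq_square power3_eq_cube)
  hence "(1 - r^2) * r^2 * x^3 / (1 - r^2 * x^2) + r * (1 - x^2) / (1 - r^2 * x^2)
     = r * (1 - r * x) * (1 + r * x - (1 - r^2) * x^2) / ((1 - r * x) * (1 + r * x))"
    by (simp only: add_divide_distrib[symmetric] 3)
  also have "\<dots> = r * ((1 + r * x - (1 - r^2) * x^2) / (1 + r * x))" using 1 by simp
  also have "(1 + r * x - (1 - r^2) * x^2) / (1 + r * x) = 1 - (1 - r^2) * x^2 / (1 + r * x)"
    using 2 by (subst diff_divide_distrib) simp
  finally show ?thesis .
qed

lemma inner_bound_identity:
  fixes r x :: real
  assumes "0 \<le> r" "r < 1" "0 \<le> x" "x \<le> 1"
  shows "r * (1 - x^2) / (1 - r^2 * x^2) - (1 - r^2) * r^2 * x^3 / (1 - r^2 * x^2)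
     = r * (1 - (1 - r^2) * x^2 / (1 - r * x))"
proof -
  have "r * x \<le> r" using assms mult_left_le by blast
  hence 1: "1 - r * x \<noteq> 0" using assms by simp
  have "0 \<le> r * x" using assms by simp
  hence 2: "1 + r * x \<noteq> 0" by simp
  have 3: "1 - r^2 * x^2 = (1 - r * x) * (1 + r * x)" by (simp add: algebra_simps power2_eq_square)
  have "r * (1 - x^2) - (1 - r^2) * r^2 * x^3 = r * (1 - r * x - (1 - r^2) * x^2) * (1 + r * x)"
    by (simp add: algebra_simps power2_eq_square power3_eq_cube)
  hence "r * (1 - x^2) / (1 - r^2 * x^2) - (1 - r^2) * r^2 * x^3 / (1 - r^2 * x^2)
     = r * (1 - r * x - (1 - r^2) * x^2) * (1 + r * x) / ((1 - r * x) * (1 + r * x))"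
    by (simp only: diff_divide_distrib[symmetric] 3)
  also have "\<dots> = r * ((1 - r * x - (1 - r^2) * x^2) / (1 - r * x))" using 2 by simp
  also have "(1 - r * x - (1 - r^2) * x^2) / (1 - r * x) = 1 - (1 - r^2) * x^2 / (1 - r * x)"
    using 1 by (subst diff_divide_distrib) simp
  finally show ?thesis .
qed

text \<open>The affine function on the left can reach modulus \<open>r\<close> only over
  \<open>z = 0\<close>, so it is a peak function at \<open>(0, r)\<close>. The case
  \<open>pdist z w = r\<close> is included because the maximum principle applies the bound at a
  point where \<open>pdist\<close> is maximal.\<close>

lemma Dr_subset_egg:
  assumes "0 < r" "r < 1" "cmod z < 1" "cmod w < 1" "pdist z w \<le> r"
  shows "cmod (w - of_real (1 - r^2) * z) \<le> r * (1 - (1 - r^2) * (cmod z)^2 / (1 + r * cmod z))"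
proof -
  have "w - of_real (1 - r^2) * z = (w - disc_center r z) + (disc_center r z - of_real (1 - r^2) * z)" by simp
  hence "cmod (w - of_real (1 - r^2) * z) \<le> cmod (w - disc_center r z) + cmod (disc_center r z - of_real (1 - r^2) * z)"
    by (metis norm_triangle_ineq)
  moreover have "cmod (w - disc_center r z) \<le> disc_radius r z"
    using pdist_less_iff_disc[OF assms(1-4)] pdist_eq_iff_disc[OF assms(1-4)] assms(5) by linarith
  ultimately have "cmod (w - of_real (1 - r^2) * z) \<le>
     (1 - r^2) * r^2 * (cmod z)^3 / (1 - r^2 * (cmod z)^2) + disc_radius r z"
    using norm_center_shift[of r z] assms by auto
  also have "\<dots> = r * (1 - (1 - r^2) * (cmod z)^2 / (1 + r * cmod z))"
    unfolding disc_radius_def by (rule outer_bound_identity) (use assms in auto)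
  finally show ?thesis .
qed

text \<open>Here the error of the centre is subtracted from the radius instead of added. The gap to
  the bound of \<open>Dr_subset_egg\<close> is of order |z|^3.\<close>

lemma egg_subset_Dr:
  assumes "0 < r" "r < 1" "cmod z < 1"
    "cmod (w - of_real (1 - r^2) * z) < r * (1 - (1 - r^2) * (cmod z)^2 / (1 - r * cmod z))"
  shows "(z, w) \<in> Dr r"
proof -
  have "w - disc_center r z = (w - of_real (1 - r^2) * z) - (disc_center r z - of_real (1 - r^2) * z)" by simp
  hence "cmod (w - disc_center r z) \<le> cmod (w - of_real (1 - r^2) * z) + cmod (disc_center r z - of_real (1 - r^2) * z)"
    by (metis norm_triangle_ineq4)
  also have "\<dots> < r * (1 - (1 - r^2) * (cmod z)^2 / (1 - r * cmod z)) +
       (1 - r^2) * r^2 * (cmod z)^3 / (1 - r^2 * (cmod z)^2)"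
    using assms norm_center_shift[of r z] by simp
  also have "\<dots> = disc_radius r z"
    using inner_bound_identity[of r "cmod z"] assms by (simp add: disc_radius_def)
  finally show ?thesis using assms by (simp add: mem_Dr_iff_disc)
qed

subsection \<open>The Schwarz-Pick lemma and automorphisms of the disc\<close>

lemma norm_Moebius_function: "cmod (Moebius_function 0 a z) = pdist a z"
  by (simp add: Moebius_function_simple pdist_def norm_divide norm_minus_commute)

lemma Moebius_function_inverse:
  assumes "cmod a < 1" "cmod z < 1"
  shows "Moebius_function 0 (- a) (Moebius_function 0 a z) = z"
    and "Moebius_function 0 a (Moebius_function 0 (- a) z) = z"
  using assms by (auto intro!: Moebius_function_compose)

lemma Schwarz_Pick:
  assumes f: "f holomorphic_on unit_disc" "\<And>z. cmod z < 1 \<Longrightarrow> cmod (f z) < 1"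
    and zw: "cmod z < 1" "cmod w < 1"
  shows "pdist (f z) (f w) \<le> pdist z w"
proof -
  define g where "g = Moebius_function 0 (f z) \<circ> (f \<circ> Moebius_function 0 (- z))"
  have M: "Moebius_function 0 (- z) ` unit_disc \<subseteq> unit_disc"
    using Moebius_function_norm_lt_1[of "-z"] zw by auto
  have "Moebius_function 0 (- z) holomorphic_on unit_disc"
    using Moebius_function_holomorphic[of "-z"] zw by (simp add: unit_disc_def)
  hence h1: "(f \<circ> Moebius_function 0 (- z)) holomorphic_on unit_disc"
    by (rule holomorphic_on_compose_gen[OF _ f(1) M])
  have "Moebius_function 0 (f z) holomorphic_on unit_disc"
    using Moebius_function_holomorphic[of "f z"] f zw by (simp add: unit_disc_def)
  hence "g holomorphic_on unit_disc" unfolding g_def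
    by (rule holomorphic_on_compose_gen[OF h1]) (use M f in auto)
  moreover have "g 0 = 0"
    by (simp add: g_def Moebius_function_of_zero Moebius_function_eq_zero)
  moreover have "cmod (g x) < 1" if "cmod x < 1" for x
    using that zw f Moebius_function_norm_lt_1 by (auto simp: g_def)
  ultimately have "cmod (g (Moebius_function 0 z w)) \<le> cmod (Moebius_function 0 z w)"
    using Schwarz_Lemma(1)[of g] Moebius_function_norm_lt_1[of z w] zw by (simp add: unit_disc_def)
  thus ?thesis using zw by (simp add: g_def norm_Moebius_function Moebius_function_inverse)
qed

text \<open>Any two-sided inverse agrees with \<open>inv_into\<close> on the disc, and holomorphy
  there sees nothing else.\<close>

lemma aut_disc_iff:
  "\<phi> \<in> aut_disc \<longleftrightarrow> \<phi> holomorphic_on unit_disc \<and>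
    (\<exists>\<psi>. \<psi> holomorphic_on unit_disc \<and> \<phi> ` unit_disc \<subseteq> unit_disc \<and> \<psi> ` unit_disc \<subseteq> unit_disc \<and>
         (\<forall>z\<in>unit_disc. \<psi> (\<phi> z) = z \<and> \<phi> (\<psi> z) = z))" (is "?L \<longleftrightarrow> ?R")
proof
  assume L: ?L
  hence b: "bij_betw \<phi> unit_disc unit_disc" by (simp add: aut_disc_def)
  have "inv_into unit_disc \<phi> ` unit_disc \<subseteq> unit_disc"
    using bij_betw_inv_into[OF b] by (simp add: bij_betw_def)
  moreover have "\<forall>z\<in>unit_disc. inv_into unit_disc \<phi> (\<phi> z) = z \<and> \<phi> (inv_into unit_disc \<phi> z) = z"
    using b by (auto simp del: unit_disc_iff simp: bij_betw_inv_into_left bij_betw_inv_into_right)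
  ultimately show ?R using L by (auto simp del: unit_disc_iff simp: aut_disc_def bij_betw_def)
next
  assume ?R
  then obtain \<psi> where \<psi>: "\<phi> holomorphic_on unit_disc" "\<psi> holomorphic_on unit_disc"
    "\<phi> ` unit_disc \<subseteq> unit_disc" "\<psi> ` unit_disc \<subseteq> unit_disc"
    "\<And>z. z \<in> unit_disc \<Longrightarrow> \<psi> (\<phi> z) = z" "\<And>z. z \<in> unit_disc \<Longrightarrow> \<phi> (\<psi> z) = z" by blast
  have b: "bij_betw \<phi> unit_disc unit_disc"
    by (rule bij_betw_byWitness[of _ \<psi>]) (use \<psi> in \<open>auto simp del: unit_disc_iff\<close>)
  moreover have "inv_into unit_disc \<phi> z = \<psi> z" if "z \<in> unit_disc" for z
    using b \<psi> that by (metis bij_betw_inv_into_left image_subset_iff)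
  hence "inv_into unit_disc \<phi> holomorphic_on unit_disc"
    using \<psi>(2) holomorphic_cong by blast
  ultimately show ?L using \<psi> by (simp add: aut_disc_def)
qed

lemma aut_discE:
  assumes "\<phi> \<in> aut_disc"
  obtains \<psi> where "\<psi> \<in> aut_disc" "\<phi> holomorphic_on unit_disc" "\<psi> holomorphic_on unit_disc"
    "\<And>z. cmod z < 1 \<Longrightarrow> cmod (\<phi> z) < 1" "\<And>z. cmod z < 1 \<Longrightarrow> cmod (\<psi> z) < 1"
    "\<And>z. cmod z < 1 \<Longrightarrow> \<psi> (\<phi> z) = z" "\<And>z. cmod z < 1 \<Longrightarrow> \<phi> (\<psi> z) = z"
proof -
  obtain \<psi> where \<psi>: "\<phi> holomorphic_on unit_disc" "\<psi> holomorphic_on unit_disc"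
    "\<phi> ` unit_disc \<subseteq> unit_disc" "\<psi> ` unit_disc \<subseteq> unit_disc"
    "\<And>z. z \<in> unit_disc \<Longrightarrow> \<psi> (\<phi> z) = z \<and> \<phi> (\<psi> z) = z"
    using assms unfolding aut_disc_iff by blast
  have "\<psi> \<in> aut_disc" unfolding aut_disc_iff using \<psi> by blast
  moreover have "cmod (\<phi> z) < 1" "cmod (\<psi> z) < 1" if "cmod z < 1" for z
    using \<psi>(3,4) that unfolding image_subset_iff by auto
  ultimately show thesis using \<psi> by (intro that[of \<psi>]) auto
qed

lemma aut_discI:
  assumes "\<phi> holomorphic_on unit_disc" "\<psi> holomorphic_on unit_disc"
    "\<And>z. cmod z < 1 \<Longrightarrow> cmod (\<phi> z) < 1" "\<And>z. cmod z < 1 \<Longrightarrow> cmod (\<psi> z) < 1"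
    "\<And>z. cmod z < 1 \<Longrightarrow> \<psi> (\<phi> z) = z" "\<And>z. cmod z < 1 \<Longrightarrow> \<phi> (\<psi> z) = z"
  shows "\<phi> \<in> aut_disc"
  unfolding aut_disc_iff using assms by (auto intro!: exI[of _ \<psi>])

lemma aut_disc_comp:
  assumes "\<phi> \<in> aut_disc" "\<psi> \<in> aut_disc"
  shows "\<phi> \<circ> \<psi> \<in> aut_disc"
proof -
  obtain \<phi>' where p: "\<phi>' \<in> aut_disc" "\<phi> holomorphic_on unit_disc" "\<phi>' holomorphic_on unit_disc"
    "\<And>z. cmod z < 1 \<Longrightarrow> cmod (\<phi> z) < 1" "\<And>z. cmod z < 1 \<Longrightarrow> cmod (\<phi>' z) < 1"
    "\<And>z. cmod z < 1 \<Longrightarrow> \<phi>' (\<phi> z) = z" "\<And>z. cmod z < 1 \<Longrightarrow> \<phi> (\<phi>' z) = z"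
    using aut_discE[OF assms(1)] by blast
  obtain \<psi>' where q: "\<psi>' \<in> aut_disc" "\<psi> holomorphic_on unit_disc" "\<psi>' holomorphic_on unit_disc"
    "\<And>z. cmod z < 1 \<Longrightarrow> cmod (\<psi> z) < 1" "\<And>z. cmod z < 1 \<Longrightarrow> cmod (\<psi>' z) < 1"
    "\<And>z. cmod z < 1 \<Longrightarrow> \<psi>' (\<psi> z) = z" "\<And>z. cmod z < 1 \<Longrightarrow> \<psi> (\<psi>' z) = z"
    using aut_discE[OF assms(2)] by blast
  show ?thesis
    by (rule aut_discI[of _ "\<psi>' \<circ> \<phi>'"])
       (use p q in \<open>auto intro!: holomorphic_on_compose_gen[where t=unit_disc]\<close>)
qed

lemma Moebius_function_aut_disc:
  assumes "cmod a < 1"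
  shows "Moebius_function 0 a \<in> aut_disc"
  by (rule aut_discI[of _ "Moebius_function 0 (- a)"])
    (use assms Moebius_function_holomorphic[of a] Moebius_function_holomorphic[of "-a"]
      Moebius_function_norm_lt_1 Moebius_function_inverse in \<open>auto simp: unit_disc_def\<close>)

lemma rotation_aut_disc:
  assumes "cmod c = 1"
  shows "(\<lambda>z. c * z) \<in> aut_disc"
proof -
  have "c \<noteq> 0" using assms by auto
  thus ?thesis using assms
    by (intro aut_discI[of _ "\<lambda>z. z / c"])
       (auto intro!: holomorphic_intros simp: norm_mult norm_divide)
qed

lemma pdist_aut_disc:
  assumes "\<phi> \<in> aut_disc" "cmod z < 1" "cmod w < 1"
  shows "pdist (\<phi> z) (\<phi> w) = pdist z w"
proof -
  obtain \<psi> where p: "\<phi> holomorphic_on unit_disc" "\<psi> holomorphic_on unit_disc"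
    "\<And>z. cmod z < 1 \<Longrightarrow> cmod (\<phi> z) < 1" "\<And>z. cmod z < 1 \<Longrightarrow> cmod (\<psi> z) < 1"
    "\<And>z. cmod z < 1 \<Longrightarrow> \<psi> (\<phi> z) = z"
    using aut_discE[OF assms(1)] by metis
  have "pdist (\<phi> z) (\<phi> w) \<le> pdist z w" using Schwarz_Pick p assms by blast
  moreover have "pdist (\<psi> (\<phi> z)) (\<psi> (\<phi> w)) \<le> pdist (\<phi> z) (\<phi> w)"
    using Schwarz_Pick p assms by blast
  ultimately show ?thesis using p assms by simp
qed

subsection \<open>Holomorphic functions of two variables\<close>

text \<open>Total differentiability with complex-linear derivative rather than separate holomorphy,
  so that the chain rule along analytic discs is immediate; \<open>Osgood\<close> provides it where
  only separate holomorphy is at hand.\<close>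

definition hol2 :: "(complex \<times> complex \<Rightarrow> complex) \<Rightarrow> (complex \<times> complex) set \<Rightarrow> bool" where
  "hol2 f U \<longleftrightarrow> (\<forall>z\<in>U. \<exists>a b. (f has_derivative (\<lambda>w. a * fst w + b * snd w)) (at z))"

definition biholo2 :: "(complex \<times> complex) set \<Rightarrow> (complex \<times> complex \<Rightarrow> complex \<times> complex) \<Rightarrow>
    (complex \<times> complex \<Rightarrow> complex \<times> complex) \<Rightarrow> bool" where
  "biholo2 U F G \<longleftrightarrow> holo2_on F U \<and> holo2_on G U \<and> F ` U \<subseteq> U \<and> G ` U \<subseteq> U \<and>
     (\<forall>z\<in>U. G (F z) = z \<and> F (G z) = z)"

lemma biholo2_sym: "biholo2 U F G \<Longrightarrow> biholo2 U G F"
  by (auto simp: biholo2_def)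

lemma complex_linear2_form:
  fixes L :: "complex \<times> complex \<Rightarrow> complex \<times> complex"
  assumes "linear L" "\<And>c w1 w2. L (c * w1, c * w2) = (c * fst (L (w1, w2)), c * snd (L (w1, w2)))"
  shows "L w = (fst (L (1, 0)) * fst w + fst (L (0, 1)) * snd w,
                snd (L (1, 0)) * fst w + snd (L (0, 1)) * snd w)"
proof -
  have "L w = L (fst w * 1, fst w * 0) + L (snd w * 0, snd w * 1)"
    using linear_add[OF assms(1), of "(fst w, 0)" "(0, snd w)"] by simp
  thus ?thesis unfolding assms(2) by (simp add: mult.commute)
qed

lemma holo2_on_iff: "holo2_on F U \<longleftrightarrow> hol2 (\<lambda>z. fst (F z)) U \<and> hol2 (\<lambda>z. snd (F z)) U"
proof
  assume F: "holo2_on F U"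
  have "\<exists>a b. ((\<lambda>z. fst (F z)) has_derivative (\<lambda>w. a * fst w + b * snd w)) (at z)"
       "\<exists>a b. ((\<lambda>z. snd (F z)) has_derivative (\<lambda>w. a * fst w + b * snd w)) (at z)" if "z \<in> U" for z
  proof -
    obtain L where L: "(F has_derivative L) (at z)"
      "\<And>c w1 w2. L (c * w1, c * w2) = (c * fst (L (w1, w2)), c * snd (L (w1, w2)))"
      using F \<open>z \<in> U\<close> unfolding holo2_on_def by metis
    note form = complex_linear2_form[OF has_derivative_linear[OF L(1)] L(2)]
    show "\<exists>a b. ((\<lambda>z. fst (F z)) has_derivative (\<lambda>w. a * fst w + b * snd w)) (at z)"
      using has_derivative_fst[OF L(1)] by (subst (asm) form) auto
    show "\<exists>a b. ((\<lambda>z. snd (F z)) has_derivative (\<lambda>w. a * fst w + b * snd w)) (at z)"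
      using has_derivative_snd[OF L(1)] by (subst (asm) form) auto
  qed
  thus "hol2 (\<lambda>z. fst (F z)) U \<and> hol2 (\<lambda>z. snd (F z)) U" by (auto simp: hol2_def)
next
  assume F: "hol2 (\<lambda>z. fst (F z)) U \<and> hol2 (\<lambda>z. snd (F z)) U"
  show "holo2_on F U" unfolding holo2_on_def
  proof
    fix z assume "z \<in> U"
    then obtain a b c d where
      "((\<lambda>z. fst (F z)) has_derivative (\<lambda>w. a * fst w + b * snd w)) (at z)"
      "((\<lambda>z. snd (F z)) has_derivative (\<lambda>w. c * fst w + d * snd w)) (at z)"
      using F unfolding hol2_def by blast
    from has_derivative_Pair[OF this]
    show "\<exists>L. (F has_derivative L) (at z) \<and>
      (\<forall>c::complex. \<forall>w1 w2. L (c * w1, c * w2) = (c * fst (L (w1, w2)), c * snd (L (w1, w2))))"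
      by (intro exI conjI) (auto simp: algebra_simps)
  qed
qed

lemma holo2_derivativeE:
  assumes "holo2_on F U" "z \<in> U"
  obtains a b c d where
    "(F has_derivative (\<lambda>w. (a * fst w + b * snd w, c * fst w + d * snd w))) (at z)"
proof -
  obtain a b c d where
      "((\<lambda>z. fst (F z)) has_derivative (\<lambda>w. a * fst w + b * snd w)) (at z)"
      "((\<lambda>z. snd (F z)) has_derivative (\<lambda>w. c * fst w + d * snd w)) (at z)"
    using assms unfolding holo2_on_iff hol2_def by blast
  from has_derivative_Pair[OF this] show thesis by (intro that) simp
qed

lemma hol2_subset: "hol2 f U \<Longrightarrow> V \<subseteq> U \<Longrightarrow> hol2 f V"
  by (auto simp: hol2_def)

lemma hol2_cong:
  assumes "open U" "\<And>z. z \<in> U \<Longrightarrow> f z = g z"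
  shows "hol2 f U \<longleftrightarrow> hol2 g U"
proof -
  have "(f has_derivative D) (at z) \<longleftrightarrow> (g has_derivative D) (at z)" if "z \<in> U" for z D
    using that assms by (metis has_derivative_transform_within_open)
  thus ?thesis by (auto simp: hol2_def)
qed

lemma holo2_on_cong:
  assumes "open U" "\<And>z. z \<in> U \<Longrightarrow> f z = g z"
  shows "holo2_on f U \<longleftrightarrow> holo2_on g U"
  unfolding holo2_on_iff using hol2_cong[OF assms(1)] assms(2) by (metis (no_types, lifting))

lemma hol2_continuous_on: "hol2 f U \<Longrightarrow> continuous_on U f"
  unfolding hol2_def by (intro continuous_at_imp_continuous_on) (metis has_derivative_continuous)

lemma holo2_continuous_on: "holo2_on F U \<Longrightarrow> continuous_on U F"
  unfolding holo2_on_def by (intro continuous_at_imp_continuous_on) (metis has_derivative_continuous)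

lemma hol2_compose:
  assumes F: "holo2_on F U" and f: "hol2 f V" and "F ` U \<subseteq> V"
  shows "hol2 (\<lambda>z. f (F z)) U"
  unfolding hol2_def
proof
  fix z assume z: "z \<in> U"
  obtain a b c d where 1:
    "(F has_derivative (\<lambda>w. (a * fst w + b * snd w, c * fst w + d * snd w))) (at z)"
    using holo2_derivativeE[OF F z] .
  obtain p q where 2: "(f has_derivative (\<lambda>w. p * fst w + q * snd w)) (at (F z))"
    using f z assms(3) unfolding hol2_def by blast
  from diff_chain_at[OF 1 2]
  have "((\<lambda>z. f (F z)) has_derivative (\<lambda>w. (p * a + q * c) * fst w + (p * b + q * d) * snd w)) (at z)"
    by (simp add: o_def algebra_simps)
  thus "\<exists>a b. ((\<lambda>z. f (F z)) has_derivative (\<lambda>w. a * fst w + b * snd w)) (at z)" by blast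
qed

lemma holo2_compose:
  assumes "holo2_on F U" "holo2_on G V" "F ` U \<subseteq> V"
  shows "holo2_on (\<lambda>z. G (F z)) U"
  using assms hol2_compose[OF assms(1) _ assms(3)] unfolding holo2_on_iff[of G] holo2_on_iff[of "\<lambda>z. G (F z)"]
  by blast

lemma has_field_derivative_hol2_disc:
  assumes "(f has_derivative (\<lambda>w. a * fst w + b * snd w)) (at (p z, q z))"
    and "(p has_field_derivative p') (at z)" "(q has_field_derivative q') (at z)"
  shows "((\<lambda>z. f (p z, q z)) has_field_derivative (a * p' + b * q')) (at z)"
proof -
  have "((\<lambda>z. (p z, q z)) has_derivative (\<lambda>h. (p' * h, q' * h))) (at z)"
    using assms(2,3) by (intro has_derivative_Pair) (simp_all add: has_field_derivative_def)
  from diff_chain_at[OF this assms(1)]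
  have "((\<lambda>z. f (p z, q z)) has_derivative (\<lambda>h. a * (p' * h) + b * (q' * h))) (at z)"
    by (simp add: o_def)
  then
  show ?thesis unfolding has_field_derivative_def
    by (rule has_derivative_eq_rhs) (auto simp: fun_eq_iff algebra_simps)
qed

text \<open>Restriction to analytic discs is how the one-variable Schwarz lemma, maximum principle
  and identity theorem reach functions of two variables.\<close>

lemma hol2_disc:
  assumes "hol2 f U" "p holomorphic_on S" "q holomorphic_on S" "open S"
    "\<And>z. z \<in> S \<Longrightarrow> (p z, q z) \<in> U"
  shows "(\<lambda>z. f (p z, q z)) holomorphic_on S"
  unfolding holomorphic_on_def
proof
  fix z assume z: "z \<in> S"
  obtain a b where "(f has_derivative (\<lambda>w. a * fst w + b * snd w)) (at (p z, q z))"
    using assms z unfolding hol2_def by blast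
  moreover have "(p has_field_derivative deriv p z) (at z)" "(q has_field_derivative deriv q z) (at z)"
    using assms z holomorphic_derivI by blast+
  ultimately show "(\<lambda>z. f (p z, q z)) field_differentiable at z within S"
    using has_field_derivative_hol2_disc field_differentiable_at_within field_differentiable_def by blast
qed

lemma hol2_fst: "hol2 fst U"
  unfolding hol2_def
proof
  fix z :: "complex \<times> complex"
  have "(fst has_derivative (\<lambda>w. 1 * fst w + 0 * snd w)) (at z)"
    using has_derivative_fst[OF has_derivative_ident] by simp
  thus "\<exists>a b. (fst has_derivative (\<lambda>w. a * fst w + b * snd w)) (at z)" by blast
qed

lemma hol2_snd: "hol2 snd U"
  unfolding hol2_def
proof
  fix z :: "complex \<times> complex"
  have "(snd has_derivative (\<lambda>w. 0 * fst w + 1 * snd w)) (at z)"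
    using has_derivative_snd[OF has_derivative_ident] by simp
  thus "\<exists>a b. (snd has_derivative (\<lambda>w. a * fst w + b * snd w)) (at z)" by blast
qed

lemma hol2_of_fst:
  assumes "p holomorphic_on S" "open S" "fst ` U \<subseteq> S"
  shows "hol2 (\<lambda>z. p (fst z)) U"
  unfolding hol2_def
proof
  fix z assume "z \<in> U"
  hence "(p has_field_derivative deriv p (fst z)) (at (fst z))"
    using assms holomorphic_derivI by blast
  from diff_chain_at[OF has_derivative_fst[OF has_derivative_ident] this[unfolded has_field_derivative_def]]
  have "((\<lambda>z. p (fst z)) has_derivative (\<lambda>w. deriv p (fst z) * fst w + 0 * snd w)) (at z)"
    by (simp add: o_def)
  thus "\<exists>a b. ((\<lambda>z. p (fst z)) has_derivative (\<lambda>w. a * fst w + b * snd w)) (at z)" by blast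
qed

lemma hol2_of_snd:
  assumes "p holomorphic_on S" "open S" "snd ` U \<subseteq> S"
  shows "hol2 (\<lambda>z. p (snd z)) U"
  unfolding hol2_def
proof
  fix z assume "z \<in> U"
  hence "(p has_field_derivative deriv p (snd z)) (at (snd z))"
    using assms holomorphic_derivI by blast
  from diff_chain_at[OF has_derivative_snd[OF has_derivative_ident] this[unfolded has_field_derivative_def]]
  have "((\<lambda>z. p (snd z)) has_derivative (\<lambda>w. 0 * fst w + deriv p (snd z) * snd w)) (at z)"
    by (simp add: o_def)
  thus "\<exists>a b. ((\<lambda>z. p (snd z)) has_derivative (\<lambda>w. a * fst w + b * snd w)) (at z)" by blast
qed

lemma hol2_add:
  assumes "hol2 f U" "hol2 g U"
  shows "hol2 (\<lambda>z. f z + g z) U"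
  unfolding hol2_def
proof
  fix z assume "z \<in> U"
  then obtain a b c d where
    "(f has_derivative (\<lambda>w. a * fst w + b * snd w)) (at z)"
    "(g has_derivative (\<lambda>w. c * fst w + d * snd w)) (at z)" using assms unfolding hol2_def by blast
  from has_derivative_add[OF this]
  have "((\<lambda>z. f z + g z) has_derivative (\<lambda>w. (a + c) * fst w + (b + d) * snd w)) (at z)"
    by (simp add: algebra_simps)
  thus "\<exists>a b. ((\<lambda>z. f z + g z) has_derivative (\<lambda>w. a * fst w + b * snd w)) (at z)" by blast
qed

lemma hol2_cmult:
  assumes "hol2 f U"
  shows "hol2 (\<lambda>z. k * f z) U"
  unfolding hol2_def
proof
  fix z assume "z \<in> U"
  then obtain a b where
    "(f has_derivative (\<lambda>w. a * fst w + b * snd w)) (at z)" using assms unfolding hol2_def by blast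
  from has_derivative_mult_right[OF this, of k]
  have "((\<lambda>z. k * f z) has_derivative (\<lambda>w. (k * a) * fst w + (k * b) * snd w)) (at z)"
    by (simp add: algebra_simps)
  thus "\<exists>a b. ((\<lambda>z. k * f z) has_derivative (\<lambda>w. a * fst w + b * snd w)) (at z)" by blast
qed

lemma hol2_diff:
  assumes "hol2 f U" "hol2 g U"
  shows "hol2 (\<lambda>z. f z - g z) U"
  using hol2_add[OF assms(1) hol2_cmult[OF assms(2), of "-1"]] by simp

lemma hol2_comp1:
  assumes "p holomorphic_on S" "open S" "hol2 f U" "f ` U \<subseteq> S"
  shows "hol2 (\<lambda>z. p (f z)) U"
  unfolding hol2_def
proof
  fix z assume z: "z \<in> U"
  then obtain a b where f: "(f has_derivative (\<lambda>w. a * fst w + b * snd w)) (at z)"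
    using assms(3) unfolding hol2_def by blast
  have "(p has_field_derivative deriv p (f z)) (at (f z))"
    using assms z holomorphic_derivI by blast
  from diff_chain_at[OF f this[unfolded has_field_derivative_def]]
  have "((\<lambda>z. p (f z)) has_derivative (\<lambda>w. (deriv p (f z) * a) * fst w + (deriv p (f z) * b) * snd w)) (at z)"
    by (simp add: o_def algebra_simps)
  thus "\<exists>a b. ((\<lambda>z. p (f z)) has_derivative (\<lambda>w. a * fst w + b * snd w)) (at z)" by blast
qed

lemma hol2_mult:
  assumes "hol2 f U" "hol2 g U"
  shows "hol2 (\<lambda>z. f z * g z) U"
  unfolding hol2_def
proof
  fix z assume "z \<in> U"
  then obtain a b c d where
    "(f has_derivative (\<lambda>w. a * fst w + b * snd w)) (at z)"
    "(g has_derivative (\<lambda>w. c * fst w + d * snd w)) (at z)" using assms unfolding hol2_def by blast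
  from has_derivative_mult[OF this]
  have "((\<lambda>z. f z * g z) has_derivative (\<lambda>w. (f z * c + a * g z) * fst w + (f z * d + b * g z) * snd w)) (at z)"
    by (rule has_derivative_eq_rhs) (simp add: fun_eq_iff algebra_simps)
  thus "\<exists>a b. ((\<lambda>z. f z * g z) has_derivative (\<lambda>w. a * fst w + b * snd w)) (at z)" by blast
qed

lemma hol2_divide:
  assumes "hol2 f U" "hol2 g U" "\<And>z. z \<in> U \<Longrightarrow> g z \<noteq> 0"
  shows "hol2 (\<lambda>z. f z / g z) U"
proof -
  have "hol2 (\<lambda>z. inverse (g z)) U"
    by (rule hol2_comp1[of inverse "- {0}"]) (use assms in \<open>auto intro!: holomorphic_intros\<close>)
  from hol2_mult[OF assms(1) this] show ?thesis by (simp add: divide_inverse)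
qed

section \<open>Automorphisms as pairs of mutually inverse maps\<close>

lemma aut2_iff:
  assumes U: "open U"
  shows "F \<in> aut2 U \<longleftrightarrow> (\<exists>G. biholo2 U F G)"
proof
  assume F: "F \<in> aut2 U"
  hence b: "bij_betw F U U" by (simp add: aut2_def)
  have "inv_into U F ` U \<subseteq> U" using bij_betw_inv_into[OF b] by (simp add: bij_betw_def)
  hence "biholo2 U F (inv_into U F)"
    using F b by (auto simp: aut2_def biholo2_def bij_betw_inv_into_left bij_betw_inv_into_right bij_betwE)
  thus "\<exists>G. biholo2 U F G" by blast
next
  assume "\<exists>G. biholo2 U F G"
  then obtain G where G: "biholo2 U F G" by blast
  have b: "bij_betw F U U"
    by (rule bij_betw_byWitness[of _ G]) (use G in \<open>auto simp: biholo2_def\<close>)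
  have "inv_into U F z = G z" if "z \<in> U" for z
    using b G that unfolding biholo2_def by (metis bij_betw_inv_into_left image_subset_iff)
  hence "holo2_on (inv_into U F) U"
    using G holo2_on_cong[OF U, of "inv_into U F" G] by (simp add: biholo2_def)
  thus "F \<in> aut2 U" using G b by (simp add: aut2_def biholo2_def)
qed

lemma biholo2_comp:
  assumes "biholo2 U F F'" "biholo2 U G G'"
  shows "biholo2 U (\<lambda>z. F (G z)) (\<lambda>z. G' (F' z))"
  using assms holo2_compose[of G U F U] holo2_compose[of F' U G' U]
  by (auto simp: biholo2_def image_subset_iff)

lemma biholo2_cong:
  assumes "open U" "\<And>z. z \<in> U \<Longrightarrow> F z = F' z" "biholo2 U F G"
  shows "biholo2 U F' G"
  using assms(3,2) holo2_on_cong[OF assms(1), of F F'] unfolding biholo2_def image_subset_iff by metis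

lemma diag_map_simp [simp]: "diag_map \<phi> (a, b) = (\<phi> a, \<phi> b)"
  by (simp add: diag_map_def)

lemma sigma_simp [simp]: "sigma (a, b) = (b, a)"
  by (simp add: sigma_def)

lemma holo2_diag_map:
  assumes "\<phi> holomorphic_on unit_disc" "\<psi> holomorphic_on unit_disc" "U \<subseteq> unit_disc \<times> unit_disc"
  shows "holo2_on (\<lambda>z. (\<phi> (fst z), \<psi> (snd z))) U"
  unfolding holo2_on_iff using assms
  by (auto intro!: hol2_of_fst[where S=unit_disc] hol2_of_snd[where S=unit_disc])

lemma holo2_swap: "holo2_on (\<lambda>z. (snd z, fst z)) U"
  unfolding holo2_on_iff using hol2_fst hol2_snd by auto

lemma biholo2_diag_map:
  assumes "\<phi> \<in> aut_disc" "U = Dr r \<or> U = Dst s t"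
  obtains \<psi> where "\<psi> \<in> aut_disc" "\<And>z. cmod z < 1 \<Longrightarrow> \<psi> (\<phi> z) = z"
    "\<And>z. cmod z < 1 \<Longrightarrow> \<phi> (\<psi> z) = z" "biholo2 U (diag_map \<phi>) (diag_map \<psi>)"
proof -
  obtain \<psi> where p: "\<psi> \<in> aut_disc" "\<phi> holomorphic_on unit_disc" "\<psi> holomorphic_on unit_disc"
    "\<And>z. cmod z < 1 \<Longrightarrow> cmod (\<phi> z) < 1" "\<And>z. cmod z < 1 \<Longrightarrow> cmod (\<psi> z) < 1"
    "\<And>z. cmod z < 1 \<Longrightarrow> \<psi> (\<phi> z) = z" "\<And>z. cmod z < 1 \<Longrightarrow> \<phi> (\<psi> z) = z"
    using aut_discE[OF assms(1)] by blast
  have e: "diag_map f = (\<lambda>z. (f (fst z), f (snd z)))" for f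
    by (auto simp: diag_map_def)
  have sub: "U \<subseteq> unit_disc \<times> unit_disc" using assms(2) by (auto simp: Dr_def Dst_def)
  have "biholo2 U (diag_map \<phi>) (diag_map \<psi>)"
    unfolding biholo2_def e using p sub holo2_diag_map[of \<phi> \<phi> U] holo2_diag_map[of \<psi> \<psi> U]
      pdist_aut_disc[OF p(1)] pdist_aut_disc[OF assms(1)] assms(2)
    by (auto simp: Dr_iff Dst_iff)
  thus thesis using that p by blast
qed

lemma biholo2_sigma:
  assumes "U = Dr r \<or> U = Dst s t"
  shows "biholo2 U sigma sigma"
proof -
  have e: "sigma = (\<lambda>z. (snd z, fst z))" by (auto simp: sigma_def)
  show ?thesis unfolding e using assms holo2_swap by (auto simp: biholo2_def Dr_iff Dst_iff pdist_sym)
qed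

subsection \<open>Osgood's lemma\<close>

lemma Schwarz_bound:
  assumes f: "f holomorphic_on ball a d" "f a = 0" "\<And>z. z \<in> ball a d \<Longrightarrow> cmod (f z) \<le> M"
    and z: "z \<in> ball a d"
  shows "cmod (f z) \<le> M * (cmod (z - a) / d)"
proof (rule field_le_epsilon)
  fix e :: real assume e: "e > 0"
  have d: "d > 0" using z by (metis ball_eq_empty empty_iff not_le)
  have M: "0 \<le> M" using f(3)[OF z] norm_ge_zero order_trans by blast
  \<comment> \<open>Dividing by \<open>M + e\<close> instead of \<open>M\<close> makes the bound
    strict, as the Schwarz lemma demands, and covers \<open>M = 0\<close>.\<close>
  define g where "g x = f (a + of_real d * x) / of_real (M + e)" for x
  have im: "a + of_real d * x \<in> ball a d" if "cmod x < 1" for x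
    using that d by (simp add: dist_norm norm_mult)
  have "g holomorphic_on ball 0 1" unfolding g_def
    using im M e by (intro holomorphic_intros holomorphic_on_compose_gen[OF _ f(1), unfolded o_def]) auto
  moreover have "g 0 = 0" by (simp add: g_def f)
  moreover have "cmod (g x) < 1" if "cmod x < 1" for x
    using f(3)[OF im[OF that]] M e by (simp add: g_def norm_divide del: of_real_add)
  moreover have "cmod ((z - a) / of_real d) < 1" using z d by (simp add: norm_divide dist_norm norm_minus_commute)
  ultimately have "cmod (g ((z - a) / of_real d)) \<le> cmod ((z - a) / of_real d)"
    using Schwarz_Lemma(1) by blast
  hence "cmod (f z) / (M + e) \<le> cmod (z - a) / d"
    using d M e by (simp add: g_def norm_divide del: of_real_add)
  hence "cmod (f z) \<le> (cmod (z - a) / d) * (M + e)"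
    using M e by (simp add: pos_divide_le_eq)
  also have "\<dots> = M * (cmod (z - a) / d) + (cmod (z - a) / d) * e"
    by (simp add: algebra_simps add_divide_distrib)
  also have "(cmod (z - a) / d) * e \<le> 1 * e"
    using z d e by (intro mult_right_mono) (auto simp: dist_norm norm_minus_commute)
  finally show "cmod (f z) \<le> M * (cmod (z - a) / d) + e" by simp
qed

text \<open>The vanishing derivative means that the quotient \<open>f z / z\<close> again vanishes
  at 0. The first order bound on \<open>f\<close> gives \<open>M / d\<close> for this quotient, and
  a second application of \<open>Schwarz_bound\<close> gives the square.\<close>

lemma Schwarz_bound_order2:
  assumes f: "f holomorphic_on ball 0 d" "f 0 = 0" "deriv f 0 = 0"
     "\<And>z. z \<in> ball 0 d \<Longrightarrow> cmod (f z) \<le> M" and z: "z \<in> ball 0 d"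
  shows "cmod (f z) \<le> M * (cmod z / d)^2"
proof -
  have d: "d > 0" using z by (metis ball_eq_empty empty_iff not_le)
  have M: "0 \<le> M" using f(4)[OF z] norm_ge_zero order_trans by blast
  obtain h where h: "h holomorphic_on ball 0 d" "\<And>z. norm z < d \<Longrightarrow> f z = z * h z" "deriv f 0 = h 0"
    using Schwarz3[OF f(1,2)] by blast
  have "cmod (h x) \<le> M / d" if "x \<in> ball 0 d" for x
  proof (cases "x = 0")
    case True thus ?thesis using h f M d by simp
  next
    case False
    have "cmod x * cmod (h x) \<le> M * (cmod x / d)"
      using Schwarz_bound[OF f(1,2,4) that] h(2)[of x] that by (simp add: norm_mult)
    hence "cmod x * cmod (h x) \<le> cmod x * (M / d)" by (simp add: mult.commute)
    thus ?thesis using False by (metis mult_le_cancel_left_pos zero_less_norm_iff)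
  qed
  hence "cmod (h z) \<le> M / d * (cmod (z - 0) / d)"
    using h f z by (intro Schwarz_bound) auto
  hence "cmod z * cmod (h z) \<le> cmod z * (M / d * (cmod z / d))" by (intro mult_left_mono) auto
  thus ?thesis using h(2)[of z] z by (simp add: norm_mult power2_eq_square field_simps)
qed

lemma has_derivative_zero_of_quadratic:
  fixes h :: "'a::real_normed_vector \<Rightarrow> 'b::real_normed_vector"
  assumes "open S" "x \<in> S" "\<And>y. y \<in> S \<Longrightarrow> norm (h y) \<le> C * (norm (y - x))^2"
  shows "(h has_derivative (\<lambda>_. 0)) (at x)"
proof -
  have hx: "h x = 0" using assms(3)[OF assms(2)] by simp
  have ev: "eventually (\<lambda>y. y \<in> S) (at x)" using assms eventually_at_in_open' by blast
  have "((\<lambda>y. norm (h y - h x - 0) / norm (y - x)) \<longlongrightarrow> 0) (at x)"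
  proof (rule tendsto_sandwich[of "\<lambda>_. 0" _ _ "\<lambda>y. C * norm (y - x)"])
    show "eventually (\<lambda>y. norm (h y - h x - 0) / norm (y - x) \<le> C * norm (y - x)) (at x)"
    proof (rule eventually_mono[OF ev])
      fix y assume y: "y \<in> S"
      show "norm (h y - h x - 0) / norm (y - x) \<le> C * norm (y - x)"
      proof (cases "y = x")
        case False
        thus ?thesis using assms(3)[OF y] hx by (simp add: divide_le_eq power2_eq_square mult.assoc)
      qed simp
    qed
    have "((\<lambda>y. C * norm (y - x)) \<longlongrightarrow> C * norm (x - x)) (at x)" by (intro tendsto_intros)
    thus "((\<lambda>y. C * norm (y - x)) \<longlongrightarrow> 0) (at x)" by simp
  qed auto
  thus ?thesis by (simp add: has_derivative_iff_norm)
qed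

text \<open>The mixed second difference of a bounded separately holomorphic function vanishes
  on both coordinate axes, so two applications of the Schwarz lemma bound it by
  a multiple of the product of the increments.\<close>

lemma Osgood:
  fixes f :: "complex \<times> complex \<Rightarrow> complex"
  assumes d: "d > 0"
    and h1: "\<And>w. w \<in> ball b d \<Longrightarrow> (\<lambda>z. f (z, w)) holomorphic_on ball a d"
    and h2: "\<And>z. z \<in> ball a d \<Longrightarrow> (\<lambda>w. f (z, w)) holomorphic_on ball b d"
    and M: "\<And>z w. z \<in> ball a d \<Longrightarrow> w \<in> ball b d \<Longrightarrow> cmod (f (z, w)) \<le> M"
  shows "\<exists>p q. (f has_derivative (\<lambda>w. p * fst w + q * snd w)) (at (a, b))"
proof -
  define h where "h z w = f (z, w) - f (a, w) - f (z, b) + f (a, b)" for z w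
  have ab: "a \<in> ball a d" "b \<in> ball b d" using d by auto
  have b4: "cmod (h z w) \<le> 4 * M" if "z \<in> ball a d" "w \<in> ball b d" for z w
  proof -
    have "cmod (h z w) \<le> cmod (f (z, w)) + cmod (f (a, w)) + cmod (f (z, b)) + cmod (f (a, b))"
      unfolding h_def by (smt (verit) norm_triangle_ineq norm_triangle_ineq4)
    thus ?thesis using M[OF that] M[OF ab(1) that(2)] M[OF that(1) ab(2)] M[OF ab] by linarith
  qed
  have hb: "cmod (h z w) \<le> 4 * M * (cmod (w - b) / d)" if "z \<in> ball a d" "w \<in> ball b d" for z w
  proof (rule Schwarz_bound[of "h z" b d])
    show "h z holomorphic_on ball b d" unfolding h_def[abs_def]
      by (intro holomorphic_intros h2 that ab)
  qed (use that b4 in \<open>auto simp: h_def\<close>)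
  have hbb: "cmod (h z w) \<le> 4 * M * (cmod (w - b) / d) * (cmod (z - a) / d)"
    if "z \<in> ball a d" "w \<in> ball b d" for z w
  proof (rule Schwarz_bound[of "\<lambda>z. h z w" a d])
    show "(\<lambda>z. h z w) holomorphic_on ball a d" unfolding h_def[abs_def]
      by (intro holomorphic_intros h1 that ab)
  qed (use that hb in \<open>auto simp: h_def\<close>)
  have M0: "0 \<le> M" using M[OF ab] norm_ge_zero order_trans by blast
  have hq: "cmod (h (fst y) (snd y)) \<le> (4 * M / d^2) * (norm (y - (a, b)))^2"
    if y: "y \<in> ball a d \<times> ball b d" for y
  proof -
    have "cmod (h (fst y) (snd y)) \<le> (4 * M / d^2) * (cmod (snd y - b) * cmod (fst y - a))"
      using hbb[of "fst y" "snd y"] y by (auto simp: power2_eq_square field_simps)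
    also have "\<dots> \<le> (4 * M / d^2) * (norm (y - (a, b)) * norm (y - (a, b)))"
      using M0 norm_snd_le[of "snd y - b" "fst y - a"] norm_fst_le[of "fst y - a" "snd y - b"]
      by (intro mult_left_mono mult_mono) (auto simp: minus_prod_def)
    finally show ?thesis by (simp add: power2_eq_square)
  qed
  have D0: "((\<lambda>y. h (fst y) (snd y)) has_derivative (\<lambda>_. 0)) (at (a, b))"
    by (rule has_derivative_zero_of_quadratic[of "ball a d \<times> ball b d", OF _ _ hq])
       (use d in \<open>auto simp: open_Times\<close>)
  have "((\<lambda>z. f (z, b)) has_field_derivative deriv (\<lambda>z. f (z, b)) a) (at a)"
    using holomorphic_derivI[OF h1[OF ab(2)] _ ab(1)] by simp
  hence D1: "((\<lambda>y. f (fst y, b)) has_derivative (\<lambda>w. deriv (\<lambda>z. f (z, b)) a * fst w)) (at (a, b))"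
    using diff_chain_at[OF has_derivative_fst[OF has_derivative_ident], where x="(a,b)" and g="\<lambda>z. f (z, b)"]
    by (simp add: has_field_derivative_def o_def)
  have "((\<lambda>w. f (a, w)) has_field_derivative deriv (\<lambda>w. f (a, w)) b) (at b)"
    using holomorphic_derivI[OF h2[OF ab(1)] _ ab(2)] by simp
  hence D2: "((\<lambda>y. f (a, snd y)) has_derivative (\<lambda>w. deriv (\<lambda>w. f (a, w)) b * snd w)) (at (a, b))"
    using diff_chain_at[OF has_derivative_snd[OF has_derivative_ident], where x="(a,b)" and g="\<lambda>w. f (a, w)"]
    by (simp add: has_field_derivative_def o_def)
  have e: "f = (\<lambda>y. h (fst y) (snd y) + f (a, snd y) + f (fst y, b) - f (a, b))"
    by (auto simp: h_def fun_eq_iff)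
  have "(f has_derivative (\<lambda>w. 0 + deriv (\<lambda>w. f (a, w)) b * snd w + deriv (\<lambda>z. f (z, b)) a * fst w - 0)) (at (a, b))"
    by (subst e) (intro has_derivative_diff has_derivative_add D0 D1 D2 has_derivative_const)
  hence "(f has_derivative (\<lambda>w. deriv (\<lambda>z. f (z, b)) a * fst w + deriv (\<lambda>w. f (a, w)) b * snd w)) (at (a, b))"
    by (simp add: add.commute)
  thus ?thesis by blast
qed

subsection \<open>Cartan's theorem on circular domains\<close>

definition cscale :: "complex \<Rightarrow> complex \<times> complex \<Rightarrow> complex \<times> complex" where
  "cscale c z = (c * fst z, c * snd z)"

text \<open>Complete circular domains: allowing the whole closed disc of factors makes the slices by
  complex lines through 0 starlike.\<close>

definition balanced2 :: "(complex \<times> complex) set \<Rightarrow> bool" where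
  "balanced2 U \<longleftrightarrow> (\<forall>z\<in>U. \<forall>c. cmod c \<le> 1 \<longrightarrow> cscale c z \<in> U)"

lemma norm_cscale [simp]: "norm (cscale c z) = cmod c * norm z"
proof -
  have "sqrt ((cmod c)^2 * ((cmod (fst z))^2 + (cmod (snd z))^2)) = cmod c * norm z"
    by (simp add: real_sqrt_mult norm_prod_def)
  thus ?thesis by (simp add: cscale_def norm_Pair norm_mult power_mult_distrib distrib_left)
qed

lemma cscale_simps [simp]: "cscale 1 z = z" "cscale 0 z = 0" "cscale c 0 = 0"
  "cscale c (cscale c' z) = cscale (c * c') z" "fst (cscale c z) = c * fst z" "snd (cscale c z) = c * snd z"
  by (simp_all add: cscale_def zero_prod_def mult.assoc)

lemma has_derivative_cscale: "(cscale c has_derivative cscale c) (at z)"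
  unfolding cscale_def[abs_def]
  by (intro has_derivative_Pair has_derivative_mult_right has_derivative_fst has_derivative_snd has_derivative_ident)

text \<open>Vanishing to second order makes the Lipschitz constant on the ball of radius
  \<open>e\<close> proportional to \<open>e\<close>, with a factor depending only on the bound
  \<open>M\<close> and on \<open>d\<close>. It can therefore be made small for a whole bounded
  family at once.\<close>

lemma hol2_Lipschitz:
  fixes x y :: "complex \<times> complex"
  assumes f: "hol2 f (ball 0 d)" "f 0 = 0" "(f has_derivative (\<lambda>_. 0)) (at 0)"
    "\<And>x. x \<in> ball 0 d \<Longrightarrow> cmod (f x) \<le> M"
   and e: "0 < e" "2 * e \<le> d" and x: "norm x < e" and y: "norm y < e"
  shows "cmod (f x - f y) \<le> 8 * M * e / d^2 * norm (x - y)"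
proof -
  have d: "d > 0" using e by simp
  have M: "0 \<le> M" using f(4)[of 0] d norm_ge_zero order_trans by (metis centre_in_ball)
  have q: "cmod (f x) \<le> M * (norm x / d)^2" if x: "norm x < d" for x
  proof (cases "x = 0")
    case True thus ?thesis using f by simp
  next
    case False
    define g where "g l = f (l * fst x, l * snd x)" for l
    have in_ball: "cscale l x \<in> ball 0 d" if "l \<in> ball 0 (d / norm x)" for l
      using that False by (simp add: field_simps)
    hence g: "g holomorphic_on ball 0 (d / norm x)"
      unfolding g_def using f by (intro hol2_disc[OF f(1)]) (auto intro!: holomorphic_intros simp: cscale_def)
    have g0: "g 0 = 0" using f by (simp add: g_def zero_prod_def)
    have "(f has_derivative (\<lambda>w. 0 * fst w + 0 * snd w)) (at (0 * fst x, 0 * snd x))"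
      using f(3) by (simp add: zero_prod_def)
    hence "(g has_field_derivative 0 * fst x + 0 * snd x) (at 0)"
      unfolding g_def by (rule has_field_derivative_hol2_disc) (auto intro!: derivative_eq_intros)
    hence "deriv g 0 = 0" using DERIV_imp_deriv by fastforce
    moreover have "cmod (g l) \<le> M" if "l \<in> ball 0 (d / norm x)" for l
      using f(4)[OF in_ball[OF that]] by (simp add: g_def cscale_def)
    moreover have "1 < d / norm x" using x False by (simp add: field_simps)
    ultimately have "cmod (g 1) \<le> M * (cmod 1 / (d / norm x))^2"
      using g g0 by (intro Schwarz_bound_order2) auto
    thus ?thesis by (simp add: g_def)
  qed
  show ?thesis
  proof (cases "x = y")
    case False
    \<comment> \<open>Radius of the parameter disc on which the complex line through
      \<open>y\<close> and \<open>x\<close> stays within \<open>2 * e\<close> of 0, where the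
      modulus of \<open>f\<close> is at most \<open>K\<close>. If \<open>T \<le> 1\<close> the
      Schwarz bound does not reach parameter 1, but then the trivial bound \<open>2 * K\<close>
      suffices.\<close>
    define T where "T = e / norm (x - y)"
    have T: "T > 0" using False e by (simp add: T_def)
    define K where "K = M * (2 * e / d)^2"
    have K: "K \<ge> 0" using M by (simp add: K_def)
    have qe: "cmod (f x) \<le> K" if "norm x < 2 * e" for x
    proof -
      have "M * (norm x / d)^2 \<le> K" unfolding K_def using that M d
        by (intro mult_left_mono power_mono divide_right_mono) auto
      thus ?thesis using q[of x] that e by linarith
    qed
    have "cmod (f x - f y) \<le> 2 * K * (1 / T)"
    proof (cases "T > 1")
      case True
      define g where "g l = f (fst y + l * fst (x - y), snd y + l * snd (x - y)) - f y" for l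
      have in_ball: "norm (y + cscale l (x - y)) < 2 * e" if "l \<in> ball 0 T" for l
      proof -
        have "norm (y + cscale l (x - y)) \<le> norm y + cmod l * norm (x - y)"
          using norm_triangle_ineq[of y "cscale l (x - y)"] by simp
        also have "cmod l * norm (x - y) \<le> e" using that False by (simp add: T_def field_simps)
        finally show ?thesis using y by simp
      qed
      have eq: "(fst y + l * fst (x - y), snd y + l * snd (x - y)) = y + cscale l (x - y)" for l
        by (simp add: cscale_def plus_prod_def)
      have "g holomorphic_on ball 0 T"
        unfolding g_def
      proof (intro holomorphic_intros hol2_disc[OF f(1)])
        fix l :: complex assume "l \<in> ball 0 T"
        thus "(fst y + l * fst (x - y), snd y + l * snd (x - y)) \<in> ball 0 d"
          using in_ball[of l] e unfolding eq by auto
      qed auto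
      moreover have "g 0 = 0" by (simp add: g_def)
      moreover have "cmod (g l) \<le> 2 * K" if "l \<in> ball 0 T" for l
      proof -
        have "cmod (g l) \<le> cmod (f (y + cscale l (x - y))) + cmod (f y)"
          unfolding g_def eq by (rule norm_triangle_ineq4)
        thus ?thesis using qe[OF in_ball[OF that]] qe[of y] y e by simp
      qed
      ultimately have "cmod (g 1) \<le> 2 * K * (cmod (1 - 0) / T)"
        using True by (intro Schwarz_bound[of g 0 T]) auto
      thus ?thesis by (simp add: g_def)
    next
      case False
      have "cmod (f x - f y) \<le> cmod (f x) + cmod (f y)" by (rule norm_triangle_ineq4)
      also have "\<dots> \<le> 2 * K * 1" using qe[of x] qe[of y] x y e by simp
      also have "\<dots> \<le> 2 * K * (1 / T)" using K T False by (intro mult_left_mono) auto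
      finally show ?thesis .
    qed
    also have "\<dots> = 8 * M * e / d^2 * norm (x - y)"
      using e d False by (simp add: K_def T_def power2_eq_square field_simps)
    finally show ?thesis .
  qed simp
qed

lemma connected_balanced2_slice:
  assumes "balanced2 U"
  shows "connected {l. cscale l z \<in> U}"
proof (cases "{l. cscale l z \<in> U} = {}")
  case False
  then obtain l where l: "cscale l z \<in> U" by blast
  have "cscale 0 (cscale l z) \<in> U" using assms l unfolding balanced2_def by (metis norm_zero zero_le_one)
  hence 0: "0 \<in> {l. cscale l z \<in> U}" by simp
  have "starlike {l. cscale l z \<in> U}"
    unfolding starlike_def
  proof (rule bexI[OF _ 0], intro ballI subsetI)
    fix x y assume x: "x \<in> {l. cscale l z \<in> U}" and "y \<in> closed_segment 0 x"
    then obtain t where t: "y = of_real t * x" "0 \<le> t" "t \<le> 1"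
      by (auto simp: closed_segment_def scaleR_conv_of_real)
    have "cscale (of_real t) (cscale x z) \<in> U" using assms x t unfolding balanced2_def
      by (metis mem_Collect_eq norm_of_real abs_of_nonneg)
    thus "y \<in> {l. cscale l z \<in> U}" by (simp add: t)
  qed
  thus ?thesis by (rule starlike_imp_connected)
qed simp

lemma open_balanced2_slice:
  assumes "open U"
  shows "open {l. cscale l z \<in> U}"
proof -
  have "continuous_on UNIV (\<lambda>l. cscale l z)" unfolding cscale_def by (intro continuous_intros)
  hence "open ((\<lambda>l. cscale l z) -` U)" using assms open_vimage by blast
  thus ?thesis by (simp add: vimage_def)
qed

lemma hol2_slice:
  assumes "hol2 f U" "open U"
  shows "(\<lambda>l. f (cscale l z)) holomorphic_on {l. cscale l z \<in> U}"
  unfolding cscale_def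
  by (rule hol2_disc[OF assms(1)])
     (use open_balanced2_slice[OF assms(2)] in \<open>auto intro!: holomorphic_intros simp: cscale_def\<close>)

lemma funpow_holo2:
  assumes G: "holo2_on G U" "G ` U \<subseteq> U"
  shows "holo2_on (G ^^ n) U \<and> (G ^^ n) ` U \<subseteq> U"
proof (induction n)
  case 0
  thus ?case by (simp add: holo2_on_iff hol2_fst hol2_snd)
next
  case (Suc n)
  have "holo2_on (\<lambda>z. G ((G ^^ n) z)) U"
    using Suc G(1) holo2_compose[of "G ^^ n" U G U] by blast
  moreover have "(G ^^ Suc n) ` U \<subseteq> U" using Suc G(2) unfolding image_subset_iff by simp
  moreover have "G ^^ Suc n = (\<lambda>z. G ((G ^^ n) z))" by (simp add: o_def)
  ultimately show ?case by simp
qed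

text \<open>The averages of the iterates of G are uniformly Lipschitz-close to the identity near 0,
  while precomposing the N-th average with G changes it only by O(1/N).\<close>

lemma Cartan_unique:
  assumes U: "open U" "balanced2 U" "0 \<in> U" "\<And>z. z \<in> U \<Longrightarrow> norm z \<le> B"
    and G: "holo2_on G U" "G ` U \<subseteq> U" "G 0 = 0" "(G has_derivative (\<lambda>w. w)) (at 0)"
    and z: "z \<in> U"
  shows "G z = z"
proof -
  obtain d where d: "d > 0" "ball 0 d \<subseteq> U" using U by (meson openE)
  have B: "B \<ge> 0" using U(3,4) norm_ge_zero order_trans by blast
  \<comment> \<open>The averages \<open>E N\<close> below are bounded by \<open>2 * B\<close>, so
    \<open>hol2_Lipschitz\<close> gives each coordinate the constant
    \<open>16 * B * e / d^2 \<le> 1 / 4\<close> and both together \<open>1 / 2\<close>, small enough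
    to be absorbed. \<open>B + 1\<close> avoids division by 0.\<close>
  define e where "e = min (d / 2) (d^2 / (64 * (B + 1)))"
  have e: "e > 0" "2 * e \<le> d" using d B by (auto simp: e_def min_def divide_simps)
  have eB: "16 * B * e / d^2 \<le> 1 / 4"
  proof -
    have "e \<le> d^2 / (64 * (B + 1))" by (simp add: e_def)
    hence "64 * (B * e + e) \<le> d^2" using B by (simp add: pos_le_divide_eq algebra_simps)
    hence "64 * (B * e) + 64 * e \<le> d^2" by (simp add: distrib_left)
    moreover have "0 \<le> 64 * e" using e by simp
    ultimately have "64 * (B * e) \<le> d^2" by linarith
    thus ?thesis using d by (simp add: divide_simps algebra_simps)
  qed
  have it: "holo2_on (G ^^ n) U" "(G ^^ n) x \<in> U" if "x \<in> U" for n x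
    using funpow_holo2[OF G(1,2), of n] that by auto
  have it0: "(G ^^ n) 0 = 0" for n by (induction n) (simp_all add: G)
  have itd: "((G ^^ n) has_derivative (\<lambda>w. w)) (at 0)" for n
  proof (induction n)
    case (Suc n)
    from diff_chain_at[OF Suc, of G "\<lambda>w. w"] G(4) it0[of n] show ?case by (simp add: o_def)
  qed (simp add: id_def[symmetric])
  define E where "E N x = (\<Sum>k<N. (G ^^ k) x - x) /\<^sub>R real N" for N x
  have Eh: "hol2 (\<lambda>x. fst (E N x)) U \<and> hol2 (\<lambda>x. snd (E N x)) U" for N
  proof -
    have 1: "hol2 (\<lambda>x. fst ((G ^^ k) x) - fst x) U" "hol2 (\<lambda>x. snd ((G ^^ k) x) - snd x) U" for k
      using it(1)[OF U(3), of k] hol2_fst hol2_snd unfolding holo2_on_iff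
      by (auto intro!: hol2_diff)
    have 2: "hol2 (\<lambda>x. \<Sum>k<N. fst ((G ^^ k) x) - fst x) U"
      "hol2 (\<lambda>x. \<Sum>k<N. snd ((G ^^ k) x) - snd x) U" for N
    proof -
      have 0: "hol2 (\<lambda>_. 0) U" using hol2_cmult[OF hol2_fst, of 0] by simp
      show "hol2 (\<lambda>x. \<Sum>k<N. fst ((G ^^ k) x) - fst x) U"
        by (induction N) (use 0 1 hol2_add in auto)
      show "hol2 (\<lambda>x. \<Sum>k<N. snd ((G ^^ k) x) - snd x) U"
        by (induction N) (use 0 1 hol2_add in auto)
    qed
    have 3: "fst (E N x) = of_real (inverse (real N)) * (\<Sum>k<N. fst ((G ^^ k) x) - fst x)"
      "snd (E N x) = of_real (inverse (real N)) * (\<Sum>k<N. snd ((G ^^ k) x) - snd x)" for x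
      by (simp_all add: E_def fst_sum snd_sum scaleR_conv_of_real)
    show ?thesis unfolding 3 by (intro conjI hol2_cmult 2)
  qed
  have Ed: "(E N has_derivative (\<lambda>_. 0)) (at 0)" for N
  proof -
    have "((\<lambda>x. (G ^^ k) x - x) has_derivative (\<lambda>w. w - w)) (at 0)" for k
      by (intro has_derivative_diff itd has_derivative_ident)
    hence "((\<lambda>x. \<Sum>k<N. (G ^^ k) x - x) has_derivative (\<lambda>w. \<Sum>k<N. w - w)) (at 0)"
      by (rule has_derivative_sum)
    from has_derivative_scaleR_right[OF this, of "inverse (real N)"]
    show ?thesis by (simp add: E_def[abs_def])
  qed
  have Eb: "norm (E N x) \<le> 2 * B" if x: "x \<in> U" for N x
  proof (cases "N = 0")
    case False
    have "norm (\<Sum>k<N. (G ^^ k) x - x) \<le> (\<Sum>k<N. 2 * B)"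
    proof (rule sum_norm_le)
      fix k
      show "norm ((G ^^ k) x - x) \<le> 2 * B"
        using U(4)[OF it(2)[OF x, of k]] U(4)[OF x] norm_triangle_ineq4[of "(G ^^ k) x" x] by simp
    qed
    thus ?thesis using False by (simp add: E_def field_simps)
  qed (use B in \<open>simp add: E_def\<close>)
  have lip: "norm (E N x - E N y) \<le> 1 / 2 * norm (x - y)" if x: "norm x < e" and y: "norm y < e" for N x y
  proof -
    have "cmod (fst (E N x) - fst (E N y)) \<le> 8 * (2 * B) * e / d^2 * norm (x - y)"
    proof (rule hol2_Lipschitz[OF _ _ _ _ e x y])
      show "hol2 (\<lambda>x. fst (E N x)) (ball 0 d)" using Eh d hol2_subset by blast
      show "((\<lambda>x. fst (E N x)) has_derivative (\<lambda>_. 0)) (at 0)" using has_derivative_fst[OF Ed] by simp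
      show "cmod (fst (E N x)) \<le> 2 * B" if "x \<in> ball 0 d" for x
        using Eb[of x N] norm_fst_le[of "fst (E N x)" "snd (E N x)"] d that by auto
    qed (simp add: E_def it0)
    moreover have "cmod (snd (E N x) - snd (E N y)) \<le> 8 * (2 * B) * e / d^2 * norm (x - y)"
    proof (rule hol2_Lipschitz[OF _ _ _ _ e x y])
      show "hol2 (\<lambda>x. snd (E N x)) (ball 0 d)" using Eh d hol2_subset by blast
      show "((\<lambda>x. snd (E N x)) has_derivative (\<lambda>_. 0)) (at 0)" using has_derivative_snd[OF Ed] by simp
      show "cmod (snd (E N x)) \<le> 2 * B" if "x \<in> ball 0 d" for x
        using Eb[of x N] norm_snd_le[of "snd (E N x)" "fst (E N x)"] d that by auto
    qed (simp add: E_def it0)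
    moreover have "norm (E N x - E N y) \<le> cmod (fst (E N x) - fst (E N y)) + cmod (snd (E N x) - snd (E N y))"
      using norm_Pair_le[of "fst (E N x - E N y)" "snd (E N x - E N y)"] unfolding prod.collapse by simp
    ultimately have "norm (E N x - E N y) \<le> 2 * (8 * (2 * B) * e / d^2 * norm (x - y))" by (smt (verit))
    hence "norm (E N x - E N y) \<le> 2 * (16 * B * e / d^2 * norm (x - y))" by simp
    also have "\<dots> \<le> 2 * (1 / 4 * norm (x - y))"
      using eB by (intro mult_left_mono mult_right_mono) auto
    finally show ?thesis by simp
  qed
  have fix_small: "G x = x" if x: "norm x < e" and Gx: "norm (G x) < e" for x
  proof -
    have xU: "x \<in> U" using x e d by auto
    have "norm (G x - x) / 2 \<le> 2 * B / real N" if N: "N > 0" for N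
    proof -
      have "(\<Sum>k<N. (G ^^ k) (G x) - G x) - (\<Sum>k<N. (G ^^ k) x - x)
          = (\<Sum>k<N. (G ^^ Suc k) x - (G ^^ k) x) - (\<Sum>k<N. G x - x)"
        by (simp add: sum_subtractf[symmetric] funpow_swap1 algebra_simps)
      also have "(\<Sum>k<N. (G ^^ Suc k) x - (G ^^ k) x) = (G ^^ N) x - x"
        using sum_lessThan_telescope[of "\<lambda>k. (G ^^ k) x" N] by simp
      finally have "E N (G x) - E N x = ((G ^^ N) x - x) /\<^sub>R real N - (\<Sum>k<N. G x - x) /\<^sub>R real N"
        by (simp add: E_def scaleR_diff_right[symmetric])
      also have "(\<Sum>k<N. G x - x) /\<^sub>R real N = G x - x" using N by (simp add: sum_constant_scaleR)
      finally have "G x - x = ((G ^^ N) x - x) /\<^sub>R real N - (E N (G x) - E N x)" by simp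
      hence "norm (G x - x) \<le> norm (((G ^^ N) x - x) /\<^sub>R real N) + norm (E N (G x) - E N x)"
        by (metis norm_triangle_ineq4)
      also have "norm (E N (G x) - E N x) \<le> 1 / 2 * norm (G x - x)" by (rule lip[OF Gx x])
      also have "norm (((G ^^ N) x - x) /\<^sub>R real N) \<le> (2 * B) / real N"
        using U(4)[OF it(2)[OF xU, of N]] U(4)[OF xU] norm_triangle_ineq4[of "(G ^^ N) x" x] N
        by (simp add: divide_simps)
      finally show ?thesis by simp
    qed
    hence *: "norm (G x - x) / 2 \<le> 2 * B * inverse (real (Suc n))" for n
      using zero_less_Suc[of n] by (simp only: divide_inverse[symmetric])
    have "(\<lambda>n. 2 * B * inverse (real (Suc n))) \<longlonglongrightarrow> 2 * B * 0"
      by (intro tendsto_intros LIMSEQ_inverse_real_of_nat)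
    from LIMSEQ_le_const[OF this] * have "norm (G x - x) / 2 \<le> 2 * B * 0" by blast
    thus ?thesis by simp
  qed
  have "continuous (at 0) G" using G(4) has_derivative_continuous by blast
  then obtain e' where e': "e' > 0" "\<And>x. norm x < e' \<Longrightarrow> norm (G x) < e"
    using e G(3) unfolding continuous_at_eps_delta by (metis diff_zero dist_norm)
  define m where "m = min e e'"
  have m: "m > 0" "\<And>x. norm x < m \<Longrightarrow> G x = x" using e e' fix_small by (auto simp: m_def)
  \<comment> \<open>Spreads the identity from a ball around 0 to all of \<open>U\<close>: on the
    connected slice of \<open>U\<close> by the complex line through \<open>z\<close>, the function
    \<open>f (cscale l z) - l * g z\<close> vanishes for small \<open>l\<close>, hence also at
    \<open>l = 1\<close>.\<close>
  have ext: "f (cscale 1 z) = 1 * g z"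
    if f: "hol2 f U" "\<And>x. norm x < m \<Longrightarrow> f x = g x" and g: "\<And>l. g (cscale l z) = l * g z" for f g :: "_ \<Rightarrow> complex"
  proof -
    let ?S = "{l. cscale l z \<in> U}"
    let ?T = "ball 0 (m / (norm z + 1)) \<inter> ?S"
    have h: "(\<lambda>l. f (cscale l z) - l * g z) holomorphic_on ?S"
      by (intro holomorphic_intros hol2_slice f U)
    have "(\<lambda>l. f (cscale l z) - l * g z) 1 = 0"
    proof (rule analytic_continuation_open[OF _ open_balanced2_slice[OF U(1)] _ connected_balanced2_slice[OF U(2)] _ h, of ?T "\<lambda>_. 0"])
      show "open ?T" by (intro open_Int open_ball open_balanced2_slice U)
      have "(0::complex) \<in> ?T" using m U by (simp add: add_nonneg_pos)
      thus "?T \<noteq> {}" by blast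
      fix l assume "l \<in> ?T"
      hence "cmod l * (norm z + 1) < m" by (simp add: pos_less_divide_eq add_nonneg_pos)
      hence "norm (cscale l z) < m" by (simp add: algebra_simps) (smt (verit) norm_ge_zero)
      thus "f (cscale l z) - l * g z = 0" using f g by simp
    qed (use z in auto)
    thus ?thesis by simp
  qed
  have "fst (G z) = fst z"
    using ext[of "\<lambda>x. fst (G x)" fst] G(1) m by (simp add: holo2_on_iff)
  moreover have "snd (G z) = snd z"
    using ext[of "\<lambda>x. snd (G x)" snd] G(1) m by (simp add: holo2_on_iff)
  ultimately show ?thesis by (simp add: prod_eq_iff)
qed

lemma biholo2_derivative_inverse:
  assumes "open U" "biholo2 U F G" "z \<in> U" "(F has_derivative L) (at z)" "(G has_derivative M) (at (F z))"
  shows "M (L w) = w"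
proof -
  have "((\<lambda>x. G (F x)) has_derivative (\<lambda>w. M (L w))) (at z)"
    using diff_chain_at[OF assms(4,5)] by (simp add: o_def)
  hence "((\<lambda>x. x) has_derivative (\<lambda>w. M (L w))) (at z)"
    by (rule has_derivative_transform_within_open[OF _ assms(1,3)]) (use assms in \<open>auto simp: biholo2_def\<close>)
  hence "(\<lambda>w. M (L w)) = (\<lambda>w. w)" using has_derivative_ident has_derivative_unique by blast
  thus ?thesis by metis
qed

text \<open>Conjugating by rotations, \<open>K\<close> = \<open>G\<close> after rotation by
  \<open>cnj c\<close> after \<open>F\<close> after rotation by \<open>c\<close>: since the
  derivative of \<open>F\<close> at 0 is complex linear, the rotations cancel and \<open>K\<close>
  has derivative the identity, so \<open>Cartan_unique\<close> applies.\<close>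

lemma Cartan_commutes_rotation:
  assumes U: "open U" "balanced2 U" "0 \<in> U" "\<And>z. z \<in> U \<Longrightarrow> norm z \<le> B"
    and F: "biholo2 U F G" "F 0 = 0" and c: "cmod c = 1" and z: "z \<in> U"
  shows "F (cscale c z) = cscale c (F z)"
proof -
  have cU: "cscale k x \<in> U" if "x \<in> U" "cmod k = 1" for x k using U(2) that by (simp add: balanced2_def)
  have hF: "holo2_on F U" "holo2_on G U" using F by (simp_all add: biholo2_def)
  have G0: "G 0 = 0" using F U by (metis biholo2_def)
  obtain p q u v where L: "(F has_derivative (\<lambda>w. (p * fst w + q * snd w, u * fst w + v * snd w))) (at 0)"
    using holo2_derivativeE[OF hF(1) U(3)] by blast
  obtain p' q' u' v' where M: "(G has_derivative (\<lambda>w. (p' * fst w + q' * snd w, u' * fst w + v' * snd w))) (at 0)"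
    using holo2_derivativeE[OF hF(2) U(3)] by blast
  define l where "l w = (p * fst w + q * snd w, u * fst w + v * snd w)" for w
  define n where "n w = (p' * fst w + q' * snd w, u' * fst w + v' * snd w)" for w
  have L: "(F has_derivative l) (at 0)" and M: "(G has_derivative n) (at 0)"
    using L M by (simp_all add: l_def[abs_def] n_def[abs_def])
  have nl: "n (l w) = w" for w
    using biholo2_derivative_inverse[OF U(1) F(1) U(3) L] M F by simp
  have cc: "cnj c * c = 1" using c by (metis complex_norm_square mult.commute of_real_1 one_power2)
  define K where "K x = G (cscale (cnj c) (F (cscale c x)))" for x
  have d1: "((\<lambda>x. F (cscale c x)) has_derivative (\<lambda>w. l (cscale c w))) (at 0)"
    using diff_chain_at[OF has_derivative_cscale, of F l c 0] L by (simp add: o_def)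
  have d2: "((\<lambda>x. cscale (cnj c) (F (cscale c x))) has_derivative (\<lambda>w. cscale (cnj c) (l (cscale c w)))) (at 0)"
    using diff_chain_at[OF d1 has_derivative_cscale] by (simp add: o_def)
  have "(K has_derivative (\<lambda>w. n (cscale (cnj c) (l (cscale c w))))) (at 0)"
    using diff_chain_at[OF d2, of G n] M F by (simp add: o_def K_def[abs_def])
  moreover have "cscale (cnj c) (l (cscale c w)) = l w" for w
  proof -
    have "l (cscale c w) = cscale c (l w)" by (simp add: l_def cscale_def algebra_simps)
    thus ?thesis by (simp add: cc)
  qed
  ultimately have Kd: "(K has_derivative (\<lambda>w. w)) (at 0)" by (simp add: nl)
  have hc: "holo2_on (cscale k) U" for k
    unfolding holo2_on_iff using hol2_fst hol2_snd by (auto intro!: hol2_cmult)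
  have KU: "holo2_on K U" unfolding K_def[abs_def]
  proof (rule holo2_compose[of _ U G U])
    have "holo2_on (\<lambda>x. F (cscale c x)) U"
      by (rule holo2_compose[of _ U F U]) (use hc F cU c in \<open>auto simp: biholo2_def\<close>)
    moreover have "holo2_on (cscale (cnj c)) U" by (rule hc)
    ultimately show "holo2_on (\<lambda>x. cscale (cnj c) (F (cscale c x))) U"
      by (rule holo2_compose) (use F cU c in \<open>auto simp: biholo2_def image_subset_iff\<close>)
  qed (use F cU c in \<open>auto simp: biholo2_def image_subset_iff\<close>)
  have "K z = z"
  proof (rule Cartan_unique[OF U KU _ _ Kd z])
    show "K ` U \<subseteq> U" using F cU c by (auto simp: K_def biholo2_def image_subset_iff)
    show "K 0 = 0" by (simp add: K_def F G0)
  qed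
  hence "F (G (cscale (cnj c) (F (cscale c z)))) = F z" by (simp add: K_def)
  moreover have "cscale (cnj c) (F (cscale c z)) \<in> U" using F cU c z by (auto simp: biholo2_def image_subset_iff)
  ultimately have "cscale (cnj c) (F (cscale c z)) = F z" using F by (simp add: biholo2_def)
  hence "cscale c (cscale (cnj c) (F (cscale c z))) = cscale c (F z)" by simp
  thus ?thesis using cc by (simp add: mult.commute)
qed

text \<open>Homogeneity for unimodular factors says that \<open>f (cscale l z) - l * f z\<close>
  vanishes on the unit circle, hence on the disc. Its derivative at \<open>l = 0\<close> then
  equates \<open>f z\<close> with the value of the differential at \<open>z\<close>.\<close>

lemma Cartan_linear:
  assumes U: "open U" "balanced2 U" "0 \<in> U" "\<And>z. z \<in> U \<Longrightarrow> norm z \<le> B"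
    and F: "biholo2 U F G" "F 0 = 0"
  obtains p q u v where "\<And>z. z \<in> U \<Longrightarrow> F z = (p * fst z + q * snd z, u * fst z + v * snd z)"
proof -
  have *: "f z = p * fst z + q * snd z"
    if f: "hol2 f U" "\<And>c z. z \<in> U \<Longrightarrow> cmod c = 1 \<Longrightarrow> f (cscale c z) = c * f z"
      and p: "(f has_derivative (\<lambda>w. p * fst w + q * snd w)) (at 0)" and z: "z \<in> U" for f p q z
  proof -
    let ?S = "{l. cscale l z \<in> U}"
    define h where "h l = f (cscale l z) - l * f z" for l
    have S: "cball 0 1 \<subseteq> ?S" using U(2) z by (auto simp: balanced2_def)
    have hS: "h holomorphic_on ?S"
      unfolding h_def by (intro holomorphic_intros hol2_slice f U)
    have h0: "h l = 0" if l: "cmod l \<le> 1" for l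
    proof -
      have "cmod (h l) \<le> 0"
      proof (rule maximum_modulus_frontier[of h "cball 0 1"])
        show "h holomorphic_on interior (cball 0 1)"
          using S holomorphic_on_subset[OF hS] by (metis interior_subset subset_trans)
        show "continuous_on (closure (cball 0 1)) h"
          using holomorphic_on_imp_continuous_on[OF hS] S continuous_on_subset by (metis closure_closed closed_cball)
        show "cmod (h x) \<le> 0" if "x \<in> frontier (cball 0 1)" for x
          using that f(2)[OF z, of x] by (simp add: h_def)
      qed (use l in auto)
      thus ?thesis by simp
    qed
    have "((\<lambda>l. f (l * fst z, l * snd z)) has_field_derivative p * fst z + q * snd z) (at 0)"
      by (rule has_field_derivative_hol2_disc) (use p in \<open>auto intro!: derivative_eq_intros simp: zero_prod_def\<close>)
    moreover have "((\<lambda>l. l * f z) has_field_derivative f z) (at 0)" by (auto intro!: derivative_eq_intros)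
    ultimately have "(h has_field_derivative (p * fst z + q * snd z - f z)) (at 0)"
      unfolding h_def cscale_def by (rule DERIV_diff)
    moreover have "(h has_field_derivative 0) (at 0)"
      by (rule has_field_derivative_transform_within_open[of "\<lambda>_. 0" 0 0 "ball 0 1"]) (auto simp: h0)
    ultimately show ?thesis using DERIV_unique by fastforce
  qed
  obtain p q u v where D: "(F has_derivative (\<lambda>w. (p * fst w + q * snd w, u * fst w + v * snd w))) (at 0)"
    using holo2_derivativeE[of F U 0] F U unfolding biholo2_def by blast
  have h: "hol2 (\<lambda>x. fst (F x)) U" "hol2 (\<lambda>x. snd (F x)) U" using F by (auto simp: biholo2_def holo2_on_iff)
  have "fst (F z) = p * fst z + q * snd z" "snd (F z) = u * fst z + v * snd z" if "z \<in> U" for z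
    using *[OF h(1) _ _ that, of p q] *[OF h(2) _ _ that, of u v] has_derivative_fst[OF D] has_derivative_snd[OF D]
      Cartan_commutes_rotation[OF U F] by simp_all
  thus thesis by (intro that[of p q u v]) (simp add: prod_eq_iff)
qed

subsection \<open>Ellipsoids osculating the strictly pseudoconvex boundary\<close>

lemma deriv_bound:
  assumes f: "f holomorphic_on ball 0 1" "\<And>z. cmod z < 1 \<Longrightarrow> cmod (f z) \<le> M"
  shows "cmod (deriv f 0) \<le> M"
proof -
  have M: "0 \<le> M" using f(2)[of 0] by (metis norm_ge_zero norm_zero order_trans zero_less_one)
  have b: "x * cmod (deriv f 0) \<le> M" if x: "0 < x" "x < 1" for x
  proof -
    have sub: "cball 0 x \<subseteq> (ball 0 1 :: complex set)" "ball 0 x \<subseteq> (ball 0 1 :: complex set)" using x by auto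
    have "cmod ((deriv ^^ 1) f 0) \<le> fact 1 * M / x ^ 1"
      using f x holomorphic_on_subset[OF f(1) sub(2)]
        continuous_on_subset[OF holomorphic_on_imp_continuous_on[OF f(1)] sub(1)]
      by (intro Cauchy_inequality) auto
    thus ?thesis using x by (simp add: pos_le_divide_eq mult.commute)
  qed
  have "((\<lambda>x. x * cmod (deriv f 0)) \<longlongrightarrow> 1 * cmod (deriv f 0)) (at_left 1)"
    by (intro tendsto_intros)
  moreover have "eventually (\<lambda>x::real. x * cmod (deriv f 0) \<le> M) (at_left 1)"
    using eventually_at_left_real[of 0 1] b by (auto elim!: eventually_mono)
  ultimately have "1 * cmod (deriv f 0) \<le> M"
    by (intro tendsto_upperbound) auto
  thus ?thesis by simp
qed

lemma Cauchy_Schwarz_complex2: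
  "(cmod (a * x + b * y))^2 \<le> ((cmod a)^2 + (cmod b)^2) * ((cmod x)^2 + (cmod y)^2)"
proof -
  have "cmod (a * x + b * y) \<le> cmod a * cmod x + cmod b * cmod y"
    using norm_triangle_ineq[of "a * x" "b * y"] by (simp add: norm_mult)
  hence "(cmod (a * x + b * y))^2 \<le> (cmod a * cmod x + cmod b * cmod y)^2"
    by (intro power_mono) auto
  also have "\<dots> \<le> ((cmod a)^2 + (cmod b)^2) * ((cmod x)^2 + (cmod y)^2)"
    using zero_le_power2[of "cmod a * cmod y - cmod b * cmod x"]
    by (simp add: power2_eq_square algebra_simps)
  finally show ?thesis .
qed

text \<open>The normalised conjugate vector is the test vector at which the functional attains its
  norm.\<close>

lemma unit_ball_dual:
  assumes "\<And>s1 s2. (cmod s1)^2 + (cmod s2)^2 = 1 \<Longrightarrow> cmod (s1 * a + s2 * b) \<le> 1"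
  shows "(cmod a)^2 + (cmod b)^2 \<le> 1"
proof (cases "(cmod a)^2 + (cmod b)^2 = 0")
  case False
  define N where "N = sqrt ((cmod a)^2 + (cmod b)^2)"
  have N2: "N^2 = (cmod a)^2 + (cmod b)^2" by (simp add: N_def)
  have "N \<ge> 0" "N \<noteq> 0" using False by (simp_all add: N_def)
  hence N: "N > 0" by simp
  have 1: "cmod (cnj a / of_real N * a + cnj b / of_real N * b) \<le> 1"
    by (rule assms) (use N in \<open>simp add: norm_divide power_divide add_divide_distrib[symmetric] N2[symmetric]\<close>)
  have "cnj a / of_real N * a + cnj b / of_real N * b = of_real (N^2 / N)"
    by (simp add: N2 add_divide_distrib) (simp add: complex_norm_square[symmetric] mult.commute[of "cnj _"])
  hence "N \<le> 1" using 1 N by (simp add: power2_eq_square del: of_real_divide of_real_power)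
  thus ?thesis using N unfolding N2[symmetric] by (simp add: power_le_one)
qed simp

text \<open>Schwarz lemma for the ellipsoid |q|^2 + A |p|^2 < 1 at the point (0, y). After rescaling
  it is the unit ball, whose automorphism carrying the point to 0 has the components (q - y) / (1 -
  y q) and \<open>B * p / (1 - y * q)\<close>. Pairing with unit vectors reduces the claim to
  \<open>deriv_bound\<close>.\<close>

lemma outer_Schwarz:
  fixes A y :: real
  assumes hol: "p holomorphic_on ball 0 1" "q holomorphic_on ball 0 1"
    and A: "0 \<le> A" and y: "0 \<le> y" "y < 1"
    and b: "\<And>l. cmod l < 1 \<Longrightarrow> (cmod (q l))^2 + A * (cmod (p l))^2 \<le> 1"
    and 0: "p 0 = 0" "q 0 = of_real y"
    and d: "(p has_field_derivative p') (at 0)" "(q has_field_derivative q') (at 0)"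
  shows "(cmod q')^2 / (1 - y^2)^2 + A * (cmod p')^2 / (1 - y^2) \<le> 1"
proof -
  have y2: "0 < 1 - y^2" using y by (simp add: power_less_one_iff)
  \<comment> \<open>One factor \<open>sqrt A\<close> from the rescaling and one factor
    \<open>sqrt (1 - y^2)\<close> from the automorphism of the ball.\<close>
  define B where "B = sqrt (A * (1 - y^2))"
  have B2: "B^2 = A * (1 - y^2)" using A y2 by (simp add: B_def)
  have q1: "cmod (q l) \<le> 1" if "cmod l < 1" for l
  proof -
    have "0 \<le> A * (cmod (p l))^2" using A by simp
    hence "(cmod (q l))^2 \<le> 1" using b[OF that] by linarith
    thus ?thesis by (simp add: abs_square_le_1)
  qed
  have nz: "1 - of_real y * q l \<noteq> 0" if "cmod l < 1" for l
  proof
    assume "1 - of_real y * q l = 0"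
    hence "y * cmod (q l) = 1" using y
      by (metis abs_of_nonneg eq_iff_diff_eq_0 norm_mult norm_of_real norm_one)
    moreover have "y * cmod (q l) \<le> y * 1" using q1[OF that] y by (intro mult_left_mono) auto
    ultimately show False using y by simp
  qed
  have main: "cmod (s1 * (q' / of_real (1 - y^2)) + s2 * (of_real B * p' / of_real (1 - y^2))) \<le> 1"
    if s: "(cmod s1)^2 + (cmod s2)^2 = 1" for s1 s2
  proof -
    define k where "k l = s1 * ((q l - of_real y) / (1 - of_real y * q l)) + s2 * (of_real B * p l / (1 - of_real y * q l))" for l
    have "k holomorphic_on ball 0 1" unfolding k_def using nz
      by (intro holomorphic_intros hol) auto
    moreover have "cmod (k l) \<le> 1" if l: "cmod l < 1" for l
    proof -
      have id: "(cmod (1 - of_real y * q l))^2 - (cmod (q l - of_real y))^2 = (1 - y^2) * (1 - (cmod (q l))^2)"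
        using cmod_diff_identity[of "of_real y" "q l"] y by (simp add: norm_minus_commute)
      have "(1 - y^2) * (A * (cmod (p l))^2) \<le> (1 - y^2) * (1 - (cmod (q l))^2)"
        using b[OF l] y2 by (intro mult_left_mono) auto
      hence le: "(cmod (q l - of_real y))^2 + B^2 * (cmod (p l))^2 \<le> (cmod (1 - of_real y * q l))^2"
        using id by (simp add: B2 mult_ac)
      have "(cmod (k l))^2 \<le> 1 * ((cmod ((q l - of_real y) / (1 - of_real y * q l)))^2 + (cmod (of_real B * p l / (1 - of_real y * q l)))^2)"
        unfolding k_def s[symmetric] by (rule Cauchy_Schwarz_complex2)
      also have "\<dots> = ((cmod (q l - of_real y))^2 + B^2 * (cmod (p l))^2) / (cmod (1 - of_real y * q l))^2"
        by (simp add: norm_divide norm_mult power_divide power_mult_distrib add_divide_distrib)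
      also have "\<dots> \<le> 1" using le nz[OF l] by simp
      finally show ?thesis by (simp add: abs_square_le_1)
    qed
    ultimately have "cmod (deriv k 0) \<le> 1" by (rule deriv_bound)
    moreover have "(k has_field_derivative (s1 * (q' / of_real (1 - y^2)) + s2 * (of_real B * p' / of_real (1 - y^2)))) (at 0)"
    proof -
      have nz0: "1 - of_real y * of_real y \<noteq> (0::complex)" using nz[of 0] 0 by simp
      have "(k has_field_derivative
         (s1 * ((q' * (1 - of_real y * q 0) - (q 0 - of_real y) * (- (of_real y * q'))) / ((1 - of_real y * q 0) * (1 - of_real y * q 0)))
        + s2 * ((of_real B * p' * (1 - of_real y * q 0) - of_real B * p 0 * (- (of_real y * q'))) / ((1 - of_real y * q 0) * (1 - of_real y * q 0))))) (at 0)"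
        unfolding k_def using nz[of 0]
        by (auto intro!: derivative_eq_intros d simp: algebra_simps)
      thus ?thesis using nz0 by (simp add: 0 power2_eq_square)
    qed
    ultimately show ?thesis using DERIV_imp_deriv by metis
  qed
  have "(cmod (q' / of_real (1 - y^2)))^2 + (cmod (of_real B * p' / of_real (1 - y^2)))^2 \<le> 1"
    using unit_ball_dual[OF main] .
  moreover have "cmod (of_real (1 - y^2)) = 1 - y^2" using y2 by (metis abs_of_pos norm_of_real)
  ultimately have "(cmod q')^2 / (1 - y^2)^2 + B^2 * (cmod p')^2 / (1 - y^2)^2 \<le> 1"
    by (simp add: norm_divide norm_mult power_divide power_mult_distrib del: of_real_diff)
  also have "B^2 * (cmod p')^2 / (1 - y^2)^2 = A * (cmod p')^2 / (1 - y^2)"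
    unfolding B2 using y2 by (simp add: power2_eq_square)
  finally show ?thesis .
qed

text \<open>An ellipsoid of size \<open>s\<close> touching the boundary from inside at
  \<open>(0, r)\<close> lies in \<open>Dr r\<close>. Restricting \<open>f\<close> to discs in this
  ellipsoid through \<open>(0, r * y)\<close> bounds its derivative by the tangent norm of the
  ellipsoid. The parameter \<open>\<delta>\<close> bounds |z| there and thus the denominator in
  \<open>k\<close>.\<close>

lemma inner_Schwarz:
  fixes r \<delta> s y :: real
  assumes r: "0 < r" "r < 1" and \<delta>: "0 < \<delta>" "\<delta> < 1"
  defines "k \<equiv> (1 - r^2) / (1 - r * \<delta>)"
  assumes s: "0 < s" "s \<le> 1" "s \<le> 2 * k * \<delta>^2" and y: "1 - s \<le> y" "y < 1"
  defines "c \<equiv> 1 - (1 - (1 - y) / s)^2"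
  assumes f: "hol2 f (Dr r)" "\<And>z. z \<in> Dr r \<Longrightarrow> cmod (f z) \<le> 1"
    and D: "(f has_derivative (\<lambda>w. a * fst w + b * snd w)) (at (0, of_real (r * y)))"
  shows "(cmod (a * v1 + b * v2))^2
     \<le> 2 * k / (s * c) * (cmod v1)^2 + (cmod ((v2 - of_real (1 - r^2) * v1) / of_real r))^2 / (s * c)^2"
    (is "_ \<le> ?N2")
proof -
  \<comment> \<open>The position of \<open>y\<close> in the coordinate of the ball:
    \<open>1 - s + s * \<beta> = y\<close>.\<close>
  define \<beta> where "\<beta> = 1 - (1 - y) / s"
  have \<beta>: "0 \<le> \<beta>" "\<beta> < 1" using s y by (simp_all add: \<beta>_def)
  have c: "c = 1 - \<beta>^2" "c > 0" using \<beta> by (simp_all add: c_def \<beta>_def power_less_one_iff)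
  have k: "k > 0" using r \<delta> unfolding k_def
    by (intro divide_pos_pos) (auto simp: power_less_one_iff mult_less_cancel_left1
        intro: less_trans[OF mult_strict_left_mono, of \<delta> 1 r])
  \<comment> \<open>Points of the unit ball satisfy \<open>(cmod bz)^2 < 2 * (1 - cmod bh)\<close>.
    With this scaling \<open>k * (cmod (Z l))^2\<close> stays below
    \<open>s * (1 - cmod bh)\<close>, which is the room that \<open>egg_subset_Dr\<close> asks
    for.\<close>
  define \<gamma> where "\<gamma> = sqrt (s / (2 * k))"
  have \<gamma>: "\<gamma> > 0" "\<gamma>^2 = s / (2 * k)" using s k by (simp_all add: \<gamma>_def)
  define m where "m = sqrt c"
  have m: "m > 0" "m^2 = c" using c by (simp_all add: m_def)
  have \<kappa>: "0 < 1 - r^2" using r by (simp add: power_less_one_iff)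
  have unit: "cmod (a * (of_real (\<gamma> * m) * u1) + b * (of_real r * of_real (s * c) * u2 + of_real (1 - r^2) * (of_real (\<gamma> * m) * u1))) \<le> 1"
    if u: "(cmod u1)^2 + (cmod u2)^2 = 1" for u1 u2
  proof -
    \<comment> \<open>The straight disc with direction \<open>(u1, u2)\<close> in the unit ball,
      moved by the ball automorphism that takes 0 to \<open>(0, \<beta>)\<close>, then placed into
      the ellipsoid; \<open>W\<close> undoes the affine change of the second coordinate.\<close>
    define Z where "Z l = of_real \<gamma> * (of_real m * (l * u1) / (1 + of_real \<beta> * (l * u2)))" for l
    define H where "H l = of_real (1 - s) + of_real s * ((l * u2 + of_real \<beta>) / (1 + of_real \<beta> * (l * u2)))" for l
    define W where "W l = of_real r * H l + of_real (1 - r^2) * Z l" for l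
    have u2: "cmod u2 \<le> 1"
    proof -
      have "(cmod u2)^2 \<le> 1" using u zero_le_power2[of "cmod u1"] by linarith
      thus ?thesis by (simp add: abs_square_le_1)
    qed
    have nz: "1 + of_real \<beta> * (l * u2) \<noteq> 0" if "cmod l < 1" for l
    proof
      assume "1 + of_real \<beta> * (l * u2) = 0"
      hence "cmod (of_real \<beta> * (l * u2)) = 1" by (metis add_eq_0_iff norm_minus_cancel norm_one)
      moreover have "\<beta> * (cmod l * cmod u2) \<le> \<beta> * (1 * 1)"
        using that u2 \<beta> by (intro mult_left_mono mult_mono) auto
      ultimately show False using \<beta> by (simp add: norm_mult)
    qed
    have mem: "(Z l, W l) \<in> Dr r" if l: "cmod l < 1" for l
    proof -
      define bz where "bz = of_real m * (l * u1) / (1 + of_real \<beta> * (l * u2))"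
      define bh where "bh = (l * u2 + of_real \<beta>) / (1 + of_real \<beta> * (l * u2))"
      have id: "(cmod (1 + of_real \<beta> * (l * u2)))^2 - (cmod (l * u2 + of_real \<beta>))^2 = c * (1 - (cmod (l * u2))^2)"
        using cmod_diff_identity[of "- of_real \<beta>" "l * u2"] \<beta> c
          norm_minus_cancel[of "l * u2 + of_real \<beta>"] by (simp add: add.commute)
      have "(cmod l)^2 * ((cmod u1)^2 + (cmod u2)^2) < 1" using l by (simp add: u power_less_one_iff)
      hence "(cmod (l * u1))^2 < 1 - (cmod (l * u2))^2"
        by (simp add: norm_mult power_mult_distrib distrib_left)
      hence "c * (cmod (l * u1))^2 < c * (1 - (cmod (l * u2))^2)" using c by simp
      hence "(cmod (of_real m * (l * u1)))^2 + (cmod (l * u2 + of_real \<beta>))^2 < (cmod (1 + of_real \<beta> * (l * u2)))^2"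
        using id m by (simp add: norm_mult power_mult_distrib)
      hence sph: "(cmod bz)^2 + (cmod bh)^2 < 1"
        using nz[OF l] by (simp add: bz_def bh_def norm_divide power_divide add_divide_distrib[symmetric])
      have bh1: "cmod bh < 1"
      proof -
        have "(cmod bh)^2 < 1" using sph zero_le_power2[of "cmod bz"] by linarith
        thus ?thesis by (simp add: abs_square_less_1)
      qed
      have Z2: "(cmod (Z l))^2 = s / (2 * k) * (cmod bz)^2"
        using \<gamma> by (simp add: Z_def bz_def[symmetric] norm_mult power_mult_distrib)
      have "(cmod bz)^2 \<le> 1" using sph zero_le_power2[of "cmod bh"] by linarith
      hence "(cmod (Z l))^2 \<le> s / (2 * k) * 1" unfolding Z2 using s k by (intro mult_left_mono) auto
      also have "\<dots> \<le> \<delta>^2" using s k by (simp add: field_simps)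
      finally have Zd: "cmod (Z l) \<le> \<delta>" using \<delta> by (simp add: power2_le_iff_abs_le)
      have "cmod (H l) \<le> cmod (of_real (1 - s)) + cmod (of_real s * bh)"
        unfolding H_def bh_def[symmetric] by (rule norm_triangle_ineq)
      hence H1: "cmod (H l) \<le> 1 - s + s * cmod bh" using s by (simp add: norm_mult del: of_real_diff)
      have "(1 - r^2) * (cmod (Z l))^2 / (1 - r * cmod (Z l)) \<le> k * (cmod (Z l))^2"
      proof -
        have "r * cmod (Z l) \<le> r * \<delta>" using Zd r by simp
        moreover have "r * \<delta> < 1" using r \<delta> by (metis less_le_trans mult_less_cancel_left1 mult.right_neutral
            mult_strict_left_mono less_imp_le less_trans)
        ultimately have "(1 - r^2) / (1 - r * cmod (Z l)) \<le> k" unfolding k_def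
          using \<kappa> by (intro divide_left_mono mult_pos_pos) auto
        thus ?thesis by (metis mult_right_mono times_divide_eq_left zero_le_power2)
      qed
      also have "k * (cmod (Z l))^2 = s * ((cmod bz)^2 / 2)" unfolding Z2 using k by simp
      also have "\<dots> < s * (1 - cmod bh)"
      proof (intro mult_strict_left_mono s)
        have "1 - (cmod bh)^2 \<le> 2 * (1 - cmod bh)" by (rule one_minus_square_le)
        thus "(cmod bz)^2 / 2 < 1 - cmod bh" using sph by argo
      qed
      finally have "cmod (H l) < 1 - (1 - r^2) * (cmod (Z l))^2 / (1 - r * cmod (Z l))"
        using H1 by (simp add: algebra_simps)
      hence "cmod (W l - of_real (1 - r^2) * Z l) < r * (1 - (1 - r^2) * (cmod (Z l))^2 / (1 - r * cmod (Z l)))"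
        using r by (simp add: W_def norm_mult)
      thus ?thesis using r Zd \<delta> by (intro egg_subset_Dr) auto
    qed
    have hZ: "Z holomorphic_on ball 0 1" and hH: "H holomorphic_on ball 0 1"
      unfolding Z_def H_def using nz by (auto intro!: holomorphic_intros)
    hence hW: "W holomorphic_on ball 0 1" unfolding W_def by (intro holomorphic_intros)
    have dZ: "(Z has_field_derivative of_real (\<gamma> * m) * u1) (at 0)"
      unfolding Z_def by (auto intro!: derivative_eq_intros)
    have dH: "(H has_field_derivative of_real (s * c) * u2) (at 0)"
      unfolding H_def by (auto intro!: derivative_eq_intros simp: c power2_eq_square algebra_simps)
    have dW: "(W has_field_derivative of_real r * (of_real (s * c) * u2) + of_real (1 - r^2) * (of_real (\<gamma> * m) * u1)) (at 0)"
      unfolding W_def by (intro DERIV_add DERIV_cmult dH dZ)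
    have "W 0 = of_real (r * y)"
    proof -
      have "1 - s + s * \<beta> = y" using s by (simp add: \<beta>_def field_simps)
      hence "of_real (1 - s) + of_real s * of_real \<beta> = (of_real y :: complex)"
        by (metis of_real_add of_real_mult)
      thus ?thesis by (simp add: W_def H_def Z_def)
    qed
    moreover have "Z 0 = 0" by (simp add: Z_def)
    ultimately have "((\<lambda>l. f (Z l, W l)) has_field_derivative a * (of_real (\<gamma> * m) * u1) + b * (of_real r * (of_real (s * c) * u2) + of_real (1 - r^2) * (of_real (\<gamma> * m) * u1))) (at 0)"
      by (intro has_field_derivative_hol2_disc dZ dW) (use D in simp)
    moreover have "cmod (deriv (\<lambda>l. f (Z l, W l)) 0) \<le> 1"
      using mem f by (intro deriv_bound hol2_disc[OF f(1) hZ hW]) auto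
    ultimately have "cmod (a * (of_real (\<gamma> * m) * u1) + b * (of_real r * (of_real (s * c) * u2) + of_real (1 - r^2) * (of_real (\<gamma> * m) * u1))) \<le> 1"
      using DERIV_imp_deriv by fastforce
    thus ?thesis by (simp only: mult.assoc)
  qed
  \<comment> \<open>Component of the direction along the affine coordinate. Dividing by the
    ellipsoid norm \<open>N\<close> yields a unit vector \<open>(u1, u2)\<close>;
    \<open>N = 0\<close> happens only for the zero direction.\<close>
  define e where "e = (v2 - of_real (1 - r^2) * v1) / of_real r"
  define N where "N = sqrt ?N2"
  have N2: "N^2 = ?N2" unfolding N_def using k s(1) c(2) by (intro real_sqrt_pow2) simp
  have v2: "v2 = of_real r * e + of_real (1 - r^2) * v1" using r by (simp add: e_def)
  show ?thesis
  proof (cases "N = 0")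
    case True
    hence "2 * k / (s * c) * (cmod v1)^2 + (cmod e)^2 / (s * c)^2 = 0" using N2 by (simp add: e_def)
    hence "2 * k / (s * c) * (cmod v1)^2 = 0" "(cmod e)^2 / (s * c)^2 = 0"
      using k s(1) c(2) by (subst (asm) add_nonneg_eq_0_iff; simp)+
    hence "v1 = 0" "e = 0" using k s(1) c(2) by auto
    hence "v2 = 0" using v2 by simp
    thus ?thesis using \<open>v1 = 0\<close> by simp
  next
    case False
    have "N \<ge> 0" unfolding N_def using k s(1) c(2) by (intro real_sqrt_ge_zero) simp
    with False have N0: "N > 0" by simp
    define u1 where "u1 = v1 / of_real (N * (\<gamma> * m))"
    define u2 where "u2 = e / of_real (N * (s * c))"
    have "(cmod u1)^2 = 2 * k / (s * c) * (cmod v1)^2 / N^2"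
      using \<gamma> m N0 k s by (simp add: u1_def norm_divide norm_mult power_divide power_mult_distrib mult_ac)
    moreover have "(cmod u2)^2 = (cmod e)^2 / (s * c)^2 / N^2"
      using N0 c(2) s(1) by (simp add: u2_def norm_divide norm_mult power_divide power_mult_distrib)
    ultimately have "(cmod u1)^2 + (cmod u2)^2 = ?N2 / N^2" by (simp add: e_def add_divide_distrib)
    hence u: "(cmod u1)^2 + (cmod u2)^2 = 1" unfolding N2[symmetric] using N0 by simp
    have 1: "of_real (\<gamma> * m) * u1 = v1 / of_real N" using \<gamma> m N0 by (simp add: u1_def)
    have 2: "of_real r * of_real (s * c) * u2 = of_real r * e / of_real N" using s(1) c(2) N0 by (simp add: u2_def)
    have "a * (v1 / of_real N) + b * (of_real r * e / of_real N + of_real (1 - r^2) * (v1 / of_real N)) = (a * v1 + b * v2) / of_real N"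
      using N0 by (simp add: v2 field_simps)
    hence "cmod ((a * v1 + b * v2) / of_real N) \<le> 1" using unit[OF u] unfolding 1 2 by simp
    hence "cmod (a * v1 + b * v2) \<le> N" using N0 by (simp add: norm_divide)
    hence "(cmod (a * v1 + b * v2))^2 \<le> N^2" by (intro power_mono) auto
    thus ?thesis using N2 by simp
  qed
qed

lemma DERIV_scale_arg:
  fixes f :: "complex \<Rightarrow> complex"
  assumes "(f has_field_derivative D) (at 0)"
  shows "((\<lambda>l. f (c * l)) has_field_derivative c * D) (at 0)"
proof -
  have "((\<lambda>l. c * l) has_field_derivative c) (at 0)" by (auto intro!: derivative_eq_intros)
  hence "((\<lambda>l. f (c * l)) has_field_derivative D * c) (at 0)"
    by (rule DERIV_chain2[rotated]) (use assms in simp)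
  thus ?thesis by (simp only: mult.commute)
qed

text \<open>The ellipsoid contains \<open>Dr r\<close> only where |z| \<le> \<delta>: there
  \<open>cmod q \<le> 1 - k * (cmod z)^2\<close>, and squaring gives the coefficient
  \<open>A = 2 * k - k^2 * \<delta>^2\<close>. A disc through \<open>(0, r * y)\<close> may leave
  this region, but its part of radius \<open>\<rho>\<close> does not when \<open>y\<close> is close
  to 1; hence the factor \<open>\<rho>^2\<close>.\<close>

lemma outer_Schwarz_Dr:
  fixes r \<delta> \<rho> y :: real
  assumes r: "0 < r" "r < 1" and \<delta>: "0 < \<delta>" "\<delta> < 1" and \<rho>: "0 < \<rho>" "\<rho> < 1"
    and y: "0 \<le> y" "y < 1" "1 - y \<le> \<delta>^2 * (1 - r^2) * (1 - \<rho>) / 4"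
  defines "k \<equiv> (1 - r^2) / (1 + r * \<delta>)"
  defines "A \<equiv> 2 * k - k^2 * \<delta>^2"
  assumes P: "P holomorphic_on ball 0 1" and Q: "Q holomorphic_on ball 0 1"
    and mem: "\<And>l. cmod l < 1 \<Longrightarrow> (P l, Q l) \<in> Dr r"
    and 0: "P 0 = 0" "Q 0 = of_real (r * y)"
    and d: "(P has_field_derivative v1) (at 0)" "(Q has_field_derivative v2) (at 0)"
  shows "\<rho>^2 * ((cmod ((v2 - of_real (1 - r^2) * v1) / of_real r))^2 / (1 - y^2)^2 + A * (cmod v1)^2 / (1 - y^2)) \<le> 1"
proof -
  have \<kappa>: "0 < 1 - r^2" using r by (simp add: power_less_one_iff)
  define q where "q l = (Q l - of_real (1 - r^2) * P l) / of_real r" for l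
  have qh: "q holomorphic_on ball 0 1" unfolding q_def using r by (intro holomorphic_intros P Q) auto
  have egg: "cmod (q l) \<le> 1 - (1 - r^2) * (cmod (P l))^2 / (1 + r * cmod (P l))" if "cmod l < 1" for l
  proof -
    have "cmod (Q l - of_real (1 - r^2) * P l) \<le> r * (1 - (1 - r^2) * (cmod (P l))^2 / (1 + r * cmod (P l)))"
      using mem[OF that] r by (intro Dr_subset_egg) (auto simp: Dr_iff)
    thus ?thesis using r by (simp add: q_def norm_divide pos_divide_le_eq mult.commute)
  qed
  have egg2: "(1 - r^2) * (cmod (P l))^2 \<le> 2 * (1 - cmod (q l))" if l: "cmod l < 1" for l
  proof -
    have "r * cmod (P l) \<le> 1 * 1" using mem[OF l] r by (intro mult_mono) (auto simp: Dr_iff)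
    hence "(1 - r^2) * (cmod (P l))^2 / 2 \<le> (1 - r^2) * (cmod (P l))^2 / (1 + r * cmod (P l))"
      using r \<kappa> by (intro divide_left_mono mult_pos_pos) (auto intro: add_pos_nonneg)
    thus ?thesis using egg[OF l] by argo
  qed
  have q1: "cmod (q l) < 1" if l: "cmod l < 1" for l
  proof (cases "P l = 0")
    case True
    hence "cmod (Q l) < r" using mem[OF l] by (simp add: Dr_iff pdist_def)
    thus ?thesis using r True by (simp add: q_def norm_divide)
  next
    case False
    hence "0 < (1 - r^2) * (cmod (P l))^2" using \<kappa> by simp
    thus ?thesis using egg2[OF l] by argo
  qed
  have q0: "q 0 = of_real y" using r by (simp add: q_def 0)
  \<comment> \<open>Schwarz-Pick for \<open>q\<close> keeps \<open>q w\<close> within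
    \<open>pdist\<close> \<open>\<rho>\<close> of \<open>y\<close>, hence at distance at most
    \<open>2 * (1 - y) / (1 - \<rho>)\<close> from 1, and \<open>egg2\<close> converts this into
    smallness of \<open>P w\<close>. The 4 in the hypothesis on \<open>y\<close> is the product of
    this 2 with the 2 in \<open>egg2\<close>.\<close>
  have near: "cmod (P (of_real \<rho> * l)) \<le> \<delta>" if l: "cmod l < 1" for l
  proof -
    define w where "w = of_real \<rho> * l"
    have w: "cmod w \<le> \<rho>" "cmod w < 1"
    proof -
      have "\<rho> * cmod l \<le> \<rho> * 1" using l \<rho> by (intro mult_left_mono) auto
      moreover have "cmod w = \<rho> * cmod l" using \<rho> by (simp add: w_def norm_mult)
      ultimately show "cmod w \<le> \<rho>" "cmod w < 1" using \<rho> by linarith+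
    qed
    have qw: "cmod (q w) < 1" using q1 w by simp
    have "pdist (q 0) (q w) \<le> pdist 0 w"
      using qh q1 w by (intro Schwarz_Pick) (auto simp: unit_disc_def)
    also have "pdist 0 w \<le> \<rho>" using w by (simp add: pdist_def)
    finally have "cmod (of_real y - q w) \<le> \<rho> * cmod (1 - of_real y * q w)"
      using pdist_denom_nonzero[of "of_real y" "q w"] qw y
      by (simp add: q0 pdist_def norm_divide divide_le_eq)
    also have "cmod (1 - of_real y * q w) \<le> (1 - y) + cmod (1 - q w)"
    proof -
      have "1 - of_real y * q w = of_real (1 - y) + of_real y * (1 - q w)" by (simp add: algebra_simps)
      hence "cmod (1 - of_real y * q w) \<le> cmod (of_real (1 - y)) + cmod (of_real y * (1 - q w))"
        by (metis norm_triangle_ineq)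
      also have "cmod (of_real (1 - y)) = 1 - y" using y by (simp del: of_real_diff)
      also have "cmod (of_real y * (1 - q w)) \<le> 1 * cmod (1 - q w)"
        unfolding norm_mult using y by (intro mult_right_mono) auto
      finally show ?thesis by simp
    qed
    finally have 1: "cmod (of_real y - q w) \<le> \<rho> * ((1 - y) + cmod (1 - q w))" using \<rho> by simp
    have "cmod (1 - q w) \<le> cmod (of_real (1 - y)) + cmod (of_real y - q w)"
      using norm_triangle_ineq[of "of_real (1 - y)" "of_real y - q w"] by simp
    moreover have "cmod (of_real (1 - y)) = 1 - y" using y by (simp del: of_real_diff)
    ultimately have "cmod (1 - q w) \<le> (1 - y) + \<rho> * ((1 - y) + cmod (1 - q w))" using 1 by linarith
    hence "(1 - \<rho>) * cmod (1 - q w) \<le> (1 + \<rho>) * (1 - y)" by (simp add: algebra_simps)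
    also have "\<dots> \<le> 2 * (1 - y)" using \<rho> y by (intro mult_right_mono) auto
    also have "\<dots> \<le> (1 - \<rho>) * (\<delta>^2 * (1 - r^2) / 2)" using y(3) by (simp add: algebra_simps)
    finally have "cmod (1 - q w) \<le> \<delta>^2 * (1 - r^2) / 2" using \<rho> by simp
    moreover have "1 - cmod (q w) \<le> cmod (1 - q w)" using norm_triangle_ineq2[of 1 "q w"] by simp
    ultimately have "(1 - r^2) * (cmod (P w))^2 \<le> (1 - r^2) * \<delta>^2" using egg2[OF w(2)] by argo
    hence "(cmod (P w))^2 \<le> \<delta>^2" using \<kappa> by simp
    thus ?thesis using \<delta> by (simp add: w_def power2_le_iff_abs_le)
  qed
  have rd: "0 < r * \<delta>" using r \<delta> by simp
  have le1: "1 - r^2 \<le> 1 + r * \<delta>" using zero_le_power2[of r] rd by linarith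
  have k: "0 < k" "k \<le> 1" using \<kappa> rd le1 unfolding k_def
    by (simp_all add: divide_le_eq)
  have A: "0 \<le> A"
  proof -
    have "k * (k * \<delta>^2) \<le> k * (1 * 1)" using k \<delta> by (intro mult_left_mono mult_mono) (auto simp: power_le_one)
    thus ?thesis using k by (simp add: A_def power2_eq_square mult_ac)
  qed
  have "(cmod (of_real \<rho> * ((v2 - of_real (1 - r^2) * v1) / of_real r)))^2 / (1 - y^2)^2 + A * (cmod (of_real \<rho> * v1))^2 / (1 - y^2) \<le> 1"
  proof (rule outer_Schwarz[OF _ _ A y(1,2), of "\<lambda>l. P (of_real \<rho> * l)" "\<lambda>l. q (of_real \<rho> * l)"])
    have im: "of_real \<rho> * l \<in> ball (0::complex) 1" if "l \<in> ball 0 1" for l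
    proof -
      have "\<rho> * cmod l \<le> 1 * cmod l" using \<rho> by (intro mult_right_mono) auto
      moreover have "cmod (of_real \<rho> * l) = \<rho> * cmod l" using \<rho> by (simp add: norm_mult)
      ultimately show ?thesis using that by simp
    qed
    show "(\<lambda>l. P (of_real \<rho> * l)) holomorphic_on ball 0 1"
      by (intro holomorphic_on_compose_gen[OF _ P, unfolded o_def] holomorphic_intros) (use im in auto)
    show "(\<lambda>l. q (of_real \<rho> * l)) holomorphic_on ball 0 1"
      by (intro holomorphic_on_compose_gen[OF _ qh, unfolded o_def] holomorphic_intros) (use im in auto)
    show "P (of_real \<rho> * 0) = 0" "q (of_real \<rho> * 0) = of_real y" by (simp_all add: 0 q0)
    show "((\<lambda>l. P (of_real \<rho> * l)) has_field_derivative of_real \<rho> * v1) (at 0)"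
      by (rule DERIV_scale_arg[OF d(1)])
    have "(q has_field_derivative (v2 - of_real (1 - r^2) * v1) / of_real r) (at 0)"
      unfolding q_def by (intro DERIV_cdivide DERIV_diff DERIV_cmult d)
    thus "((\<lambda>l. q (of_real \<rho> * l)) has_field_derivative of_real \<rho> * ((v2 - of_real (1 - r^2) * v1) / of_real r)) (at 0)"
      by (rule DERIV_scale_arg)
    fix l :: complex assume l: "cmod l < 1"
    define w where "w = of_real \<rho> * l"
    have w: "cmod w < 1" using im[of l] l by (simp add: w_def)
    have Pw: "cmod (P w) \<le> \<delta>" using near[OF l] by (simp add: w_def)
    have "k * (cmod (P w))^2 \<le> (1 - r^2) * (cmod (P w))^2 / (1 + r * cmod (P w))"
    proof -
      have "r * cmod (P w) \<le> r * \<delta>" using Pw r by simp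
      hence "k \<le> (1 - r^2) / (1 + r * cmod (P w))" unfolding k_def
        using \<kappa> r rd by (intro divide_left_mono mult_pos_pos add_pos_nonneg) auto
      thus ?thesis by (metis mult_right_mono times_divide_eq_left zero_le_power2)
    qed
    hence 1: "cmod (q w) \<le> 1 - k * (cmod (P w))^2" using egg[OF w] by linarith
    hence "(cmod (q w))^2 \<le> (1 - k * (cmod (P w))^2)^2" by (intro power_mono) auto
    also have "\<dots> = 1 - 2 * k * (cmod (P w))^2 + k^2 * ((cmod (P w))^2 * (cmod (P w))^2)"
      by (simp add: power2_eq_square algebra_simps)
    also have "k^2 * ((cmod (P w))^2 * (cmod (P w))^2) \<le> k^2 * (\<delta>^2 * (cmod (P w))^2)"
      using Pw by (intro mult_left_mono mult_right_mono power_mono) auto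
    finally show "(cmod (q (of_real \<rho> * l)))^2 + A * (cmod (P (of_real \<rho> * l)))^2 \<le> 1"
      unfolding w_def[symmetric] by (simp add: A_def algebra_simps)
  qed
  moreover have "(cmod (of_real \<rho> * x))^2 = \<rho>^2 * (cmod x)^2" for x
    by (simp add: norm_mult power_mult_distrib)
  ultimately show ?thesis by (simp only:) (simp add: algebra_simps)
qed

text \<open>As \<open>\<delta>\<close> tends to 0, the inner coefficient \<open>2 * k\<close> and
  the outer coefficient \<open>A\<close> both tend to \<open>2 * (1 - r^2)\<close>, so any factor
  above 1 eventually absorbs their ratio.\<close>

lemma ellipsoid_parameters:
  fixes r e :: real
  assumes r: "0 < r" "r < 1" and e: "0 < e" "e \<le> 1"
  obtains \<delta> where "0 < \<delta>" "\<delta> < 1"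
    "2 * ((1 - r^2) / (1 - r * \<delta>)) \<le>
       (1 + e) * (2 * ((1 - r^2) / (1 + r * \<delta>)) - ((1 - r^2) / (1 + r * \<delta>))^2 * \<delta>^2)"
proof -
  have \<kappa>: "0 < 1 - r^2" using r by (simp add: power_less_one_iff)
  let ?g = "\<lambda>\<delta>. (1 + e) * (2 * ((1 - r^2) / (1 + r * \<delta>)) - ((1 - r^2) / (1 + r * \<delta>))^2 * \<delta>^2)
       - 2 * ((1 - r^2) / (1 - r * \<delta>))"
  have "(?g \<longlongrightarrow> (1 + e) * (2 * ((1 - r^2) / (1 + r * 0)) - ((1 - r^2) / (1 + r * 0))^2 * 0^2)
       - 2 * ((1 - r^2) / (1 - r * 0))) (at_right 0)"
    by (intro tendsto_intros) auto
  hence "(?g \<longlongrightarrow> 2 * e * (1 - r^2)) (at_right 0)" by (simp add: algebra_simps)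
  moreover have "0 < 2 * e * (1 - r^2)" using \<kappa> e by simp
  ultimately have "eventually (\<lambda>\<delta>. 0 < ?g \<delta>) (at_right 0)" by (rule order_tendstoD)
  moreover have "eventually (\<lambda>\<delta>::real. \<delta> \<in> {0<..<1}) (at_right 0)"
    by (rule eventually_at_right_real) simp
  ultimately have "eventually (\<lambda>\<delta>. 0 < ?g \<delta> \<and> \<delta> \<in> {0<..<1}) (at_right 0)" by (rule eventually_conj)
  from eventually_happens'[OF trivial_limit_at_right_real this]
  obtain \<delta> where "0 < ?g \<delta>" "\<delta> \<in> {0<..<1}" by blast
  thus thesis by (intro that[of \<delta>]) auto
qed

lemma parallelogram_complex:
  fixes a b :: complex
  shows "(cmod (a + b))^2 + (cmod (a - b))^2 = 2 * (cmod a)^2 + 2 * (cmod b)^2"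
  unfolding cmod_power2 by (simp add: power2_eq_square algebra_simps)

text \<open>Both coordinate functions restrict to the identity on the diagonal disc. An automorphism
  carrying the origin very close to the strictly pseudoconvex boundary transports this pair of
  extremal functions to a place where the domain is squeezed between two almost equal
  ellipsoids, and there an extremal function is almost determined to first order.\<close>

lemma orbit_of_origin_bounded:
  fixes r :: real
  assumes r: "0 < r" "r < 1"
  obtains x0 where "x0 < r"
    "\<And>H K x. biholo2 (Dr r) H K \<Longrightarrow> H 0 = (0, of_real x) \<Longrightarrow> 0 \<le> x \<Longrightarrow> x < r \<Longrightarrow> x \<le> x0"
proof -
  have \<kappa>: "0 < 1 - r^2" using r by (simp add: power_less_one_iff)
  \<comment> \<open>The direction (t, -t) is \<open>2 * t / r\<close> times
    \<open>(r / 2, - r / 2)\<close>, whose disc lies in \<open>Dr r\<close>. Its squared norm is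
    therefore at most about \<open>4 * t^2 / r^2 = t / 2\<close>, too little to pay for the gain in
    \<open>(1 + t)^2\<close>.\<close>
  define t where "t = r^2 / 8"
  have t: "0 < t" "t \<le> 1 / 8" using r by (auto simp: t_def power_le_one)
  \<comment> \<open>\<open>e\<close> pays for the ratio of the two ellipsoids and
    \<open>\<rho>\<close> for shrinking the discs. \<open>\<rho>\<close> is chosen so that the total
    loss \<open>(1 + e)^2 / \<rho>^2\<close> is exactly \<open>1 + t\<close>;
    \<open>e = t / 8\<close> ensures \<open>(1 + e)^2 < 1 + t\<close>, that is,
    \<open>\<rho> < 1\<close>.\<close>
  define e where "e = t / 8"
  have e: "0 < e" "e \<le> 1" using t by (auto simp: e_def)
  define \<rho> where "\<rho> = sqrt ((1 + e)^2 / (1 + t))"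
  have ee: "(1 + e)^2 < 1 + t"
  proof -
    have "e * e \<le> e * 1" using e by (intro mult_left_mono) auto
    moreover have "3 * e < t" using t by (simp add: e_def)
    ultimately show ?thesis by (simp add: power2_eq_square algebra_simps)
  qed
  have \<rho>2: "\<rho>^2 = (1 + e)^2 / (1 + t)" using e t by (simp add: \<rho>_def)
  have \<rho>: "0 < \<rho>" "\<rho> < 1" using ee e t by (simp_all add: \<rho>_def)
  obtain \<delta> where \<delta>: "0 < \<delta>" "\<delta> < 1"
    "2 * ((1 - r^2) / (1 - r * \<delta>)) \<le>
       (1 + e) * (2 * ((1 - r^2) / (1 + r * \<delta>)) - ((1 - r^2) / (1 + r * \<delta>))^2 * \<delta>^2)"
    using ellipsoid_parameters[OF r e] .
  define k where "k = (1 - r^2) / (1 - r * \<delta>)"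
  define k' where "k' = (1 - r^2) / (1 + r * \<delta>)"
  define A where "A = 2 * k' - k'^2 * \<delta>^2"
  have kA: "2 * k \<le> (1 + e) * A" using \<delta> by (simp add: k_def k'_def A_def)
  have rd: "0 < r * \<delta>" "r * \<delta> < 1"
  proof -
    show "0 < r * \<delta>" using r \<delta> by simp
    have "r * \<delta> < 1 * 1" using r \<delta> by (intro mult_strict_mono) auto
    thus "r * \<delta> < 1" by simp
  qed
  have k: "1 - r^2 \<le> k" unfolding k_def using rd \<kappa> by (simp add: pos_le_divide_eq mult_left_le)
  \<comment> \<open>An admissible size of the inner ellipsoid, since
    \<open>1 - r^2 \<le> k\<close>.\<close>
  define s where "s = (1 - r^2) * \<delta>^2"
  have s: "0 < s" "s \<le> 1" "s \<le> 2 * k * \<delta>^2"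
  proof -
    show "0 < s" using \<kappa> \<delta> by (simp add: s_def)
    have "(1 - r^2) * \<delta>^2 \<le> 1 * 1" using \<kappa> \<delta> by (intro mult_mono) (auto simp: power_le_one)
    thus "s \<le> 1" by (simp add: s_def)
    have "(1 - r^2) * \<delta>^2 \<le> (2 * k) * \<delta>^2" using k \<kappa> by (intro mult_right_mono) auto
    thus "s \<le> 2 * k * \<delta>^2" by (simp add: s_def)
  qed
  \<comment> \<open>In order, the three terms give \<open>1 - y^2 \<le> (1 + e) * (s * c)\<close>,
    the hypothesis \<open>1 - s \<le> y\<close> of \<open>inner_Schwarz\<close>, and the hypothesis
    on \<open>y\<close> in \<open>outer_Schwarz_Dr\<close>.\<close>
  define \<tau> where "\<tau> = min (s * (2 - 2 / (1 + e))) (min s (\<delta>^2 * (1 - r^2) * (1 - \<rho>) / 4))"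
  have \<tau>: "0 < \<tau>" "\<tau> \<le> s * (2 - 2 / (1 + e))" "\<tau> \<le> s" "\<tau> \<le> \<delta>^2 * (1 - r^2) * (1 - \<rho>) / 4"
  proof -
    have "2 / (1 + e) < 2" using e by (simp add: divide_less_eq)
    thus "0 < \<tau>" using s \<kappa> \<rho> \<delta> by (simp add: \<tau>_def)
    show "\<tau> \<le> s * (2 - 2 / (1 + e))" "\<tau> \<le> s" "\<tau> \<le> \<delta>^2 * (1 - r^2) * (1 - \<rho>) / 4"
      unfolding \<tau>_def by (intro min.coboundedI1 min.coboundedI2 order_refl; fail)+
  qed
  show thesis
  proof (rule that[of "r * (1 - \<tau>)"])
    show "r * (1 - \<tau>) < r" using r \<tau> by (simp add: right_diff_distrib)
    fix H K x assume HK: "biholo2 (Dr r) H K" and H0: "H 0 = (0, of_real x)" and x: "0 \<le> x" "x < r"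
    show "x \<le> r * (1 - \<tau>)"
    proof (rule ccontr)
      assume "\<not> x \<le> r * (1 - \<tau>)"
      hence x\<tau>: "r * (1 - \<tau>) < x" by simp
      define y where "y = x / r"
      have xy: "x = r * y" using r by (simp add: y_def)
      have y: "0 \<le> y" "y < 1" "1 - y < \<tau>"
        using x r x\<tau> by (simp_all add: y_def field_simps)
      have s1: "1 - s \<le> y" using y \<tau> by linarith
      define c where "c = 1 - (1 - (1 - y) / s)^2"
      have y2: "0 < 1 - y^2" using y by (simp add: power_less_one_iff)
      have sc: "s * c = (1 - y) * (2 - (1 - y) / s)"
        using s by (simp add: c_def power2_eq_square field_simps)
      have yy: "1 - y^2 \<le> (1 + e) * (s * c)"
      proof -
        have "(1 - y) / s \<le> 2 - 2 / (1 + e)" using y \<tau> s by (simp add: pos_divide_le_eq mult.commute)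
        hence "2 / (1 + e) \<le> 2 - (1 - y) / s" by linarith
        hence "2 \<le> (1 + e) * (2 - (1 - y) / s)" using e by (simp add: pos_divide_le_eq mult.commute)
        hence "(1 - y) * 2 \<le> (1 - y) * ((1 + e) * (2 - (1 - y) / s))" using y by (intro mult_left_mono) auto
        moreover have "1 - y^2 \<le> (1 - y) * 2" using y zero_le_power2[of "1 - y"] by (simp add: power2_eq_square algebra_simps)
        ultimately show ?thesis unfolding sc by (simp add: mult_ac)
      qed
      have c0: "0 < s * c"
      proof (rule ccontr)
        assume "\<not> 0 < s * c"
        hence "(1 + e) * (s * c) \<le> 0" using e mult_nonneg_nonpos[of "1 + e" "s * c"] by simp
        thus False using yy y2 by linarith
      qed
      have D0: "(0::complex \<times> complex) \<in> Dr r" using r by (simp add: zero_prod_def Dr_iff pdist_def)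
      have h: "holo2_on H (Dr r)" "holo2_on K (Dr r)" "\<And>z. z \<in> Dr r \<Longrightarrow> H z \<in> Dr r" "\<And>z. z \<in> Dr r \<Longrightarrow> K z \<in> Dr r"
        using HK by (auto simp: biholo2_def)
      obtain h1 h2 h3 h4 where DH: "(H has_derivative (\<lambda>w. (h1 * fst w + h2 * snd w, h3 * fst w + h4 * snd w))) (at 0)"
        using holo2_derivativeE[OF h(1) D0] by blast
      obtain k1 k2 k3 k4 where DK: "(K has_derivative (\<lambda>w. (k1 * fst w + k2 * snd w, k3 * fst w + k4 * snd w))) (at (H 0))"
        using holo2_derivativeE[OF h(2) h(3)[OF D0]] by blast
      have inv: "k1 * (h1 * fst w + h2 * snd w) + k2 * (h3 * fst w + h4 * snd w) = fst w"
                "k3 * (h1 * fst w + h2 * snd w) + k4 * (h3 * fst w + h4 * snd w) = snd w" for w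
        using biholo2_derivative_inverse[OF open_Dr HK D0 DH DK, of w] by (auto simp: prod_eq_iff)
      \<comment> \<open>Squared tangent norms at \<open>(0, x)\<close>: \<open>X\<close> belongs to
        the outer ellipsoid, \<open>Y\<close> to the inner one, and \<open>YX\<close> compares
        them.\<close>
      define X where "X v1 v2 = (cmod ((v2 - of_real (1 - r^2) * v1) / of_real r))^2 / (1 - y^2)^2 + A * (cmod v1)^2 / (1 - y^2)" for v1 v2
      define Y where "Y v1 v2 = 2 * k / (s * c) * (cmod v1)^2 + (cmod ((v2 - of_real (1 - r^2) * v1) / of_real r))^2 / (s * c)^2" for v1 v2
      have YX: "Y v1 v2 \<le> (1 + e)^2 * X v1 v2" for v1 v2
      proof -
        have k0: "0 < 2 * k" using k \<kappa> by linarith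
        have "2 * k * (1 - y^2) \<le> (1 + e) * A * ((1 + e) * (s * c))"
          by (rule mult_mono[OF kA yy]) (use kA k0 y2 in linarith)+
        hence "2 * k / (s * c) \<le> (1 + e)^2 * A / (1 - y^2)"
          using c0 y2 by (simp add: pos_divide_le_eq pos_le_divide_eq power2_eq_square mult_ac)
        hence 1: "2 * k / (s * c) * (cmod v1)^2 \<le> (1 + e)^2 * A / (1 - y^2) * (cmod v1)^2"
          by (intro mult_right_mono) auto
        have le: "(1 - y^2)^2 \<le> ((1 + e) * (s * c))^2" using yy y2 by (intro power_mono) auto
        have "1 / (s * c)^2 \<le> (1 + e)^2 / (1 - y^2)^2"
        proof -
          have S: "0 < (s * c)^2" "0 < (1 - y^2)^2" using zero_less_power[OF c0, of 2] zero_less_power[OF y2, of 2] .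
          have "1 \<le> ((1 + e)^2 * (s * c)^2) / (1 - y^2)^2"
            using le S(2) by (simp only: le_divide_eq_1_pos power_mult_distrib[of "1 + e"])
          hence "1 \<le> (1 + e)^2 / (1 - y^2)^2 * (s * c)^2" by (simp only: times_divide_eq_left)
          thus ?thesis using S(1) by (simp only: pos_divide_le_eq)
        qed
        hence "(cmod ((v2 - of_real (1 - r^2) * v1) / of_real r))^2 * (1 / (s * c)^2)
            \<le> (cmod ((v2 - of_real (1 - r^2) * v1) / of_real r))^2 * ((1 + e)^2 / (1 - y^2)^2)"
          by (intro mult_left_mono) auto
        with 1 show ?thesis unfolding X_def Y_def by (simp add: distrib_left mult_ac)
      qed
      \<comment> \<open>\<open>H\<close> carries a straight disc through 0 to a disc in
        \<open>Dr r\<close> through \<open>(0, x)\<close>, so the outer norm of its image direction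
        is controlled.\<close>
      have X: "\<rho>^2 * X (h1 * e1 + h2 * e2) (h3 * e1 + h4 * e2) \<le> 1"
        if ed: "\<And>l. cmod l < 1 \<Longrightarrow> (l * e1, l * e2) \<in> Dr r" for e1 e2
      proof -
        have hh: "hol2 (\<lambda>z. fst (H z)) (Dr r)" "hol2 (\<lambda>z. snd (H z)) (Dr r)"
          using h(1) by (simp_all add: holo2_on_iff)
        show ?thesis unfolding X_def A_def k'_def
        proof (rule outer_Schwarz_Dr[OF r \<delta>(1,2) \<rho> y(1,2), of "\<lambda>l. fst (H (l * e1, l * e2))" "\<lambda>l. snd (H (l * e1, l * e2))"])
          show "1 - y \<le> \<delta>^2 * (1 - r^2) * (1 - \<rho>) / 4" using y \<tau> by linarith
          show "(\<lambda>l. fst (H (l * e1, l * e2))) holomorphic_on ball 0 1"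
            by (rule hol2_disc[OF hh(1)]) (use ed in \<open>auto intro!: holomorphic_intros\<close>)
          show "(\<lambda>l. snd (H (l * e1, l * e2))) holomorphic_on ball 0 1"
            by (rule hol2_disc[OF hh(2)]) (use ed in \<open>auto intro!: holomorphic_intros\<close>)
          show "(fst (H (l * e1, l * e2)), snd (H (l * e1, l * e2))) \<in> Dr r" if "cmod l < 1" for l
            using h(3)[OF ed[OF that]] by simp
          show "fst (H (0 * e1, 0 * e2)) = 0" "snd (H (0 * e1, 0 * e2)) = of_real (r * y)"
            using H0 by (simp_all add: zero_prod_def[symmetric] xy)
          show "((\<lambda>l. fst (H (l * e1, l * e2))) has_field_derivative h1 * e1 + h2 * e2) (at 0)"
            using has_derivative_fst[OF DH]
            by (intro has_field_derivative_hol2_disc) (auto intro!: derivative_eq_intros simp: zero_prod_def)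
          show "((\<lambda>l. snd (H (l * e1, l * e2))) has_field_derivative h3 * e1 + h4 * e2) (at 0)"
            using has_derivative_snd[OF DH]
            by (intro has_field_derivative_hol2_disc) (auto intro!: derivative_eq_intros simp: zero_prod_def)
        qed
      qed
      \<comment> \<open>The coordinates of \<open>K\<close> are bounded by 1 and their derivatives
        undo the derivative of \<open>H\<close>; the inner estimate makes the norm of the image of
        \<open>w\<close> dominate both coordinates of \<open>w\<close>.\<close>
      have Y: "(cmod (fst w))^2 \<le> Y (h1 * fst w + h2 * snd w) (h3 * fst w + h4 * snd w)"
              "(cmod (snd w))^2 \<le> Y (h1 * fst w + h2 * snd w) (h3 * fst w + h4 * snd w)" for w
      proof -
        have kk: "hol2 (\<lambda>z. fst (K z)) (Dr r)" "hol2 (\<lambda>z. snd (K z)) (Dr r)"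
          using h(2) by (simp_all add: holo2_on_iff)
        have le: "cmod (fst (K z)) \<le> 1" "cmod (snd (K z)) \<le> 1" if "z \<in> Dr r" for z
          using h(4)[OF that] Dr_iff[of "fst (K z)" "snd (K z)"] by auto
        have D1: "((\<lambda>z. fst (K z)) has_derivative (\<lambda>w. k1 * fst w + k2 * snd w)) (at (0, of_real (r * y)))"
          using has_derivative_fst[OF DK] by (simp add: H0 xy)
        have D2: "((\<lambda>z. snd (K z)) has_derivative (\<lambda>w. k3 * fst w + k4 * snd w)) (at (0, of_real (r * y)))"
          using has_derivative_snd[OF DK] by (simp add: H0 xy)
        note I = inner_Schwarz[OF r \<delta>(1,2) s(1,2) s(3)[unfolded k_def] s1 y(2), folded k_def c_def]
        show "(cmod (fst w))^2 \<le> Y (h1 * fst w + h2 * snd w) (h3 * fst w + h4 * snd w)"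
          using I[OF kk(1) le(1) D1, of "h1 * fst w + h2 * snd w" "h3 * fst w + h4 * snd w"]
          unfolding Y_def inv by simp
        show "(cmod (snd w))^2 \<le> Y (h1 * fst w + h2 * snd w) (h3 * fst w + h4 * snd w)"
          using I[OF kk(2) le(2) D2, of "h1 * fst w + h2 * snd w" "h3 * fst w + h4 * snd w"]
          unfolding Y_def inv by simp
      qed
      define Z where "Z e1 e2 = Y (h1 * e1 + h2 * e2) (h3 * e1 + h4 * e2)" for e1 e2
      have plus: "Z (a + b) (c + d) + Z (a - b) (c - d) = 2 * Z a c + 2 * Z b d" for a b c d
      proof -
        have 1: "(cmod (h1 * (a + b) + h2 * (c + d)))^2 + (cmod (h1 * (a - b) + h2 * (c - d)))^2
            = 2 * (cmod (h1 * a + h2 * c))^2 + 2 * (cmod (h1 * b + h2 * d))^2"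
          using parallelogram_complex[of "h1 * a + h2 * c" "h1 * b + h2 * d"] by (simp add: algebra_simps)
        define L where "L e1 e2 = (h3 * e1 + h4 * e2 - of_real (1 - r^2) * (h1 * e1 + h2 * e2)) / of_real r" for e1 e2
        have L: "L (a + b) (c + d) = L a c + L b d" "L (a - b) (c - d) = L a c - L b d"
          unfolding L_def using r by (simp_all add: field_simps)
        have 2: "(cmod (L (a + b) (c + d)))^2 + (cmod (L (a - b) (c - d)))^2
            = 2 * (cmod (L a c))^2 + 2 * (cmod (L b d))^2"
          unfolding L by (rule parallelogram_complex)
        \<comment> \<open>The name \<open>c\<close> is taken by an argument here, so the constant of
          that name re-enters as \<open>c'\<close>.\<close>
        have e: "Z e1 e2 = 2 * k / (s * c') * (cmod (h1 * e1 + h2 * e2))^2 + (cmod (L e1 e2))^2 / (s * c')^2"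
          if "c' = 1 - (1 - (1 - y) / s)^2" for e1 e2 c'
          unfolding Z_def Y_def L_def that c_def ..
        obtain c' where c': "c' = 1 - (1 - (1 - y) / s)^2" by blast
        have "Z (a + b) (c + d) + Z (a - b) (c - d) = 2 * k / (s * c') * ((cmod (h1 * (a + b) + h2 * (c + d)))^2 + (cmod (h1 * (a - b) + h2 * (c - d)))^2)
           + ((cmod (L (a + b) (c + d)))^2 + (cmod (L (a - b) (c - d)))^2) / (s * c')^2"
          unfolding e[OF c'] by (simp add: distrib_left add_divide_distrib)
        also have "\<dots> = 2 * Z a c + 2 * Z b d"
          unfolding e[OF c'] 1 2 by (simp add: distrib_left add_divide_distrib)
        finally show ?thesis .
      qed
      have cp: "0 < (1 + e)^2" using e by simp
      have Z1: "Z 1 1 \<le> (1 + e)^2 / \<rho>^2"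
      proof -
        have "\<rho>^2 * X (h1 * 1 + h2 * 1) (h3 * 1 + h4 * 1) \<le> 1"
          by (rule X) (use r in \<open>auto simp: Dr_iff pdist_def\<close>)
        hence "X (h1 * 1 + h2 * 1) (h3 * 1 + h4 * 1) \<le> 1 / \<rho>^2" using \<rho> by (simp add: pos_le_divide_eq mult.commute)
        hence "(1 + e)^2 * X (h1 * 1 + h2 * 1) (h3 * 1 + h4 * 1) \<le> (1 + e)^2 * (1 / \<rho>^2)"
          by (rule mult_left_mono) simp
        thus ?thesis using YX[of "h1 * 1 + h2 * 1" "h3 * 1 + h4 * 1"] unfolding Z_def by simp
      qed
      have Z2: "Z (of_real t) (- of_real t) \<le> t / 2 * ((1 + e)^2 / \<rho>^2)"
      proof -
        \<comment> \<open>For the points \<open>(l * m, - (l * m))\<close> the numerator of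
          \<open>pdist\<close> is \<open>cmod l * r\<close> and the denominator is
          \<open>1 + (cmod (l * m))^2\<close>, at least 1.\<close>
        define m :: complex where "m = of_real (r / 2)"
        have "\<rho>^2 * X (h1 * m + h2 * (- m)) (h3 * m + h4 * (- m)) \<le> 1"
        proof (rule X)
          fix l :: complex assume l: "cmod l < 1"
          have lm: "cmod (l * m) < 1 / 2"
          proof -
            have "cmod l * (r / 2) \<le> 1 * (r / 2)" using l r by (intro mult_right_mono) auto
            moreover have "cmod (l * m) = cmod l * (r / 2)" using r by (simp add: m_def norm_mult)
            ultimately show ?thesis using r by linarith
          qed
          have "pdist (l * m) (l * - m) < r"
          proof (subst pdist_less_iff)
            have "cmod (l * m - l * - m) = cmod l * r" using r by (simp add: m_def norm_mult)
            also have "\<dots> < 1 * r" using l r by (intro mult_strict_right_mono) auto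
            also have "\<dots> \<le> r * cmod (1 - cnj (l * m) * (l * - m))"
            proof -
              have "1 - cnj (l * m) * (l * - m) = of_real (1 + (cmod (l * m))^2)"
                by (simp only: of_real_add of_real_1 complex_norm_square) (simp add: mult_ac)
              hence "1 \<le> cmod (1 - cnj (l * m) * (l * - m))" by (simp only: norm_of_real) simp
              thus ?thesis using r by simp
            qed
            finally show "cmod (l * m - l * - m) < r * cmod (1 - cnj (l * m) * (l * - m))" .
          qed (use lm in auto)
          thus "(l * m, l * - m) \<in> Dr r" using lm by (simp add: Dr_iff)
        qed
        hence "X (h1 * m + h2 * (- m)) (h3 * m + h4 * (- m)) \<le> 1 / \<rho>^2" using \<rho> by (simp add: pos_le_divide_eq mult.commute)
        hence "(1 + e)^2 * X (h1 * m + h2 * (- m)) (h3 * m + h4 * (- m)) \<le> (1 + e)^2 * (1 / \<rho>^2)"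
          by (rule mult_left_mono) simp
        hence Zm: "Z m (- m) \<le> (1 + e)^2 / \<rho>^2"
          using YX[of "h1 * m + h2 * (- m)" "h3 * m + h4 * (- m)"] unfolding Z_def by simp
        define u where "u = 2 * t / r"
        have u2: "u^2 = t / 2" using r by (simp add: u_def t_def power2_eq_square field_simps)
        have scal: "Y (of_real u * a) (of_real u * b) = u^2 * Y a b" for a b
        proof -
          have "(of_real u * b - of_real (1 - r^2) * (of_real u * a)) / of_real r = of_real u * ((b - of_real (1 - r^2) * a) / of_real r)"
            using r by (simp add: field_simps)
          moreover have "(cmod (of_real u * x))^2 = u^2 * (cmod x)^2" for x
            by (simp add: norm_mult power_mult_distrib)
          ultimately show ?thesis unfolding Y_def by (simp only:) (simp add: distrib_left mult_ac)
        qed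
        have tm: "of_real t = of_real u * m" using r by (simp add: u_def m_def)
        have "Z (of_real t) (- of_real t) = u^2 * Z m (- m)"
          unfolding Z_def scal[symmetric] tm by (simp add: algebra_simps)
        also have "\<dots> \<le> t / 2 * ((1 + e)^2 / \<rho>^2)" unfolding u2 using Zm t by (intro mult_left_mono) auto
        finally show ?thesis .
      qed
      have r2: "(1 + e)^2 / \<rho>^2 = 1 + t" unfolding \<rho>2 using cp t by simp
      have "(1 + t)^2 \<le> Z (1 + of_real t) (1 + - of_real t)"
      proof -
        have "cmod (1 + of_real t) = 1 + t" using t by (metis abs_of_pos add_pos_pos norm_of_real of_real_1 of_real_add zero_less_one)
        thus ?thesis using Y(1)[of "(1 + of_real t, 1 - of_real t)"] by (simp add: Z_def)
      qed
      moreover have "(1 + t)^2 \<le> Z (1 - of_real t) (1 - - of_real t)"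
      proof -
        have "cmod (1 + of_real t) = 1 + t" using t by (metis abs_of_pos add_pos_pos norm_of_real of_real_1 of_real_add zero_less_one)
        thus ?thesis using Y(2)[of "(1 - of_real t, 1 + of_real t)"] by (simp add: Z_def)
      qed
      \<comment> \<open>By the parallelogram law the squared norms of (1 + t, 1 - t) and (1 - t, 1 +
        t) add up to at most \<open>2 * (1 + t) + t * (1 + t)\<close>, which is less than
        \<open>2 * (1 + t)^2\<close>.\<close>
      ultimately have "2 * (1 + t)^2 \<le> 2 * Z 1 1 + 2 * Z (of_real t) (- of_real t)"
        using plus[of 1 "of_real t" 1 "- of_real t"] by linarith
      also have "\<dots> \<le> 2 * (1 + t) + 2 * (t / 2 * (1 + t))"
        by (rule add_mono[OF mult_left_mono[OF Z1[unfolded r2], of 2] mult_left_mono[OF Z2[unfolded r2], of 2]]) simp_all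
      finally have "(1 + t) * (1 + t) \<le> (1 + t) * (1 + t / 2)" by (simp add: power2_eq_square algebra_simps)
      thus False using t by simp
    qed
  qed
qed

subsection \<open>Automorphisms of Dr r\<close>

text \<open>Maximum principle on circles of radius close to 1; uniform decay of the modulus replaces
  boundary values.\<close>

lemma holomorphic_zero_of_boundary_limit:
  assumes h: "h holomorphic_on ball 0 1"
    and b: "\<And>e. 0 < e \<Longrightarrow> \<exists>R<1. \<forall>z. R < cmod z \<and> cmod z < 1 \<longrightarrow> cmod (h z) \<le> e"
    and z: "cmod z < 1"
  shows "h z = 0"
proof -
  have "cmod (h z) \<le> 0 + e" if e: "e > 0" for e
  proof -
    obtain R where R: "R < 1" "\<And>z. R < cmod z \<Longrightarrow> cmod z < 1 \<Longrightarrow> cmod (h z) \<le> e" using b[OF e] by blast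
    obtain S where S: "max (max R 0) (cmod z) < S" "S < 1" using dense[of "max (max R 0) (cmod z)" 1] R z by auto
    have sub: "cball 0 S \<subseteq> (ball 0 1 :: complex set)" using S by auto
    have "cmod (h z) \<le> e"
    proof (rule maximum_modulus_frontier[of h "cball 0 S"])
      show "h holomorphic_on interior (cball 0 S)"
        using holomorphic_on_subset[OF h] sub interior_subset by blast
      show "continuous_on (closure (cball 0 S)) h"
        using continuous_on_subset[OF holomorphic_on_imp_continuous_on[OF h] sub] by simp
      show "cmod (h x) \<le> e" if "x \<in> frontier (cball 0 S)" for x
        using that S R(2)[of x] by (simp add: frontier_cball dist_norm)
    qed (use S in \<open>auto simp: dist_norm\<close>)
    thus ?thesis by simp
  qed
  hence "cmod (h z) \<le> 0" by (rule field_le_epsilon)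
  thus ?thesis by simp
qed

lemma zero_mem_Dr: "0 < r \<Longrightarrow> 0 \<in> Dr r"
  by (simp add: zero_prod_def Dr_iff pdist_def)

lemma diagonal_mem_Dr: "0 < r \<Longrightarrow> cmod z < 1 \<Longrightarrow> (z, z) \<in> Dr r"
  by (simp add: Dr_iff pdist_def)

section \<open>Invariance of the diagonal\<close>

lemma move_to_axis:
  assumes "cmod a < 1" "cmod b < 1"
  obtains \<phi> where "\<phi> \<in> aut_disc" "\<phi> a = 0" "\<phi> b = of_real (pdist a b)"
proof -
  define w where "w = Moebius_function 0 a b"
  define c where "c = (if w = 0 then 1 else of_real (cmod w) / w)"
  have c: "cmod c = 1" "c * w = of_real (cmod w)" by (simp_all add: c_def norm_divide)
  show thesis
  proof
    show "(\<lambda>z. c * z) \<circ> Moebius_function 0 a \<in> aut_disc"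
      using aut_disc_comp rotation_aut_disc[OF c(1)] Moebius_function_aut_disc[OF assms(1)] by blast
    show "((\<lambda>z. c * z) \<circ> Moebius_function 0 a) a = 0" by (simp add: Moebius_function_eq_zero)
    show "((\<lambda>z. c * z) \<circ> Moebius_function 0 a) b = of_real (pdist a b)"
      using c(2) by (simp add: w_def norm_Moebius_function)
  qed
qed

text \<open>Diagonal automorphisms on both sides of \<open>F\<close> reduce to the image of the
  origin being \<open>(0, x)\<close>, where \<open>x\<close> is the \<open>pdist\<close> in
  question; one constant thus serves for all automorphisms and all diagonal points.\<close>

lemma automorphism_diagonal_pdist_bound:
  fixes r :: real
  assumes r: "0 < r" "r < 1"
  obtains x0 where "x0 < r" "0 \<le> x0"
    "\<And>F K z. biholo2 (Dr r) F K \<Longrightarrow> cmod z < 1 \<Longrightarrow> pdist (fst (F (z, z))) (snd (F (z, z))) \<le> x0"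
proof -
  obtain x1 where x1: "x1 < r"
    "\<And>H K x. biholo2 (Dr r) H K \<Longrightarrow> H 0 = (0, of_real x) \<Longrightarrow> 0 \<le> x \<Longrightarrow> x < r \<Longrightarrow> x \<le> x1"
    using orbit_of_origin_bounded[OF r] by blast
  show thesis
  proof (rule that[of "max x1 0"])
    fix F K z assume F: "biholo2 (Dr r) F K" and z: "cmod z < 1"
    have "F (z, z) \<in> Dr r" using F diagonal_mem_Dr[OF r(1) z] by (auto simp: biholo2_def)
    then obtain a b where ab: "F (z, z) = (a, b)" "cmod a < 1" "cmod b < 1" "pdist a b < r"
      by (metis Dr_iff prod.collapse)
    obtain \<phi> where \<phi>: "\<phi> \<in> aut_disc" "\<phi> a = 0" "\<phi> b = of_real (pdist a b)"
      using move_to_axis[OF ab(2,3)] by blast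
    obtain \<phi>' where \<phi>': "biholo2 (Dr r) (diag_map \<phi>) (diag_map \<phi>')"
      using biholo2_diag_map[OF \<phi>(1), of "Dr r" r] by blast
    have "Moebius_function 0 (- z) \<in> aut_disc" using Moebius_function_aut_disc[of "- z"] z by simp
    then obtain \<mu> where \<mu>: "biholo2 (Dr r) (diag_map (Moebius_function 0 (- z))) (diag_map \<mu>)"
      using biholo2_diag_map[of _ "Dr r" r] by blast
    have "diag_map \<phi> (F (diag_map (Moebius_function 0 (- z)) 0)) = (0, of_real (pdist a b))"
      using \<phi> ab by (simp add: zero_prod_def Moebius_function_of_zero)
    hence "pdist a b \<le> x1"
      using x1(2)[OF biholo2_comp[OF \<phi>' biholo2_comp[OF F \<mu>]]] ab by simp
    thus "pdist (fst (F (z, z))) (snd (F (z, z))) \<le> max x1 0" by (simp add: ab)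
  qed (use x1 r in auto)
qed

lemma cmod_less_1_of_cmod_diff_le:
  assumes x: "x < 1" "0 \<le> x" and a: "cmod a < 1" and ab: "cmod (a - b) \<le> x * cmod (1 - cnj a * b)"
  shows "cmod b < 1"
proof (rule ccontr)
  assume b: "\<not> cmod b < 1"
  hence "cmod (1 - cnj a * b) \<le> cmod (a - b)" using cmod_ge_imp_cmod_diff_ge[of a b] a by auto
  hence "x * cmod (1 - cnj a * b) \<le> x * cmod (a - b)" using x by (intro mult_left_mono) auto
  hence "(1 - x) * cmod (a - b) \<le> 0" using ab by (simp add: algebra_simps)
  hence "a = b" using x by (simp add: mult_le_0_iff)
  thus False using a b by simp
qed

text \<open>Clearing the denominator of \<open>pdist\<close> leaves closed conditions on the whole
  plane, and \<open>cmod_less_1_of_cmod_diff_le\<close> makes the set bounded. The condition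
  \<open>R < 1\<close> empties the set for larger \<open>R\<close>, where \<open>cmod a < 1\<close>
  would not be closed.\<close>

lemma compact_pdist_le:
  assumes x: "0 \<le> x" "x < 1"
  shows "compact {(a, b). cmod a \<le> R \<and> cmod a < 1 \<and> R < 1 \<and> cmod (a - b) \<le> x * cmod (1 - cnj a * b)}"
    (is "compact ?C")
proof -
  have e: "?C = {p. cmod (fst p) \<le> R \<and> R < 1 \<and> cmod (fst p - snd p) \<le> x * cmod (1 - cnj (fst p) * snd p)}"
    by auto
  have "closed ?C" unfolding e
    by (intro closed_Collect_conj closed_Collect_le closed_Collect_const continuous_intros)
  moreover have "cmod b < 1" if "(a, b) \<in> ?C" for a b
    using cmod_less_1_of_cmod_diff_le[of x a b] that x by auto
  hence "?C \<subseteq> cball 0 1 \<times> cball 0 1" by (fastforce simp: less_imp_le)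
  hence "bounded ?C" by (rule bounded_subset[OF bounded_Times[OF bounded_cball bounded_cball]])
  ultimately show ?thesis by (simp add: compact_eq_bounded_closed)
qed

lemma automorphism_preserves_diagonal:
  fixes r :: real
  assumes r: "0 < r" "r < 1" and F: "biholo2 (Dr r) F K" and z: "cmod z < 1"
  shows "fst (F (z, z)) = snd (F (z, z))"
proof -
  obtain x0 where x0: "x0 < r" "0 \<le> x0" "\<And>z. cmod z < 1 \<Longrightarrow> pdist (fst (F (z, z))) (snd (F (z, z))) \<le> x0"
    using automorphism_diagonal_pdist_bound[OF r] F by metis
  define f where "f z = fst (F (z, z))" for z
  define g where "g z = snd (F (z, z))" for z
  have FD: "(f z, g z) \<in> Dr r" if "cmod z < 1" for z
    using F diagonal_mem_Dr[OF r(1) that] by (auto simp: biholo2_def f_def g_def)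
  hence fg: "cmod (f z) < 1" "cmod (g z) < 1" if "cmod z < 1" for z using that by (auto simp: Dr_iff)
  have hF: "hol2 (\<lambda>z. fst (F z)) (Dr r)" "hol2 (\<lambda>z. snd (F z)) (Dr r)" "continuous_on (Dr r) K"
    using F holo2_continuous_on by (auto simp: biholo2_def holo2_on_iff[of F])
  have hol: "f holomorphic_on ball 0 1" "g holomorphic_on ball 0 1"
    unfolding f_def g_def
    by (rule hol2_disc[OF hF(1)] hol2_disc[OF hF(2)]; use diagonal_mem_Dr[OF r(1)] in \<open>auto intro!: holomorphic_intros\<close>)+
  have proper: "\<exists>R<1. \<forall>z. R < cmod z \<and> cmod z < 1 \<longrightarrow> 1 - e < cmod (f z)" if e: "e > 0" for e
  proof -
    \<comment> \<open>A compact part of \<open>Dr r\<close> because \<open>x0 < r\<close>. Its image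
      under \<open>K\<close> is compact, so \<open>F (z, z)\<close> avoids \<open>C\<close> once
      \<open>cmod z\<close> is close to 1; as its \<open>pdist\<close> is at most \<open>x0\<close>,
      only \<open>cmod (f z) > 1 - e\<close> remains.\<close>
    define C where "C = {(a, b). cmod a \<le> 1 - e \<and> cmod a < 1 \<and> 1 - e < 1 \<and> cmod (a - b) \<le> x0 * cmod (1 - cnj a * b)}"
    have C: "compact C" unfolding C_def by (rule compact_pdist_le) (use x0 r in auto)
    have CD: "C \<subseteq> Dr r"
    proof
      fix p assume "p \<in> C"
      then obtain a b where p: "p = (a, b)" "cmod a < 1" "cmod (a - b) \<le> x0 * cmod (1 - cnj a * b)"
        by (auto simp: C_def)
      have b: "cmod b < 1" using cmod_less_1_of_cmod_diff_le[OF _ x0(2) p(2,3)] x0 r by simp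
      have "cmod (1 - cnj a * b) > 0" using pdist_denom_nonzero[of a b] p b by simp
      hence "x0 * cmod (1 - cnj a * b) < r * cmod (1 - cnj a * b)" using x0 by simp
      thus "p \<in> Dr r" using p b by (simp add: Dr_iff pdist_less_iff)
    qed
    have "compact ((\<lambda>p. cmod (fst (K p))) ` C)"
      by (intro compact_continuous_image C continuous_intros continuous_on_subset[OF hF(3) CD])
    moreover have KD: "K p \<in> Dr r" if "p \<in> C" for p using that CD F by (auto simp: biholo2_def)
    have lt: "cmod (fst (K p)) < 1" if "p \<in> C" for p
      using KD[OF that] Dr_iff[of "fst (K p)" "snd (K p)" r] by simp
    ultimately have "\<exists>R<1. \<forall>p\<in>C. cmod (fst (K p)) \<le> R"
    proof (cases "C = {}")
      case False
      with \<open>compact ((\<lambda>p. cmod (fst (K p))) ` C)\<close> obtain p where "p \<in> C" "\<forall>q\<in>C. cmod (fst (K q)) \<le> cmod (fst (K p))"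
        using compact_attains_sup[of "(\<lambda>p. cmod (fst (K p))) ` C"] by auto
      thus ?thesis using lt by blast
    qed (auto intro: exI[of _ 0])
    then obtain R where R: "R < 1" "\<And>p. p \<in> C \<Longrightarrow> cmod (fst (K p)) \<le> R" by blast
    have "1 - e < cmod (f z)" if z: "R < cmod z" "cmod z < 1" for z
    proof (rule ccontr)
      assume "\<not> 1 - e < cmod (f z)"
      moreover have "cmod (f z - g z) \<le> x0 * cmod (1 - cnj (f z) * g z)"
        using x0(3)[OF z(2)] pdist_denom_nonzero[of "f z" "g z"] fg[OF z(2)]
        by (simp add: pdist_def norm_divide divide_le_eq f_def[symmetric] g_def[symmetric])
      ultimately have "(f z, g z) \<in> C" using fg[OF z(2)] e by (simp add: C_def)
      hence "cmod (fst (K (f z, g z))) \<le> R" by (rule R)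
      moreover have "K (f z, g z) = (z, z)"
        using F diagonal_mem_Dr[OF r(1) z(2)] by (simp add: biholo2_def f_def g_def)
      ultimately show False using z by simp
    qed
    thus ?thesis using R(1) by blast
  qed
  have "f z - g z = 0"
  proof (rule holomorphic_zero_of_boundary_limit[OF _ _ z])
    show "(\<lambda>z. f z - g z) holomorphic_on ball 0 1" by (intro holomorphic_intros hol)
    fix e :: real assume e: "e > 0"
    have x1: "0 < 1 - x0^2" using x0 r by (simp add: power_less_one_iff)
    \<comment> \<open>With this \<open>d\<close> the bound of \<open>cmod_diff_le_of_pdist\<close>
      comes out as exactly \<open>e^2\<close>.\<close>
    define d where "d = e^2 * (1 - x0^2) / 2"
    have d: "d > 0" using e x1 by (simp add: d_def)
    obtain R where R: "R < 1" "\<And>z. R < cmod z \<Longrightarrow> cmod z < 1 \<Longrightarrow> 1 - d < cmod (f z)"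
      using proper[OF d] by blast
    have "cmod (f z - g z) \<le> e" if z: "R < cmod z" "cmod z < 1" for z
    proof -
      have "(cmod (f z - g z))^2 \<le> (1 - (cmod (f z))^2) / (1 - x0^2)"
        using fg[OF z(2)] x0 z r by (intro cmod_diff_le_of_pdist) (auto simp: f_def g_def)
      also have "\<dots> \<le> (2 * d) / (1 - x0^2)"
      proof (intro divide_right_mono)
        have "1 - (cmod (f z))^2 \<le> 2 * (1 - cmod (f z))" by (rule one_minus_square_le)
        thus "1 - (cmod (f z))^2 \<le> 2 * d" using R(2)[OF z] by argo
      qed (use x1 in auto)
      also have "\<dots> = e^2" using x1 by (simp add: d_def)
      finally show ?thesis using e by (simp add: power2_le_iff_abs_le)
    qed
    thus "\<exists>R<1. \<forall>z. R < cmod z \<and> cmod z < 1 \<longrightarrow> cmod (f z - g z) \<le> e" using R(1) by blast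
  qed
  thus ?thesis by (simp add: f_def g_def)
qed

section \<open>Linear automorphisms of \<open>Dr r\<close>\<close>

text \<open>Multiplication by \<open>c\<close> is a holomorphic self-map of the disc and so does not
  increase \<open>pdist\<close>.\<close>

lemma balanced2_Dr: "balanced2 (Dr r)"
  unfolding balanced2_def
proof (intro ballI allI impI)
  fix z :: "complex \<times> complex" and c :: complex assume z: "z \<in> Dr r" and c: "cmod c \<le> 1"
  obtain a b where ab: "z = (a, b)" "cmod a < 1" "cmod b < 1" "pdist a b < r"
    using z by (metis Dr_iff prod.collapse)
  have le: "cmod (c * w) < 1" if "cmod w < 1" for w
    using c that by (metis le_less_trans mult_left_le_one_le norm_ge_zero norm_mult)
  have "pdist (c * a) (c * b) \<le> pdist a b"
    using ab le by (intro Schwarz_Pick[of "\<lambda>w. c * w"]) (auto intro!: holomorphic_intros)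
  thus "cscale c z \<in> Dr r" using ab le by (simp add: cscale_def Dr_iff)
qed

lemma norm_Dr_le: "z \<in> Dr r \<Longrightarrow> norm z \<le> 2"
  using norm_Pair_le[of "fst z" "snd z"] by (cases z) (auto simp: Dr_iff)

lemma antidiagonal_mem_Dr:
  assumes "0 < r" "2 * cmod w < r" "r \<le> 1"
  shows "(w, - w) \<in> Dr r"
proof -
  have w: "cmod w < 1" using assms by linarith
  have "1 - cnj w * (- w) = of_real (1 + (cmod w)^2)"
    by (simp only: of_real_add of_real_1 complex_norm_square) (simp add: mult_ac)
  hence 1: "1 \<le> cmod (1 - cnj w * (- w))" by (simp only: norm_of_real) simp
  have "cmod (w - (- w)) = 2 * cmod w" by (simp add: norm_mult)
  also have "\<dots> < r * 1" using assms by simp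
  also have "\<dots> \<le> r * cmod (1 - cnj w * (- w))" using 1 assms by (intro mult_left_mono) auto
  finally show ?thesis using w by (simp add: Dr_iff pdist_less_iff)
qed

text \<open>Here U + W and U - W are the two coordinates; in the coordinates (U, W) the swap is
  (U, W) to (U, -W), and the commutator of a shear with it is unipotent, so that the shear part
  must vanish on a bounded domain.\<close>

lemma shear_automorphism_Dr:
  fixes r :: real and c d :: complex
  assumes r: "0 < r" "r < 1"
    and fwd: "\<And>U W. (U + W, U - W) \<in> Dr r \<Longrightarrow> (U + d * W + c * W, U + d * W - c * W) \<in> Dr r"
    and bwd: "\<And>U W. (U + W, U - W) \<in> Dr r \<Longrightarrow>
        \<exists>U' W'. (U' + W', U' - W') \<in> Dr r \<and> U = U' + d * W' \<and> W = c * W'"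
  shows "d = 0" "c = 1 \<or> c = -1"
proof -
  define w0 :: complex where "w0 = of_real (r / 4)"
  have w0: "(w0, - w0) \<in> Dr r" "w0 \<noteq> 0"
    using r by (auto intro!: antidiagonal_mem_Dr simp: w0_def)
  have sym: "(b, a) \<in> Dr r" if "(a, b) \<in> Dr r" for a b using that by (auto simp: Dr_iff pdist_sym)
  have bnd: "cmod U \<le> 1" "cmod W \<le> 1" if "(U + W, U - W) \<in> Dr r" for U W
  proof -
    have "cmod (U + W) < 1" "cmod (U - W) < 1" using that by (auto simp: Dr_iff)
    moreover have "cmod (2 * U) \<le> cmod (U + W) + cmod (U - W)" using norm_triangle_ineq[of "U + W" "U - W"] by simp
    moreover have "cmod (2 * W) \<le> cmod (U + W) + cmod (U - W)" using norm_triangle_ineq4[of "U + W" "U - W"] by simp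
    ultimately show "cmod U \<le> 1" "cmod W \<le> 1" by (simp_all add: norm_mult)
  qed
  have c0: "c \<noteq> 0" using bwd[of 0 w0] w0 by auto
  have shear: "(U + 2 * (d / c) * W + W, U + 2 * (d / c) * W - W) \<in> Dr r" if UW: "(U + W, U - W) \<in> Dr r" for U W
  proof -
    have "(U + (- W), U - (- W)) \<in> Dr r" using sym[OF UW] by simp
    then obtain U' W' where 1: "(U' + W', U' - W') \<in> Dr r" "U = U' + d * W'" "- W = c * W'" using bwd by blast
    have "(U' + (- W'), U' - (- W')) \<in> Dr r" using sym[OF 1(1)] by simp
    from fwd[OF this] have X: "(U' + d * (- W') + c * (- W'), U' + d * (- W') - c * (- W')) \<in> Dr r" .
    have W': "W' = - W / c" using 1(3) c0 by (simp add: field_simps)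
    have eqs: "U' + d * (- W') = U + 2 * (d / c) * W" "c * (- W') = W"
      using 1(2) c0 by (simp_all add: W' field_simps)
    show ?thesis using X unfolding eqs .
  qed
  have it: "(of_nat n * (2 * (d / c) * w0) + w0, of_nat n * (2 * (d / c) * w0) - w0) \<in> Dr r" for n
  proof (induction n)
    case (Suc n)
    have e: "of_nat n * (2 * (d / c) * w0) + 2 * (d / c) * w0 = of_nat (Suc n) * (2 * (d / c) * w0)"
      by (simp add: distrib_right add_divide_distrib)
    from shear[OF Suc] show ?case unfolding e .
  qed (use w0 in auto)
  have "real n * cmod (2 * (d / c) * w0) \<le> 1" for n
    using bnd(1)[OF it[of n]] by (simp only: norm_mult[of "of_nat n"] norm_of_nat)
  hence "cmod (2 * (d / c) * w0) = 0"
    by (metis ex_less_of_nat_mult norm_ge_zero not_le order_le_less)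
  thus d: "d = 0" using w0 c0 by simp
  have fwd': "(U + c * W, U - c * W) \<in> Dr r" if "(U + W, U - W) \<in> Dr r" for U W
    using fwd[OF that] d by simp
  have bwd': "(U + W / c, U - W / c) \<in> Dr r" if "(U + W, U - W) \<in> Dr r" for U W
    using bwd[OF that] d c0 by auto
  have f: "(c ^ n * w0, - (c ^ n * w0)) \<in> Dr r" for n
  proof (induction n)
    case (Suc n)
    with fwd'[of 0 "c ^ n * w0"] show ?case by (simp add: mult.assoc)
  qed (use w0 in auto)
  have b: "((1 / c) ^ n * w0, - ((1 / c) ^ n * w0)) \<in> Dr r" for n
  proof (induction n)
    case (Suc n)
    with bwd'[of 0 "(1 / c) ^ n * w0"] show ?case by (simp add: mult.assoc)
  qed (use w0 in auto)
  have le: "cmod x \<le> 1" if x: "\<And>n. (x ^ n * w0, - (x ^ n * w0)) \<in> Dr r" for x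
  proof (rule ccontr)
    assume "\<not> cmod x \<le> 1"
    then obtain n where "1 / cmod w0 < cmod x ^ n" using real_arch_pow[of "cmod x"] by auto
    hence "1 < cmod (x ^ n * w0)" using w0 by (simp add: norm_mult norm_power field_simps)
    thus False using x[of n] by (simp add: Dr_iff)
  qed
  have c1: "cmod c = 1" using le[OF f] le[OF b] c0 by (simp add: norm_divide divide_le_eq)
  \<comment> \<open>What remains is a rotation of \<open>W\<close>. Over \<open>U = 1 / 2\<close>
    the domain is not invariant under it: for \<open>W = x * k\<close> with
    \<open>cmod k = 1\<close> the squared denominator of \<open>pdist\<close> is
    \<open>(3 / 4 + x^2)^2 + (x * Im k)^2\<close>, smallest for real \<open>k\<close>.\<close>
  have "Im c = 0"
  proof (rule ccontr)
    assume Im: "Im c \<noteq> 0"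
    \<comment> \<open>\<open>x\<close> puts \<open>(1 / 2 + x, 1 / 2 - x)\<close> on the boundary.
      If \<open>Im c \<noteq> 0\<close>, the point with \<open>x * c\<close> in place of
      \<open>x\<close> is inside, and the inverse rotation would move it to that boundary
      point.\<close>
    have "\<exists>x::real. 0 \<le> x \<and> x \<le> 1 / 2 \<and> 2 * x - r * (3 / 4 + x^2) = 0"
      by (rule IVT') (use r in \<open>auto intro!: continuous_intros simp: power2_eq_square\<close>)
    then obtain x :: real where x: "0 \<le> x" "x \<le> 1 / 2" "2 * x = r * (3 / 4 + x^2)" by auto
    have x0: "x \<noteq> 0" using x(3) r by auto
    have xh: "x \<noteq> 1 / 2"
    proof
      assume h: "x = 1 / 2"
      have "2 * (1 / 2) = r * (3 / 4 + (1 / 2)^2)" using x(3) unfolding h .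
      thus False using r by (simp add: power2_eq_square)
    qed
    have nb: "cmod (1 / 2 + of_real x * k) < 1" "cmod (1 / 2 - of_real x * k) < 1" if "cmod k = 1" for k
    proof -
      have "cmod (of_real x * k) < 1 / 2" using that x xh by (simp add: norm_mult)
      thus "cmod (1 / 2 + of_real x * k) < 1" "cmod (1 / 2 - of_real x * k) < 1"
        using norm_triangle_ineq[of "1 / 2" "of_real x * k"] norm_triangle_ineq4[of "1 / 2" "of_real x * k"]
        by simp_all
    qed
    have den: "(cmod (1 - cnj (1 / 2 + of_real x * k) * (1 / 2 - of_real x * k)))^2
        = (3 / 4 + x^2)^2 + (x * Im k)^2" if k: "cmod k = 1" for k
    proof -
      have "(Re k)^2 + (Im k)^2 = 1" using k by (metis cmod_power2 one_power2)
      hence kk: "Re k * Re k + Im k * Im k = 1" by (simp add: power2_eq_square)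
      have "Re (1 - cnj (1 / 2 + of_real x * k) * (1 / 2 - of_real x * k)) = 3 / 4 + x^2 * (Re k * Re k + Im k * Im k)"
        by (simp add: algebra_simps power2_eq_square)
      moreover have "Im (1 - cnj (1 / 2 + of_real x * k) * (1 / 2 - of_real x * k)) = x * Im k"
        by (simp add: algebra_simps)
      ultimately show ?thesis unfolding cmod_power2 kk by simp
    qed
    have num: "cmod ((1 / 2 + of_real x * k) - (1 / 2 - of_real x * k)) = 2 * x" if k: "cmod k = 1" for k
      using k x by (simp add: norm_mult)
    have "(1 / 2 + of_real x * c, 1 / 2 - of_real x * c) \<in> Dr r"
    proof -
      have "0 < (x * Im c)^2" using Im x0 by simp
      hence "(3 / 4 + x^2)^2 < (cmod (1 - cnj (1 / 2 + of_real x * c) * (1 / 2 - of_real x * c)))^2"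
        unfolding den[OF c1] by simp
      hence "3 / 4 + x^2 < cmod (1 - cnj (1 / 2 + of_real x * c) * (1 / 2 - of_real x * c))"
        by (rule power2_less_imp_less) simp
      hence "2 * x < r * cmod (1 - cnj (1 / 2 + of_real x * c) * (1 / 2 - of_real x * c))"
        unfolding x(3) using r by simp
      thus ?thesis using nb[OF c1] num[OF c1] by (simp add: Dr_iff pdist_less_iff)
    qed
    from bwd'[of "1 / 2" "of_real x * c", OF this] have "(1 / 2 + of_real x, 1 / 2 - of_real x) \<in> Dr r"
      using c0 by simp
    moreover have "(cmod (1 - cnj (1 / 2 + of_real x * 1) * (1 / 2 - of_real x * 1)))^2 = (3 / 4 + x^2)^2"
      using den[of 1] by simp
    hence "cmod (1 - cnj (1 / 2 + of_real x * 1) * (1 / 2 - of_real x * 1)) = 3 / 4 + x^2"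
      by (subst (asm) power2_eq_iff_nonneg) auto
    moreover have "cmod (1 / 2 + of_real x) < 1" "cmod (1 / 2 - of_real x) < 1" using nb[of 1] by simp_all
    moreover have "cmod ((1 / 2 + of_real x) - (1 / 2 - of_real x)) = 2 * x" using num[of 1] by simp
    ultimately show False using x(3) by (simp add: Dr_iff pdist_less_iff)
  qed
  moreover have "(Re c)^2 + (Im c)^2 = 1" using c1 by (metis cmod_power2 one_power2)
  ultimately show "c = 1 \<or> c = -1" by (auto simp: complex_eq_iff power2_eq_1_iff)
qed

text \<open>Both \<open>F\<close> and \<open>K\<close> preserve the diagonal, on which they multiply
  by \<open>m\<close> and \<open>m'\<close> with \<open>m * m' = 1\<close>; both moduli are at most
  1, hence equal to 1. Dividing by \<open>m\<close> leaves a map of (half sum, half difference) that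
  is triangular with entries 1, \<open>d\<close>, \<open>c\<close>, as in
  \<open>shear_automorphism_Dr\<close>.\<close>

lemma linear_automorphism_Dr:
  fixes r :: real
  assumes r: "0 < r" "r < 1" and F: "biholo2 (Dr r) F K" and 0: "F 0 = 0"
  obtains c where "cmod c = 1" "(\<forall>z\<in>Dr r. F z = (c * fst z, c * snd z)) \<or> (\<forall>z\<in>Dr r. F z = (c * snd z, c * fst z))"
proof -
  have K: "biholo2 (Dr r) K F" and K0: "K 0 = 0"
    using F 0 zero_mem_Dr[OF r(1)] biholo2_sym by (auto simp: biholo2_def)
  have nb: "norm z \<le> 2" if "z \<in> Dr r" for z using that by (rule norm_Dr_le)
  obtain p q u v where L: "\<And>z. z \<in> Dr r \<Longrightarrow> F z = (p * fst z + q * snd z, u * fst z + v * snd z)"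
    using Cartan_linear[OF open_Dr balanced2_Dr zero_mem_Dr[OF r(1)] nb F 0] by blast
  obtain p' q' u' v' where M: "\<And>z. z \<in> Dr r \<Longrightarrow> K z = (p' * fst z + q' * snd z, u' * fst z + v' * snd z)"
    using Cartan_linear[OF open_Dr balanced2_Dr zero_mem_Dr[OF r(1)] nb K K0] by blast
  have FD: "F z \<in> Dr r" "K z \<in> Dr r" "K (F z) = z" "F (K z) = z" if "z \<in> Dr r" for z
    using F that by (auto simp: biholo2_def)
  define m where "m = p + q"
  define m' where "m' = p' + q'"
  have le: "cmod x \<le> 1" if "\<And>z. cmod z < 1 \<Longrightarrow> cmod (x * z) < 1" for x
  proof (rule ccontr)
    assume "\<not> cmod x \<le> 1"
    hence "cmod (1 / x) < 1" "x \<noteq> 0" by (auto simp: norm_divide divide_less_eq)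
    from that[OF this(1)] this(2) show False by simp
  qed
  have half: "cmod (1 / 2) < 1" by simp
  have uv: "u + v = m"
  proof -
    have "p * (1 / 2) + q * (1 / 2) = u * (1 / 2) + v * (1 / 2)"
      using automorphism_preserves_diagonal[OF r F, of "1 / 2"] half
      unfolding L[OF diagonal_mem_Dr[OF r(1) half]] by (simp only: fst_conv snd_conv)
    hence "(p + q) * (1 / 2) = (u + v) * (1 / 2)" by (simp only: distrib_right)
    thus ?thesis unfolding m_def by (subst (asm) mult_cancel_right) simp
  qed
  have m: "F (z, z) = (m * z, m * z)" if "cmod z < 1" for z
    using L[OF diagonal_mem_Dr[OF r(1) that]] uv by (simp add: m_def distrib_right[symmetric])
  have uv': "u' + v' = m'"
  proof -
    have "p' * (1 / 2) + q' * (1 / 2) = u' * (1 / 2) + v' * (1 / 2)"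
      using automorphism_preserves_diagonal[OF r K, of "1 / 2"] half
      unfolding M[OF diagonal_mem_Dr[OF r(1) half]] by (simp only: fst_conv snd_conv)
    hence "(p' + q') * (1 / 2) = (u' + v') * (1 / 2)" by (simp only: distrib_right)
    thus ?thesis unfolding m'_def by (subst (asm) mult_cancel_right) simp
  qed
  have m': "K (z, z) = (m' * z, m' * z)" if "cmod z < 1" for z
    using M[OF diagonal_mem_Dr[OF r(1) that]] uv' by (simp add: m'_def distrib_right[symmetric])
  have b: "cmod (m * z) < 1" "cmod (m' * z) < 1" if "cmod z < 1" for z
    using FD(1,2)[OF diagonal_mem_Dr[OF r(1) that]] m[OF that] m'[OF that] by (auto simp: Dr_iff)
  have mm: "m' * (m * (1 / 2)) = 1 / 2"
    using FD(3)[OF diagonal_mem_Dr[OF r(1)], of "1 / 2"] m[of "1 / 2"] m'[of "m * (1 / 2)"] b(1)[of "1 / 2"] by simp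
  hence "cmod m' * cmod m = 1" by (simp add: norm_mult[symmetric])
  moreover have "cmod m \<le> 1" "cmod m' \<le> 1" using le b by auto
  ultimately have m1: "cmod m = 1"
    by (metis mult_left_le_one_le norm_ge_zero order_antisym)
  hence m0: "m \<noteq> 0" by auto
  define d where "d = (p - q + u - v) / (2 * m)"
  define c where "c = (p - q - u + v) / (2 * m)"
  have F_UW: "F (U + W, U - W) = (m * (U + d * W + c * W), m * (U + d * W - c * W))" if "(U + W, U - W) \<in> Dr r" for U W
  proof -
    have "m * d + m * c = p - q" "m * d - m * c = u - v"
      using m0 by (simp_all add: d_def c_def add_divide_distrib[symmetric] diff_divide_distrib[symmetric])
    moreover have "m * (U + d * W + c * W) = m * U + (m * d + m * c) * W" "m * (U + d * W - c * W) = m * U + (m * d - m * c) * W"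
      by (simp_all add: algebra_simps)
    ultimately have "m * (U + d * W + c * W) = (p + q) * U + (p - q) * W" "m * (U + d * W - c * W) = (u + v) * U + (u - v) * W"
      using uv by (simp_all add: m_def)
    thus ?thesis using L[OF that] by (simp add: algebra_simps)
  qed
  have rot: "(x / m, y / m) \<in> Dr r" "(m * x, m * y) \<in> Dr r" if "(x, y) \<in> Dr r" for x y
    using balanced2_Dr[of r, unfolded balanced2_def, rule_format, OF that, of "1 / m"]
      balanced2_Dr[of r, unfolded balanced2_def, rule_format, OF that, of m] m1
    by (simp_all add: cscale_def norm_divide)
  have fwd: "(U + d * W + c * W, U + d * W - c * W) \<in> Dr r" if UW: "(U + W, U - W) \<in> Dr r" for U W
    using FD(1)[OF UW] rot(1)[of "m * (U + d * W + c * W)" "m * (U + d * W - c * W)"] m0 F_UW[OF UW] by simp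
  have bwd: "\<exists>U' W'. (U' + W', U' - W') \<in> Dr r \<and> U = U' + d * W' \<and> W = c * W'"
    if UW: "(U + W, U - W) \<in> Dr r" for U W
  proof -
    obtain a b where ab: "K (m * (U + W), m * (U - W)) = (a, b)" by fastforce
    define U' where "U' = (a + b) / 2"
    define W' where "W' = (a - b) / 2"
    have 1: "a = U' + W'" "b = U' - W'" by (simp_all add: U'_def W'_def field_simps)
    have D: "(U' + W', U' - W') \<in> Dr r" using FD(2)[OF rot(2)[OF UW]] ab 1 by simp
    have "F (U' + W', U' - W') = (m * (U + W), m * (U - W))"
      using FD(4)[OF rot(2)[OF UW]] ab 1 by simp
    hence "U + W = U' + d * W' + c * W'" "U - W = U' + d * W' - c * W'"
      unfolding F_UW[OF D] using m0 by simp_all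
    hence "U = U' + d * W'" "W = c * W'" by (simp_all add: complex_eq_iff)
    thus ?thesis using D by blast
  qed
  have d0: "d = 0" and c1: "c = 1 \<or> c = -1" using shear_automorphism_Dr[OF r fwd bwd] by blast+
  have "F z = (m * ((fst z + snd z) / 2 + c * ((fst z - snd z) / 2)), m * ((fst z + snd z) / 2 - c * ((fst z - snd z) / 2)))"
    if "z \<in> Dr r" for z
    using F_UW[of "(fst z + snd z) / 2" "(fst z - snd z) / 2"] that d0
    by (simp add: add_divide_distrib[symmetric] diff_divide_distrib[symmetric])
  with c1 show thesis
    by (intro that[OF m1]) (auto simp: add_divide_distrib[symmetric] diff_divide_distrib[symmetric])
qed

theorem automorphism_Dr:
  fixes r :: real
  assumes r: "0 < r" "r < 1" and F: "biholo2 (Dr r) F K"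
  shows "\<exists>\<phi>\<in>aut_disc. (\<forall>z\<in>Dr r. F z = diag_map \<phi> z) \<or> (\<forall>z\<in>Dr r. F z = (diag_map \<phi> \<circ> sigma) z)"
proof -
  define a where "a = fst (F 0)"
  have F0: "F 0 = (a, a)" using automorphism_preserves_diagonal[OF r F, of 0]
    by (simp add: a_def zero_prod_def prod_eq_iff)
  have FD: "F z \<in> Dr r" if "z \<in> Dr r" for z using F that by (auto simp: biholo2_def)
  have a: "cmod a < 1" using FD[OF zero_mem_Dr[OF r(1)]] F0 by (simp add: Dr_iff)
  let ?\<mu> = "Moebius_function 0 a"
  obtain \<nu> where \<nu>: "\<nu> \<in> aut_disc" "\<And>z. cmod z < 1 \<Longrightarrow> \<nu> (?\<mu> z) = z" "biholo2 (Dr r) (diag_map ?\<mu>) (diag_map \<nu>)"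
    using biholo2_diag_map[OF Moebius_function_aut_disc[OF a], of "Dr r" r] by metis
  have "biholo2 (Dr r) (\<lambda>z. diag_map ?\<mu> (F z)) (\<lambda>z. K (diag_map \<nu> z))" by (rule biholo2_comp[OF \<nu>(3) F])
  moreover have "diag_map ?\<mu> (F 0) = 0" by (simp add: F0 Moebius_function_eq_zero) (simp add: zero_prod_def)
  ultimately obtain c where c: "cmod c = 1"
    "(\<forall>z\<in>Dr r. diag_map ?\<mu> (F z) = (c * fst z, c * snd z)) \<or> (\<forall>z\<in>Dr r. diag_map ?\<mu> (F z) = (c * snd z, c * fst z))"
    using linear_automorphism_Dr[OF r] by metis
  let ?\<phi> = "\<nu> \<circ> (\<lambda>z. c * z)"
  have "?\<phi> \<in> aut_disc" using aut_disc_comp \<nu>(1) rotation_aut_disc[OF c(1)] by blast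
  moreover have "diag_map \<nu> (diag_map ?\<mu> (F z)) = F z" if "z \<in> Dr r" for z
    using FD[OF that] \<nu>(2) by (cases "F z") (auto simp: Dr_iff)
  hence "(\<forall>z\<in>Dr r. F z = diag_map ?\<phi> z) \<or> (\<forall>z\<in>Dr r. F z = (diag_map ?\<phi> \<circ> sigma) z)"
    using c(2) by (fastforce simp: diag_map_def sigma_def)
  ultimately show ?thesis by blast
qed

subsection \<open>Integrals over pseudohyperbolic circles\<close>

text \<open>Exchanging the two contour integrals transfers Cauchy's formula from the integrands to
  the integral; a Cauchy integral with continuous density is differentiable.\<close>

lemma holomorphic_param_circlepath:
  fixes g :: "complex \<Rightarrow> complex \<Rightarrow> complex"
  assumes S: "open S" and R: "0 < R"
    and cont: "continuous_on (S \<times> sphere c R) (\<lambda>(z, u). g z u)"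
    and hol: "\<And>u. u \<in> sphere c R \<Longrightarrow> (\<lambda>z. g z u) holomorphic_on S"
  shows "(\<lambda>z. contour_integral (circlepath c R) (g z)) holomorphic_on S"
proof -
  define a where "a z = contour_integral (circlepath c R) (g z)" for z
  have pi: "path_image (circlepath c R) = sphere c R" using R by simp
  have conta: "continuous_on S a"
  proof -
    have 1: "continuous_on (S \<times> cbox 0 1) (\<lambda>p. (fst p, circlepath c R (snd p)))"
      by (intro continuous_intros) (auto simp: circlepath intro!: continuous_intros)
    have im: "(\<lambda>p. (fst p, circlepath c R (snd p))) ` (S \<times> cbox 0 1) \<subseteq> S \<times> sphere c R"
      using pi by (auto simp: path_image_def simp del: path_image_circlepath_nonneg)
    have "continuous_on (S \<times> cbox 0 1) (\<lambda>p. g (fst p) (circlepath c R (snd p)) * vector_derivative (circlepath c R) (at (snd p)))"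
      using continuous_on_compose2[OF cont 1 im]
      by (intro continuous_intros) (auto simp: vector_derivative_circlepath intro!: continuous_intros)
    hence "continuous_on S (\<lambda>z. integral (cbox 0 1) (\<lambda>t. g z (circlepath c R t) * vector_derivative (circlepath c R) (at t)))"
      by (intro integral_continuous_on_param) (simp add: case_prod_unfold)
    thus ?thesis by (simp add: a_def contour_integral_integral[abs_def])
  qed
  have "a field_differentiable at z0" if z0: "z0 \<in> S" for z0
  proof -
    obtain d where d: "d > 0" "cball z0 d \<subseteq> S" using S z0 open_contains_cball by metis
    have pid: "path_image (circlepath z0 d) = sphere z0 d" "sphere z0 d \<subseteq> S" using d by auto
    have ca: "continuous_on (path_image (circlepath z0 d)) a"
      using continuous_on_subset[OF conta pid(2)] pid(1) by simp
    have rep: "((\<lambda>v. a v / (v - z) ^ 1) has_contour_integral (2 * of_real pi * \<i> * a z)) (circlepath z0 d)"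
      if z: "z \<in> ball z0 d" for z
    proof -
      have nz: "v - z \<noteq> 0" if "v \<in> sphere z0 d" for v using that z by (auto simp: dist_norm)
      have "(\<lambda>v. a v / (v - z) ^ 1) contour_integrable_on circlepath z0 d"
        by (rule contour_integrable_continuous_circlepath) (use ca nz d in \<open>auto intro!: continuous_intros\<close>)
      moreover have "contour_integral (circlepath z0 d) (\<lambda>v. a v / (v - z) ^ 1) = 2 * of_real pi * \<i> * a z"
      proof -
        have "contour_integral (circlepath z0 d) (\<lambda>v. a v / (v - z) ^ 1)
            = contour_integral (circlepath z0 d) (\<lambda>v. contour_integral (circlepath c R) (\<lambda>u. g v u / (v - z)))"
        proof (rule contour_integral_cong[OF refl])
          fix v assume v: "v \<in> path_image (circlepath z0 d)"
          have "continuous_on (sphere c R) (\<lambda>u. case (v, u) of (z, u) \<Rightarrow> g z u)"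
            by (rule continuous_on_compose2[OF cont]) (use v pid in \<open>auto intro!: continuous_intros\<close>)
          hence "g v contour_integrable_on circlepath c R"
            by (intro contour_integrable_continuous_circlepath, unfold pi) simp
          from contour_integral_rmul[OF this, of "1 / (v - z)"]
          show "a v / (v - z) ^ 1 = contour_integral (circlepath c R) (\<lambda>u. g v u / (v - z))"
            by (simp add: a_def)
        qed
        also have "\<dots> = contour_integral (circlepath c R) (\<lambda>u. contour_integral (circlepath z0 d) (\<lambda>v. g v u / (v - z)))"
        proof (rule contour_integral_swap)
          have "continuous_on (sphere z0 d \<times> sphere c R) (\<lambda>p. g (fst p) (snd p))"
            using continuous_on_subset[OF cont, of "sphere z0 d \<times> sphere c R"] pid(2)
            by (auto simp: case_prod_unfold)
          hence "continuous_on (sphere z0 d \<times> sphere c R) (\<lambda>p. g (fst p) (snd p) / (fst p - z))"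
            by (intro continuous_intros) (use nz in auto)
          thus "continuous_on (path_image (circlepath z0 d) \<times> path_image (circlepath c R)) (\<lambda>(v, u). g v u / (v - z))"
            unfolding pi pid(1) by (simp add: case_prod_unfold)
        qed (auto simp: vector_derivative_circlepath intro!: continuous_intros)
        also have "\<dots> = contour_integral (circlepath c R) (\<lambda>u. g z u * (2 * of_real pi * \<i>))"
        proof (rule contour_integral_cong[OF refl])
          fix u assume "u \<in> path_image (circlepath c R)"
          hence "(\<lambda>v. g v u) holomorphic_on cball z0 d"
            using hol pi d holomorphic_on_subset by metis
          from Cauchy_integral_circlepath_simple[OF this, of z] z
          show "contour_integral (circlepath z0 d) (\<lambda>v. g v u / (v - z)) = g z u * (2 * of_real pi * \<i>)"
            by (subst contour_integral_unique) (auto simp: dist_norm norm_minus_commute mult_ac)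
        qed
        also have "\<dots> = a z * (2 * of_real pi * \<i>)"
        proof -
          have "continuous_on (sphere c R) (\<lambda>u. case (z, u) of (z, u) \<Rightarrow> g z u)"
            by (rule continuous_on_compose2[OF cont]) (use z d in \<open>auto intro!: continuous_intros\<close>)
          hence "g z contour_integrable_on circlepath c R"
            by (intro contour_integrable_continuous_circlepath, unfold pi) simp
          thus ?thesis unfolding a_def by (rule contour_integral_rmul)
        qed
        finally show ?thesis by (simp add: mult_ac)
      qed
      ultimately show ?thesis using has_contour_integral_integral by metis
    qed
    have z0d: "z0 \<in> ball z0 d" using d by simp
    define k :: complex where "k = 2 * of_real pi * \<i>"
    have k: "k \<noteq> 0" by (simp add: k_def)
    from Cauchy_next_derivative_circlepath(2)[OF ca rep _ z0d]
    have "(\<lambda>z. k * a z) field_differentiable at z0"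
      unfolding field_differentiable_def k_def by auto
    hence "(\<lambda>z. inverse k * (k * a z)) field_differentiable at z0"
      by (rule field_differentiable_mult[OF field_differentiable_const])
    moreover have "(\<lambda>z. inverse k * (k * a z)) = a" using k by (simp add: fun_eq_iff)
    ultimately show ?thesis by (simp only:)
  qed
  thus ?thesis unfolding a_def[abs_def, symmetric] holomorphic_on_def
    using field_differentiable_at_within by blast
qed

text \<open>The pseudohyperbolic circle of radius \<open>\<tau>\<close> about \<open>z\<close>. Its
  Euclidean centre and radius involve \<open>cmod z\<close>, so this contour does not move
  holomorphically with \<open>z\<close>.\<close>

definition pcircle :: "real \<Rightarrow> complex \<Rightarrow> real \<Rightarrow> complex" where
  "pcircle \<tau> z = circlepath (disc_center \<tau> z) (disc_radius \<tau> z)"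

lemma path_image_pcircle:
  assumes "0 < \<tau>" "\<tau> < 1" "cmod z < 1"
  shows "path_image (pcircle \<tau> z) = {u. cmod u < 1 \<and> pdist z u = \<tau>}"
proof -
  have "path_image (pcircle \<tau> z) = {u. cmod (u - disc_center \<tau> z) = disc_radius \<tau> z}"
    using disc_radius_nonneg[of \<tau> z] assms by (auto simp: pcircle_def sphere_def dist_norm norm_minus_commute)
  also have "\<dots> = {u. cmod u < 1 \<and> pdist z u = \<tau>}"
    using mem_disc_imp_cmod_less_1[of \<tau> z] pdist_eq_iff_disc[OF assms] assms by auto
  finally show ?thesis .
qed

lemma valid_path_pcircle [simp]: "valid_path (pcircle \<tau> z)"
  by (simp add: pcircle_def)

lemma open_fibre: "open {u. (z, u) \<in> Dst s t}"
proof -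
  have "open (Pair z -` Dst s t)" by (intro open_vimage open_Dst continuous_intros)
  thus ?thesis by (simp add: vimage_def)
qed

lemma isCont_disc_center:
  assumes "0 \<le> \<tau>" "\<tau> < 1" "cmod z0 < 1"
  shows "isCont (disc_center \<tau>) z0" "isCont (disc_radius \<tau>) z0"
proof -
  have nz: "1 - \<tau>^2 * (cmod z0)^2 \<noteq> 0" using disc_denom_pos[of \<tau> z0] assms by simp
  have D: "isCont (\<lambda>z. 1 - \<tau>^2 * (cmod z)^2) z0" by (intro continuous_intros)
  show "isCont (disc_center \<tau>) z0" unfolding disc_center_def[abs_def]
    by (intro continuous_mult continuous_of_real isCont_divide D nz continuous_const continuous_ident)
  have N: "isCont (\<lambda>z. \<tau> * (1 - (cmod z)^2)) z0" by (intro continuous_intros)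
  show "isCont (disc_radius \<tau>) z0" unfolding disc_radius_def[abs_def]
    by (rule isCont_divide[OF N D nz])
qed

text \<open>Allows the moving contour to be frozen: for \<open>z\<close> near \<open>z0\<close> its
  circle can be deformed within the fibre over \<open>z\<close> to the fixed circle of
  \<open>z0\<close>.\<close>

lemma pcircle_nearby:
  assumes \<tau>: "0 < \<tau>" "\<tau> < 1" "s < \<tau>" "\<tau> < t" and z0: "cmod z0 < 1"
  obtains d where "0 < d"
    "\<And>z. z \<in> ball z0 d \<Longrightarrow> cmod z < 1"
    "\<And>z u. z \<in> ball z0 d \<Longrightarrow> u \<in> path_image (pcircle \<tau> z0) \<Longrightarrow> (z, u) \<in> Dst s t"
    "\<And>z. z \<in> ball z0 d \<Longrightarrow> homotopic_loops {u. (z, u) \<in> Dst s t} (pcircle \<tau> z) (pcircle \<tau> z0)"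
proof -
  define C where "C = {z0} \<times> path_image (pcircle \<tau> z0)"
  have "compact C" unfolding C_def by (intro compact_Times compact_valid_path_image valid_path_pcircle) auto
  moreover have "C \<subseteq> Dst s t" using \<tau> z0 by (auto simp: C_def path_image_pcircle Dst_iff)
  ultimately obtain e where e: "e > 0" "(\<Union>x\<in>C. ball x e) \<subseteq> Dst s t"
    using compact_subset_open_imp_ball_epsilon_subset[OF _ open_Dst] by blast
  have near: "(z, v) \<in> Dst s t" if "u \<in> path_image (pcircle \<tau> z0)" "cmod (z - z0) + cmod (v - u) < e" for z u v
  proof -
    have "dist (z0, u) (z, v) \<le> cmod (z0 - z) + cmod (u - v)"
      using norm_Pair_le[of "z0 - z" "u - v"] by (simp add: dist_norm)
    hence "(z, v) \<in> ball (z0, u) e" using that by (simp add: norm_minus_commute)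
    moreover have "(z0, u) \<in> C" using that by (simp add: C_def)
    ultimately show ?thesis using e(2) by blast
  qed
  have "isCont (\<lambda>z. cmod (z - z0) + (cmod (disc_center \<tau> z - disc_center \<tau> z0) + \<bar>disc_radius \<tau> z - disc_radius \<tau> z0\<bar>)) z0"
    using isCont_disc_center[of \<tau> z0] \<tau> z0 by (intro continuous_intros) auto
  then obtain d1 where d1: "d1 > 0" "\<And>z. dist z z0 < d1 \<Longrightarrow>
     cmod (z - z0) + (cmod (disc_center \<tau> z - disc_center \<tau> z0) + \<bar>disc_radius \<tau> z - disc_radius \<tau> z0\<bar>) < e"
    unfolding continuous_at_eps_delta using e(1) by (fastforce simp: dist_real_def abs_less_iff)
  define d where "d = min d1 (1 - cmod z0)"
  show thesis
  proof (rule that[of d])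
    show "0 < d" using d1 z0 by (simp add: d_def)
    fix z assume z: "z \<in> ball z0 d"
    hence z1: "cmod (z - z0) < 1 - cmod z0" by (simp add: d_def dist_norm norm_minus_commute)
    thus "cmod z < 1" using norm_triangle_ineq2[of z z0] by linarith
    have lt: "cmod (z - z0) + (cmod (disc_center \<tau> z - disc_center \<tau> z0) + \<bar>disc_radius \<tau> z - disc_radius \<tau> z0\<bar>) < e"
      using d1(2)[of z] z by (simp add: d_def dist_commute)
    show "(z, u) \<in> Dst s t" if "u \<in> path_image (pcircle \<tau> z0)" for u
    proof -
      have "cmod (z - z0) < e" using lt by (smt (verit) norm_ge_zero)
      thus ?thesis using near[OF that, of z u] by simp
    qed
    show "homotopic_loops {u. (z, u) \<in> Dst s t} (pcircle \<tau> z) (pcircle \<tau> z0)"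
    proof (rule homotopic_loops_linear)
      fix x :: real assume x: "x \<in> {0..1}"
      show "closed_segment (pcircle \<tau> z x) (pcircle \<tau> z0 x) \<subseteq> {u. (z, u) \<in> Dst s t}"
      proof
        fix v assume "v \<in> closed_segment (pcircle \<tau> z x) (pcircle \<tau> z0 x)"
        hence "cmod (v - pcircle \<tau> z0 x) \<le> cmod (pcircle \<tau> z x - pcircle \<tau> z0 x)"
          using segment_bound1[of v "pcircle \<tau> z0 x" "pcircle \<tau> z x"] by (simp add: closed_segment_commute)
        also have "pcircle \<tau> z x - pcircle \<tau> z0 x = (disc_center \<tau> z - disc_center \<tau> z0)
            + of_real (disc_radius \<tau> z - disc_radius \<tau> z0) * exp (2 * of_real pi * \<i> * of_real x)"
          by (simp add: pcircle_def circlepath algebra_simps)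
        also have "cmod \<dots> \<le> cmod (disc_center \<tau> z - disc_center \<tau> z0) + \<bar>disc_radius \<tau> z - disc_radius \<tau> z0\<bar>"
        proof -
          have "cmod (exp (2 * of_real pi * \<i> * of_real x)) = 1" by simp
          thus ?thesis
            using norm_triangle_ineq[of "disc_center \<tau> z - disc_center \<tau> z0" "of_real (disc_radius \<tau> z - disc_radius \<tau> z0) * exp (2 * of_real pi * \<i> * of_real x)"]
            by (simp only: norm_mult norm_of_real mult_1_right)
        qed
        finally have "cmod (z - z0) + cmod (v - pcircle \<tau> z0 x) < e" using lt by linarith
        moreover have "pcircle \<tau> z0 x \<in> path_image (pcircle \<tau> z0)" using x by (simp add: path_image_def)
        ultimately show "v \<in> {u. (z, u) \<in> Dst s t}" using near by blast
      qed
    qed (auto simp: pcircle_def)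
  qed
qed

text \<open>Locally in \<open>z\<close> the contour is replaced by a fixed one through homotopy, and
  then only the integrand depends on \<open>z\<close>. The set \<open>Z\<close> admits integrands
  such as \<open>f (z, u) / (u - w)\<close>, which are regular only for some base points.\<close>

lemma pcircle_integral_holomorphic:
  assumes \<tau>: "0 < \<tau>" "\<tau> < 1" "s < \<tau>" "\<tau> < t" and Z: "open Z" "Z \<subseteq> unit_disc"
    and g: "hol2 g {p \<in> Dst s t. fst p \<in> Z}"
  shows "(\<lambda>z. contour_integral (pcircle \<tau> z) (\<lambda>u. g (z, u))) holomorphic_on Z"
  unfolding holomorphic_on_def
proof
  fix z0 assume z0: "z0 \<in> Z"
  hence z01: "cmod z0 < 1" using Z by auto
  obtain d1 where d1: "0 < d1" "\<And>z. z \<in> ball z0 d1 \<Longrightarrow> cmod z < 1"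
    "\<And>z u. z \<in> ball z0 d1 \<Longrightarrow> u \<in> path_image (pcircle \<tau> z0) \<Longrightarrow> (z, u) \<in> Dst s t"
    "\<And>z. z \<in> ball z0 d1 \<Longrightarrow> homotopic_loops {u. (z, u) \<in> Dst s t} (pcircle \<tau> z) (pcircle \<tau> z0)"
    using pcircle_nearby[OF \<tau> z01] by metis
  obtain d2 where d2: "d2 > 0" "ball z0 d2 \<subseteq> Z" using Z z0 by (meson openE)
  define d where "d = min d1 d2"
  have d: "d > 0" "ball z0 d \<subseteq> ball z0 d1" "ball z0 d \<subseteq> Z" using d1 d2 by (auto simp: d_def)
  have R: "0 < disc_radius \<tau> z0" using disc_radius_pos \<tau> z01 by simp
  have pi: "path_image (pcircle \<tau> z0) = sphere (disc_center \<tau> z0) (disc_radius \<tau> z0)"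
    using R by (simp add: pcircle_def)
  have eq: "contour_integral (pcircle \<tau> z) (\<lambda>u. g (z, u)) = contour_integral (pcircle \<tau> z0) (\<lambda>u. g (z, u))"
    if z: "z \<in> ball z0 d" for z
  proof (rule Cauchy_theorem_homotopic_loops[OF d1(4) open_fibre])
    show "z \<in> ball z0 d1" using z d by auto
    show "(\<lambda>u. g (z, u)) holomorphic_on {u. (z, u) \<in> Dst s t}"
      by (rule hol2_disc[OF g]) (use z d open_fibre in \<open>auto intro!: holomorphic_intros\<close>)
  qed auto
  have "(\<lambda>z. contour_integral (circlepath (disc_center \<tau> z0) (disc_radius \<tau> z0)) (\<lambda>u. g (z, u))) holomorphic_on ball z0 d"
  proof (rule holomorphic_param_circlepath[OF open_ball R])
    have sub: "ball z0 d \<times> sphere (disc_center \<tau> z0) (disc_radius \<tau> z0) \<subseteq> {p \<in> Dst s t. fst p \<in> Z}"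
      using d d1(3) pi by auto
    show "continuous_on (ball z0 d \<times> sphere (disc_center \<tau> z0) (disc_radius \<tau> z0)) (\<lambda>(z, u). g (z, u))"
      using continuous_on_subset[OF hol2_continuous_on[OF g] sub] by (simp add: case_prod_unfold)
    show "(\<lambda>z. g (z, u)) holomorphic_on ball z0 d" if "u \<in> sphere (disc_center \<tau> z0) (disc_radius \<tau> z0)" for u
    proof (rule hol2_disc[OF g])
      fix z assume "z \<in> ball z0 d"
      with that sub show "(z, u) \<in> {p \<in> Dst s t. fst p \<in> Z}" by blast
    qed (auto intro!: holomorphic_intros)
  qed
  hence "(\<lambda>z. contour_integral (pcircle \<tau> z0) (\<lambda>u. g (z, u))) holomorphic_on ball z0 d"
    by (simp only: pcircle_def)
  hence "(\<lambda>z. contour_integral (pcircle \<tau> z) (\<lambda>u. g (z, u))) holomorphic_on ball z0 d"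
    by (rule holomorphic_transform) (simp add: eq)
  hence "(\<lambda>z. contour_integral (pcircle \<tau> z) (\<lambda>u. g (z, u))) field_differentiable at z0"
    using d by (auto simp: holomorphic_on_imp_differentiable_at)
  thus "(\<lambda>z. contour_integral (pcircle \<tau> z) (\<lambda>u. g (z, u))) field_differentiable at z0 within Z"
    by (rule field_differentiable_at_within)
qed

lemma pdist_tends_to_1:
  assumes a: "cmod a < 1"
  obtains R where "R < 1" "\<And>z. R < cmod z \<Longrightarrow> cmod z < 1 \<Longrightarrow> 1 / 2 \<le> pdist a z"
proof -
  \<comment> \<open>From \<open>pdist_square\<close>, \<open>1 - (pdist a z)^2\<close> is at most
    \<open>2 * (1 - cmod z) / (1 - cmod a)^2\<close>; this is below \<open>3 / 4\<close> for
    \<open>cmod z > R\<close>.\<close>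
  define R where "R = 1 - 3 * (1 - cmod a)^2 / 8"
  have R: "R < 1" using a by (simp add: R_def)
  have "1 / 2 \<le> pdist a z" if z: "R < cmod z" "cmod z < 1" for z
  proof -
    have "1 - cmod a \<le> cmod (1 - cnj a * z)"
    proof -
      have "cmod (cnj a * z) \<le> cmod a * 1" unfolding norm_mult complex_mod_cnj
        using z by (intro mult_left_mono) auto
      thus ?thesis using norm_triangle_ineq2[of 1 "cnj a * z"] by simp
    qed
    hence 1: "(1 - cmod a)^2 \<le> (cmod (1 - cnj a * z))^2" using a by (intro power_mono) auto
    have 2: "0 < (1 - cmod a)^2" using a by simp
    have "(1 - (cmod a)^2) * (1 - (cmod z)^2) \<le> 1 * (2 * (1 - cmod z))"
    proof (intro mult_mono)
      show "1 - (cmod z)^2 \<le> 2 * (1 - cmod z)" by (rule one_minus_square_le)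
    qed (use a z in \<open>auto simp: power_le_one\<close>)
    also have "\<dots> \<le> 3 / 4 * (1 - cmod a)^2" using z by (simp add: R_def)
    also have "\<dots> \<le> 3 / 4 * (cmod (1 - cnj a * z))^2" using 1 by simp
    finally have "(1 - (cmod a)^2) * (1 - (cmod z)^2) / (cmod (1 - cnj a * z))^2 \<le> 3 / 4"
      using 1 2 by (subst pos_divide_le_eq) auto
    hence "1 - (pdist a z)^2 \<le> 3 / 4" using pdist_square[OF a z(2)] by simp
    hence "(1 / 2)^2 \<le> (pdist a z)^2" by (simp add: power2_eq_square)
    thus ?thesis by (rule power2_le_imp_le) simp
  qed
  with R show thesis by (rule that)
qed

text \<open>The weight is holomorphic in both variables because the graph of the affine function m stays
  at pseudohyperbolic distance at least beta from the diagonal. The circle integral is then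
  holomorphic in the base point, and it tends to 0 at the boundary since the circles shrink.\<close>

lemma outer_Cauchy_integral_vanishes:
  fixes s t \<tau> :: real
  assumes \<tau>: "0 < \<tau>" "\<tau> < 1" "s < \<tau>" "\<tau> < t"
    and f: "hol2 f (Dst s t)" "\<And>p. p \<in> Dst s t \<Longrightarrow> cmod (f p) \<le> 1"
    and a: "cmod a < 1" and b: "cmod b < 1" "\<tau> < pdist a b"
  shows "contour_integral (pcircle \<tau> a) (\<lambda>u. f (a, u) / (u - b)) = 0"
proof -
  let ?\<psi> = "Moebius_function 0 a"
  define b0 where "b0 = ?\<psi> b"
  define \<beta> where "\<beta> = pdist a b"
  have \<beta>: "cmod b0 = \<beta>" "\<tau> < \<beta>" "0 < \<beta>" "\<beta> < 1" "0 < 1 - \<beta>^2"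
    using b \<tau> pdist_less_1[OF a b(1)] by (auto simp: b0_def \<beta>_def norm_Moebius_function power_less_one_iff)
  have \<psi>: "?\<psi> \<in> aut_disc" "\<And>z. cmod z < 1 \<Longrightarrow> cmod (?\<psi> z) < 1" "?\<psi> holomorphic_on unit_disc"
    using Moebius_function_aut_disc[OF a] Moebius_function_norm_lt_1[OF a] Moebius_function_holomorphic[OF a]
    by (auto simp: unit_disc_def)
  \<comment> \<open>The graph of \<open>m\<close> is the complex line touching the hypersurface
    \<open>pdist = \<beta>\<close> at \<open>(0, b0)\<close>. By \<open>Dr_subset_egg\<close> it
    stays outside \<open>Dr \<beta>\<close>, with a gap of order |x|^2.\<close>
  define m where "m x = b0 + of_real (1 - \<beta>^2) * x" for x
  have sep: "\<beta> * (1 - \<beta>^2) * (cmod x)^2 / 2 \<le> cmod (y - m x)" "y - m x \<noteq> 0"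
    if xy: "cmod x < 1" "cmod y < 1" "pdist x y < \<beta>" for x y
  proof -
    have "cmod (y - of_real (1 - \<beta>^2) * x) \<le> \<beta> * (1 - (1 - \<beta>^2) * (cmod x)^2 / (1 + \<beta> * cmod x))"
      using xy \<beta> by (intro Dr_subset_egg) auto
    moreover have "(1 - \<beta>^2) * (cmod x)^2 / 2 \<le> (1 - \<beta>^2) * (cmod x)^2 / (1 + \<beta> * cmod x)"
    proof (intro divide_left_mono mult_pos_pos mult_nonneg_nonneg)
      have "\<beta> * cmod x \<le> 1 * 1" using \<beta> xy by (intro mult_mono) auto
      thus "1 + \<beta> * cmod x \<le> 2" by simp
    qed (use \<beta> in \<open>auto intro: add_pos_nonneg\<close>)
    hence "\<beta> * (1 - (1 - \<beta>^2) * (cmod x)^2 / (1 + \<beta> * cmod x)) \<le> \<beta> * (1 - (1 - \<beta>^2) * (cmod x)^2 / 2)"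
      using \<beta> by (intro mult_left_mono) auto
    moreover have "\<beta> - cmod (y - of_real (1 - \<beta>^2) * x) \<le> cmod (y - m x)"
      using norm_triangle_ineq2[of b0 "y - of_real (1 - \<beta>^2) * x"] \<beta>
      by (simp add: m_def norm_minus_commute algebra_simps)
    ultimately have "\<beta> - \<beta> * (1 - (1 - \<beta>^2) * (cmod x)^2 / 2) \<le> cmod (y - m x)" by linarith
    thus le: "\<beta> * (1 - \<beta>^2) * (cmod x)^2 / 2 \<le> cmod (y - m x)" by (simp add: right_diff_distrib mult_ac)
    show "y - m x \<noteq> 0"
    proof (cases "x = 0")
      case True
      thus ?thesis using xy \<beta> by (auto simp: m_def pdist_def)
    next
      case False
      hence "0 < \<beta> * (1 - \<beta>^2) * (cmod x)^2 / 2" using \<beta> by simp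
      thus ?thesis using le by auto
    qed
  qed
  define t' where "t' = min t \<beta>"
  have t': "\<tau> < t'" "t' \<le> t" using \<tau> \<beta> by (auto simp: t'_def)
  \<comment> \<open>The factor \<open>1 - cnj a * u\<close> clears the denominator of the Moebius
    map in the second variable; over \<open>z = a\<close> this leaves a constant times
    \<open>u - b\<close>, since \<open>m 0 = b0\<close>.\<close>
  define den where "den p = (1 - cnj a * snd p) * (?\<psi> (snd p) - m (?\<psi> (fst p)))" for p
  define g where "g p = f p / den p" for p
  have den_nz: "den p \<noteq> 0" if "p \<in> Dst s t'" for p
  proof -
    obtain z u where p0: "p = (z, u)" by fastforce
    have p: "p = (z, u)" "cmod z < 1" "cmod u < 1" "pdist z u < \<beta>"
      using that by (auto simp: p0 Dst_iff t'_def)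
    have "pdist (?\<psi> z) (?\<psi> u) < \<beta>" using pdist_aut_disc[OF \<psi>(1)] p by simp
    thus ?thesis using sep(2)[of "?\<psi> z" "?\<psi> u"] \<psi>(2) p pdist_denom_nonzero[of a u] a by (simp add: den_def)
  qed
  have sub: "fst ` Dst s t' \<subseteq> unit_disc" "snd ` Dst s t' \<subseteq> unit_disc" by (auto simp: Dst_iff)
  have "hol2 den (Dst s t')" unfolding den_def[abs_def]
  proof (rule hol2_mult[OF hol2_diff hol2_diff])
    show "hol2 (\<lambda>_. 1) (Dst s t')" by (rule hol2_of_fst[of "\<lambda>_. 1" UNIV]) (auto intro!: holomorphic_intros)
    show "hol2 (\<lambda>p. cnj a * snd p) (Dst s t')" by (intro hol2_cmult hol2_snd)
    show "hol2 (\<lambda>p. ?\<psi> (snd p)) (Dst s t')" by (rule hol2_of_snd[OF \<psi>(3) _ sub(2)]) simp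
    show "hol2 (\<lambda>p. m (?\<psi> (fst p))) (Dst s t')"
      by (rule hol2_comp1[of m UNIV]) (use hol2_of_fst[OF \<psi>(3) _ sub(1)] in \<open>auto simp: m_def[abs_def] intro!: holomorphic_intros\<close>)
  qed
  hence g: "hol2 g (Dst s t')" unfolding g_def[abs_def]
    using den_nz hol2_subset[OF f(1) Dst_mono[OF order_refl t'(2)]] by (intro hol2_divide)
  define A where "A z = contour_integral (pcircle \<tau> z) (\<lambda>u. g (z, u))" for z
  have circ: "(z, u) \<in> Dst s t'" if "cmod z < 1" "u \<in> path_image (pcircle \<tau> z)" for z u
    using that path_image_pcircle[OF \<tau>(1,2) that(1)] \<tau> t' by (auto simp: Dst_iff)
  have gint: "(\<lambda>u. g (z, u)) contour_integrable_on pcircle \<tau> z" if z: "cmod z < 1" for z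
    unfolding pcircle_def
    by (rule contour_integrable_continuous_circlepath, fold pcircle_def,
        rule continuous_on_compose2[OF hol2_continuous_on[OF g]])
       (use circ z in \<open>auto intro!: continuous_intros\<close>)
  have hA: "A holomorphic_on ball 0 1" unfolding A_def[abs_def] unit_disc_def[symmetric]
    by (rule pcircle_integral_holomorphic[OF \<tau>(1-3) t'(1)])
       (use hol2_subset[OF g] in auto)
  have A0: "A a = 0"
  proof (rule holomorphic_zero_of_boundary_limit[OF hA _ a])
    fix e :: real assume e: "e > 0"
    obtain R where R: "R < 1" "\<And>z. R < cmod z \<Longrightarrow> cmod z < 1 \<Longrightarrow> 1 / 2 \<le> pdist a z"
      using pdist_tends_to_1[OF a] by blast
    \<comment> \<open>Lower bound of \<open>cmod (den (z, u))\<close> for \<open>z\<close> near the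
      unit circle: \<open>1 - cmod a\<close> from the first factor, and \<open>sep\<close> with
      \<open>1 / 2 \<le> cmod x\<close> from the second.\<close>
    define k where "k = (1 - cmod a) * (\<beta> * (1 - \<beta>^2) / 8)"
    have k: "k > 0" using a \<beta> by (simp add: k_def)
    have \<tau>2: "0 < 1 - \<tau>^2" using \<tau> by (simp add: power_less_one_iff)
    define M where "M = 4 * pi / (k * (1 - \<tau>^2))"
    have M: "M > 0" using k \<tau>2 by (simp add: M_def)
    have le: "cmod (A z) \<le> M * (1 - cmod z)" if z: "R < cmod z" "cmod z < 1" for z
    proof -
      have bd: "cmod (g (z, u)) \<le> 1 / k" if u: "u \<in> path_image (pcircle \<tau> z)" for u
      proof -
        have u1: "cmod u < 1" "pdist z u = \<tau>" using u path_image_pcircle[OF \<tau>(1,2) z(2)] by auto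
        have "pdist (?\<psi> z) (?\<psi> u) < \<beta>" using pdist_aut_disc[OF \<psi>(1)] z u1 \<beta> by simp
        hence 1: "\<beta> * (1 - \<beta>^2) * (cmod (?\<psi> z))^2 / 2 \<le> cmod (?\<psi> u - m (?\<psi> z))"
          using \<psi>(2) z u1 by (intro sep)
        have "(1 / 2)^2 \<le> (cmod (?\<psi> z))^2" unfolding norm_Moebius_function using R(2)[OF z] by (intro power_mono) auto
        hence "\<beta> * (1 - \<beta>^2) * (1 / 4) \<le> \<beta> * (1 - \<beta>^2) * (cmod (?\<psi> z))^2"
          using \<beta> by (intro mult_left_mono) (auto simp: power2_eq_square)
        hence 2: "\<beta> * (1 - \<beta>^2) / 8 \<le> cmod (?\<psi> u - m (?\<psi> z))" using 1 by argo
        have 3: "1 - cmod a \<le> cmod (1 - cnj a * u)"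
        proof -
          have "cmod (cnj a * u) \<le> cmod a * 1" unfolding norm_mult complex_mod_cnj
            using u1 by (intro mult_left_mono) auto
          thus ?thesis using norm_triangle_ineq2[of 1 "cnj a * u"] by simp
        qed
        have "k \<le> cmod (den (z, u))" unfolding k_def den_def norm_mult fst_conv snd_conv
          using 2 3 a \<beta> by (intro mult_mono) auto
        moreover have "cmod (f (z, u)) \<le> 1" using f(2) circ[OF z(2) u] Dst_mono[of s s t' t] t' by auto
        ultimately show ?thesis unfolding g_def norm_divide using k by (intro frac_le) auto
      qed
      have "cmod (A z) \<le> 1 / k * (2 * pi * disc_radius \<tau> z)"
      proof (rule has_contour_integral_bound_circlepath)
        show "((\<lambda>u. g (z, u)) has_contour_integral A z) (circlepath (disc_center \<tau> z) (disc_radius \<tau> z))"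
          unfolding A_def pcircle_def[symmetric] by (rule has_contour_integral_integral[OF gint[OF z(2)]])
        show "0 < disc_radius \<tau> z" using disc_radius_pos \<tau> z by simp
        show "cmod (g (z, x)) \<le> 1 / k" if "cmod (x - disc_center \<tau> z) = disc_radius \<tau> z" for x
          using that disc_radius_pos[OF \<tau>(1,2) z(2)] by (intro bd) (auto simp: pcircle_def dist_norm norm_minus_commute)
      qed (use k in auto)
      also have "disc_radius \<tau> z \<le> 2 * (1 - cmod z) / (1 - \<tau>^2)"
      proof -
        have "\<tau> * (1 - (cmod z)^2) \<le> 1 * (2 * (1 - cmod z))"
        proof (intro mult_mono)
          show "1 - (cmod z)^2 \<le> 2 * (1 - cmod z)" by (rule one_minus_square_le)
        qed (use \<tau> z in \<open>auto simp: power_le_one\<close>)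
        moreover have "1 - \<tau>^2 \<le> 1 - \<tau>^2 * (cmod z)^2" using z by (simp add: mult_left_le power_le_one)
        ultimately show ?thesis unfolding disc_radius_def using \<tau>2 z by (intro frac_le) auto
      qed
      hence "1 / k * (2 * pi * disc_radius \<tau> z) \<le> 1 / k * (2 * pi * (2 * (1 - cmod z) / (1 - \<tau>^2)))"
        using k by (intro mult_left_mono) auto
      also have "\<dots> = M * (1 - cmod z)" by (simp add: M_def)
      finally show ?thesis .
    qed
    have "cmod (A z) \<le> e" if z: "max R (1 - e / M) < cmod z" "cmod z < 1" for z
    proof -
      have "M * (1 - cmod z) \<le> M * (e / M)" using z M by (intro mult_left_mono) auto
      thus ?thesis using le[of z] z M by simp
    qed
    moreover have "max R (1 - e / M) < 1" using R e M by simp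
    ultimately show "\<exists>R<1. \<forall>z. R < cmod z \<and> cmod z < 1 \<longrightarrow> cmod (A z) \<le> e" by blast
  qed
  define K where "K = of_real (1 - (cmod a)^2) / (1 - cnj a * b)"
  have "f (a, u) / (u - b) = K * g (a, u)" if u: "u \<in> path_image (pcircle \<tau> a)" for u
  proof -
    have u1: "cmod u < 1" "pdist a u = \<tau>" using u path_image_pcircle[OF \<tau>(1,2) a] by auto
    have nz: "1 - cnj a * u \<noteq> 0" "1 - cnj a * b \<noteq> 0" using pdist_denom_nonzero a b u1 by auto
    have ub: "u \<noteq> b" using u1 b by auto
    have "m (?\<psi> a) = b0" by (simp add: m_def Moebius_function_eq_zero)
    hence "den (a, u) = (1 - cnj a * u) * ((u - a) / (1 - cnj a * u) - (b - a) / (1 - cnj a * b))"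
      by (simp add: den_def b0_def Moebius_function_simple)
    also have "\<dots> = (u - a) - (b - a) * (1 - cnj a * u) / (1 - cnj a * b)"
    proof -
      have "X * (A / X - B / Y) = A - B * X / Y" if "X \<noteq> 0" for X A B Y :: complex
        using that by (simp add: right_diff_distrib mult.commute)
      thus ?thesis using nz(1) by blast
    qed
    also have "\<dots> = ((u - a) * (1 - cnj a * b) - (b - a) * (1 - cnj a * u)) / (1 - cnj a * b)"
    proof -
      have "A - C / Y = (A * Y - C) / Y" if "Y \<noteq> 0" for A C Y :: complex
        using that by (simp add: diff_divide_distrib)
      thus ?thesis using nz(2) by blast
    qed
    also have "(u - a) * (1 - cnj a * b) - (b - a) * (1 - cnj a * u) = (u - b) * of_real (1 - (cmod a)^2)"
      unfolding of_real_diff of_real_1 complex_norm_square by (simp add: algebra_simps)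
    finally have d: "den (a, u) = (u - b) * K" by (simp add: K_def)
    have "den (a, u) \<noteq> 0" using den_nz circ[OF a u] by simp
    hence "K \<noteq> 0" using d by auto
    thus ?thesis unfolding g_def d by simp
  qed
  hence "contour_integral (pcircle \<tau> a) (\<lambda>u. f (a, u) / (u - b)) = contour_integral (pcircle \<tau> a) (\<lambda>u. K * g (a, u))"
    by (intro contour_integral_cong) auto
  also have "\<dots> = K * A a" unfolding A_def by (rule contour_integral_lmul[OF gint[OF a]])
  finally show ?thesis using A0 by simp
qed

lemma pcircle_homotopic:
  assumes \<tau>: "0 < \<tau>" "\<tau> < 1" "s < \<tau>" "\<tau> < t" and \<tau>': "0 < \<tau>'" "\<tau>' < 1" "s < \<tau>'" "\<tau>' < t" and z: "cmod z < 1"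
  shows "homotopic_loops {u. (z, u) \<in> Dst s t} (pcircle \<tau>' z) (pcircle \<tau> z)"
  unfolding homotopic_loops
proof (intro exI conjI ballI)
  define T where "T l = \<tau>' + l * (\<tau> - \<tau>')" for l :: real
  let ?h = "\<lambda>p :: real \<times> real. pcircle (T (fst p)) z (snd p)"
  have T: "0 < T l" "T l < 1" "s < T l" "T l < t" if "l \<in> {0..1}" for l
  proof -
    have 1: "T l = (1 - l) * \<tau>' + l * \<tau>" by (simp add: T_def algebra_simps)
    have "(1 - l) * x + l * x = x" for x :: real by (simp add: algebra_simps)
    have up: "T l < x" if "\<tau> < x" "\<tau>' < x" for x
      using convex_bound_lt[OF that(2,1), of "1 - l" l] \<open>l \<in> {0..1}\<close> unfolding 1 by simp
    have lo: "x < T l" if "x < \<tau>" "x < \<tau>'" for x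
      using convex_bound_lt[of "- \<tau>'" "- x" "- \<tau>" "1 - l" l] that \<open>l \<in> {0..1}\<close> unfolding 1 by (simp add: algebra_simps)
    show "0 < T l" "T l < 1" "s < T l" "T l < t" using up lo \<tau> \<tau>' by auto
  qed
  show "continuous_on ({0..1} \<times> {0..1}) ?h"
  proof -
    have nz: "1 - (T (fst p))^2 * (cmod z)^2 \<noteq> 0" if "p \<in> {0..1} \<times> {0..1}" for p :: "real \<times> real"
      using disc_denom_pos[of "T (fst p)" z] T[of "fst p"] that z by auto
    have cT: "continuous_on ({0..1} \<times> {0..1}) (\<lambda>p :: real \<times> real. T (fst p))"
      unfolding T_def by (intro continuous_intros)
    have c1: "continuous_on ({0..1} \<times> {0..1}) (\<lambda>p :: real \<times> real. (1 - (T (fst p))^2) / (1 - (T (fst p))^2 * (cmod z)^2))"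
      using nz by (intro continuous_on_divide continuous_intros cT) auto
    have c2: "continuous_on ({0..1} \<times> {0..1}) (\<lambda>p :: real \<times> real. T (fst p) * (1 - (cmod z)^2) / (1 - (T (fst p))^2 * (cmod z)^2))"
      using nz by (intro continuous_on_divide continuous_intros cT) auto
    show ?thesis unfolding pcircle_def circlepath disc_center_def disc_radius_def
      by (intro continuous_on_add continuous_on_mult continuous_on_of_real c1 c2 continuous_on_const continuous_on_exp continuous_on_snd continuous_on_id)
  qed
  show "?h \<in> ({0..1} \<times> {0..1}) \<rightarrow> {u. (z, u) \<in> Dst s t}"
  proof (rule Pi_I)
    fix p :: "real \<times> real" assume p: "p \<in> {0..1} \<times> {0..1}"
    hence l: "fst p \<in> {0..1}" "snd p \<in> {0..1}" by auto
    have "?h p \<in> path_image (pcircle (T (fst p)) z)" unfolding path_image_def using l(2) by (rule imageI)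
    thus "?h p \<in> {u. (z, u) \<in> Dst s t}"
      using path_image_pcircle[OF T(1,2)[OF l(1)] z] T(3,4)[OF l(1)] z by (auto simp: Dst_iff)
  qed
  show "?h (0, x) = pcircle \<tau>' z x" "?h (1, x) = pcircle \<tau> z x" for x by (simp_all add: T_def)
  show "pathfinish (?h \<circ> Pair l) = pathstart (?h \<circ> Pair l)" for l
    by (simp add: o_def pathstart_def pathfinish_def pcircle_def circlepath)
qed

text \<open>In an annulus Cauchy's formula has a second term, over an inner circle of radius
  \<open>\<tau>'\<close> between \<open>s\<close> and \<open>pdist z w\<close>; it vanishes by
  \<open>outer_Cauchy_integral_vanishes\<close>. The difference quotient \<open>q\<close> is
  holomorphic across \<open>w\<close>, so its integrals over the two circles agree.\<close>

lemma Cauchy_integral_pcircle: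
  fixes s t \<tau> :: real
  assumes s: "0 \<le> s" and \<tau>: "0 < \<tau>" "\<tau> < 1" "s < \<tau>" "\<tau> < t"
    and f: "hol2 f (Dst s t)" "\<And>p. p \<in> Dst s t \<Longrightarrow> cmod (f p) \<le> 1"
    and z: "cmod z < 1" and w: "cmod w < 1" "s < pdist z w" "pdist z w < \<tau>"
  shows "contour_integral (pcircle \<tau> z) (\<lambda>u. f (z, u) / (u - w)) = 2 * of_real pi * \<i> * f (z, w)"
proof -
  define \<tau>' where "\<tau>' = (s + pdist z w) / 2"
  have \<tau>': "0 < \<tau>'" "\<tau>' < 1" "s < \<tau>'" "\<tau>' < t" "\<tau>' < pdist z w" using s \<tau> w by (simp_all add: \<tau>'_def)
  define h where "h u = f (z, u)" for u
  let ?A = "{u. (z, u) \<in> Dst s t}"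
  have hA: "h holomorphic_on ?A" unfolding h_def
    by (rule hol2_disc[OF f(1)]) (use open_fibre in \<open>auto intro!: holomorphic_intros\<close>)
  define q where "q u = (if u = w then deriv h w else (h u - h w) / (u - w))" for u
  have qA: "q holomorphic_on ?A" unfolding q_def[abs_def] by (rule pole_lemma_open[OF hA open_fibre])
  have circ: "u \<in> ?A" "u \<noteq> w" if "u \<in> path_image (pcircle x z)" "0 < x" "x < 1" "s < x" "x < t" "x \<noteq> pdist z w" for u x
    using that path_image_pcircle[OF that(2,3) z] z by (auto simp: Dst_iff)
  have int: "(\<lambda>u. h u / (u - w)) contour_integrable_on pcircle x z" "(\<lambda>u. h w / (u - w)) contour_integrable_on pcircle x z"
    if x: "0 < x" "x < 1" "s < x" "x < t" "x \<noteq> pdist z w" for x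
  proof -
    have c: "continuous_on (path_image (pcircle x z)) h"
      by (rule continuous_on_subset[OF holomorphic_on_imp_continuous_on[OF hA]]) (use circ x in blast)
    show "(\<lambda>u. h u / (u - w)) contour_integrable_on pcircle x z"
      unfolding pcircle_def by (rule contour_integrable_continuous_circlepath, fold pcircle_def)
        (intro continuous_intros c, use circ x in auto)
    show "(\<lambda>u. h w / (u - w)) contour_integrable_on pcircle x z"
      unfolding pcircle_def by (rule contour_integrable_continuous_circlepath, fold pcircle_def)
        (intro continuous_intros, use circ x in auto)
  qed
  have split: "contour_integral (pcircle x z) q = contour_integral (pcircle x z) (\<lambda>u. h u / (u - w)) - contour_integral (pcircle x z) (\<lambda>u. h w / (u - w))"
    if x: "0 < x" "x < 1" "s < x" "x < t" "x \<noteq> pdist z w" for x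
  proof -
    have "contour_integral (pcircle x z) q = contour_integral (pcircle x z) (\<lambda>u. h u / (u - w) - h w / (u - w))"
      by (rule contour_integral_cong) (use circ x in \<open>auto simp: q_def diff_divide_distrib\<close>)
    also have "\<dots> = contour_integral (pcircle x z) (\<lambda>u. h u / (u - w)) - contour_integral (pcircle x z) (\<lambda>u. h w / (u - w))"
      by (rule contour_integral_diff[OF int[OF x]])
    finally show ?thesis .
  qed
  have "contour_integral (pcircle \<tau>' z) q = contour_integral (pcircle \<tau> z) q"
    by (rule Cauchy_theorem_homotopic_loops[OF pcircle_homotopic[OF \<tau> \<tau>'(1-4) z] open_fibre qA]) auto
  moreover have "contour_integral (pcircle \<tau>' z) (\<lambda>u. h u / (u - w)) = 0"
    unfolding h_def by (rule outer_Cauchy_integral_vanishes[OF \<tau>'(1-4) f z w(1) \<tau>'(5)])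
  moreover have "contour_integral (pcircle \<tau>' z) (\<lambda>u. h w / (u - w)) = 0"
  proof (rule contour_integral_unique, rule Cauchy_theorem_convex_simple)
    have gt: "disc_radius \<tau>' z < cmod (w - disc_center \<tau>' z)"
      using pdist_less_iff_disc[OF \<tau>'(1,2) z w(1)] pdist_eq_iff_disc[OF \<tau>'(1,2) z w(1)] \<tau>'(5) by linarith
    show "(\<lambda>u. h w / (u - w)) holomorphic_on ball (disc_center \<tau>' z) (cmod (w - disc_center \<tau>' z))"
      by (intro holomorphic_intros) (auto simp: dist_norm norm_minus_commute)
    show "path_image (pcircle \<tau>' z) \<subseteq> ball (disc_center \<tau>' z) (cmod (w - disc_center \<tau>' z))"
      using gt disc_radius_nonneg[of \<tau>' z] \<tau>' z by (auto simp: pcircle_def)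
  qed (auto simp: pcircle_def)
  moreover have "contour_integral (pcircle \<tau> z) (\<lambda>u. h w / (u - w)) = 2 * of_real pi * \<i> * h w"
    unfolding pcircle_def
    by (rule contour_integral_unique, rule Cauchy_integral_circlepath_simple)
       (use pdist_less_iff_disc[OF \<tau>(1,2) z w(1)] w in \<open>auto intro!: holomorphic_intros\<close>)
  ultimately show ?thesis using split[OF \<tau>] split[OF \<tau>'(1-4)] w \<tau>' by (simp add: h_def)
qed

subsection \<open>Extension across the inner boundary\<close>

lemma closed_pdisc_subset:
  assumes "0 < \<sigma>" "\<sigma> < 1" "cmod z < 1" "w \<in> cball (disc_center \<sigma> z) (disc_radius \<sigma> z)"
  shows "cmod w < 1" "pdist z w \<le> \<sigma>"
proof -
  have le: "cmod (w - disc_center \<sigma> z) \<le> disc_radius \<sigma> z"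
    using assms by (simp add: dist_norm norm_minus_commute)
  show w: "cmod w < 1" using mem_disc_imp_cmod_less_1[OF _ assms(2,3) le] assms(1) by simp
  show "pdist z w \<le> \<sigma>"
    using pdist_less_iff_disc[OF assms(1-3) w] pdist_eq_iff_disc[OF assms(1-3) w] le by linarith
qed

lemma mem_pdisc_iff:
  assumes "0 < \<sigma>" "\<sigma> < 1" "cmod z < 1"
  shows "w \<in> ball (disc_center \<sigma> z) (disc_radius \<sigma> z) \<longleftrightarrow> (z, w) \<in> Dr \<sigma>"
  using mem_Dr_iff_disc[OF assms(1,2), of z w] assms(3) by (simp add: dist_norm norm_minus_commute)

lemma open_slice_Dr: "open {z. (z, w) \<in> Dr r}" "open {w. (z, w) \<in> Dr r}"
proof -
  have "open ((\<lambda>z. (z, w)) -` Dr r)" by (intro open_vimage open_Dr continuous_intros)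
  thus "open {z. (z, w) \<in> Dr r}" by (simp add: vimage_def)
  have "open (Pair z -` Dr r)" by (intro open_vimage open_Dr continuous_intros)
  thus "open {w. (z, w) \<in> Dr r}" by (simp add: vimage_def)
qed

lemma Cauchy_transform_holomorphic_fst:
  fixes s t \<tau> :: real
  assumes \<tau>: "0 < \<tau>" "\<tau> < 1" "s < \<tau>" "\<tau> < t" and f: "hol2 f (Dst s t)"
  shows "(\<lambda>z. contour_integral (pcircle \<tau> z) (\<lambda>u. f (z, u) / (u - w))) holomorphic_on {z. (z, w) \<in> Dr \<tau>}"
  unfolding holomorphic_on_def
proof
  fix z0 assume "z0 \<in> {z. (z, w) \<in> Dr \<tau>}"
  hence z0: "cmod z0 < 1" "cmod w < 1" "pdist z0 w < \<tau>" by (auto simp: Dr_iff)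
  \<comment> \<open>\<open>\<sigma>\<close> keeps \<open>w\<close> away from the contour for all
    \<open>z\<close> near \<open>z0\<close>: over \<open>Z\<close> the point \<open>w\<close> is
    within \<open>pdist\<close> \<open>\<sigma>\<close>, while the integrand is considered beyond
    \<open>\<sigma>\<close>. The maximum with \<open>s\<close> keeps \<open>Dst \<sigma> t\<close>
    inside \<open>Dst s t\<close>.\<close>
  define M where "M = max s (pdist z0 w)"
  have M: "s \<le> M" "pdist z0 w \<le> M" "M < \<tau>" using \<tau> z0 by (simp_all add: M_def)
  define \<sigma> where "\<sigma> = (M + \<tau>) / 2"
  have \<sigma>: "s < \<sigma>" "pdist z0 w < \<sigma>" "\<sigma> < \<tau>" using M by (simp_all add: \<sigma>_def)
  define Z where "Z = {z. (z, w) \<in> Dr \<sigma>}"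
  have Z: "open Z" "Z \<subseteq> unit_disc" using open_slice_Dr(1) by (auto simp: Z_def Dr_iff)
  have "hol2 (\<lambda>p. f p / (snd p - w)) {p \<in> Dst \<sigma> t. fst p \<in> Z}"
  proof (rule hol2_divide)
    show "hol2 f {p \<in> Dst \<sigma> t. fst p \<in> Z}"
      by (rule hol2_subset[OF f]) (use Dst_mono[of s \<sigma> t t] \<sigma> in auto)
    have "hol2 (\<lambda>p. w) {p \<in> Dst \<sigma> t. fst p \<in> Z}" by (rule hol2_of_fst[of "\<lambda>_. w" UNIV]) (auto intro!: holomorphic_intros)
    thus "hol2 (\<lambda>p. snd p - w) {p \<in> Dst \<sigma> t. fst p \<in> Z}" by (intro hol2_diff hol2_snd)
    show "snd p - w \<noteq> 0" if "p \<in> {p \<in> Dst \<sigma> t. fst p \<in> Z}" for p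
      using that by (cases p) (auto simp: Z_def Dr_iff Dst_iff)
  qed
  from pcircle_integral_holomorphic[OF \<tau>(1,2) \<sigma>(3) \<tau>(4) Z this]
  have "(\<lambda>z. contour_integral (pcircle \<tau> z) (\<lambda>u. f (z, u) / (u - w))) holomorphic_on Z" by simp
  moreover have "z0 \<in> Z" using z0 \<sigma> by (simp add: Z_def Dr_iff)
  ultimately have "(\<lambda>z. contour_integral (pcircle \<tau> z) (\<lambda>u. f (z, u) / (u - w))) field_differentiable at z0"
    using Z(1) holomorphic_on_imp_differentiable_at by blast
  thus "(\<lambda>z. contour_integral (pcircle \<tau> z) (\<lambda>u. f (z, u) / (u - w))) field_differentiable at z0 within {z. (z, w) \<in> Dr \<tau>}"
    by (rule field_differentiable_at_within)
qed

lemma Cauchy_transform_holomorphic_snd: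
  fixes s t \<tau> :: real
  assumes \<tau>: "0 < \<tau>" "\<tau> < 1" "s < \<tau>" "\<tau> < t" and f: "hol2 f (Dst s t)" and z: "cmod z < 1"
  shows "(\<lambda>w. contour_integral (pcircle \<tau> z) (\<lambda>u. f (z, u) / (u - w))) holomorphic_on {w. (z, w) \<in> Dr \<tau>}"
proof -
  let ?c = "disc_center \<tau> z" and ?R = "disc_radius \<tau> z"
  have R: "0 < ?R" using disc_radius_pos \<tau> z by simp
  have sph: "sphere ?c ?R = path_image (pcircle \<tau> z)" using R by (simp add: pcircle_def)
  have "(\<lambda>w. contour_integral (circlepath ?c ?R) (\<lambda>u. f (z, u) / (u - w))) holomorphic_on ball ?c ?R"
  proof (rule holomorphic_param_circlepath[OF open_ball R])
    have "continuous_on (ball ?c ?R \<times> sphere ?c ?R) (\<lambda>p. f (z, snd p))"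
      by (rule continuous_on_compose2[OF hol2_continuous_on[OF f]])
         (use sph path_image_pcircle[OF \<tau>(1,2) z] z \<tau> in \<open>auto intro!: continuous_intros simp: Dst_iff\<close>)
    moreover have "snd p - fst p \<noteq> 0" if "p \<in> ball ?c ?R \<times> sphere ?c ?R" for p
      using that by (cases p) auto
    ultimately have "continuous_on (ball ?c ?R \<times> sphere ?c ?R) (\<lambda>p. f (z, snd p) / (snd p - fst p))"
      by (intro continuous_intros) auto
    thus "continuous_on (ball ?c ?R \<times> sphere ?c ?R) (\<lambda>(w, u). f (z, u) / (u - w))"
      by (simp add: case_prod_unfold)
    show "(\<lambda>w. f (z, u) / (u - w)) holomorphic_on ball ?c ?R" if "u \<in> sphere ?c ?R" for u
      using that by (intro holomorphic_intros) auto
  qed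
  moreover have "ball ?c ?R = {w. (z, w) \<in> Dr \<tau>}" using mem_pdisc_iff[OF \<tau>(1,2) z] by blast
  ultimately show ?thesis by (simp add: pcircle_def)
qed

text \<open>The Cauchy integral over the circle of radius \<open>(s + t) / 2\<close> continues
  \<open>f\<close> into the hole. It is holomorphic in each variable separately; the maximum
  principle in the fibres bounds it, and with this bound \<open>Osgood\<close> gives joint
  holomorphy.\<close>

lemma bounded_extension:
  fixes s t :: real
  assumes st: "0 \<le> s" "s < t" "t \<le> 1"
    and f: "hol2 f (Dst s t)" "\<And>p. p \<in> Dst s t \<Longrightarrow> cmod (f p) < 1"
  obtains g where "hol2 g (Dr t)" "\<And>p. p \<in> Dst s t \<Longrightarrow> g p = f p" "\<And>p. p \<in> Dr t \<Longrightarrow> cmod (g p) < 1"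
proof -
  define \<tau> where "\<tau> = (s + t) / 2"
  have \<tau>: "0 < \<tau>" "\<tau> < 1" "s < \<tau>" "\<tau> < t" using st by (simp_all add: \<tau>_def)
  define I where "I p = contour_integral (pcircle \<tau> (fst p)) (\<lambda>u. f (fst p, u) / (u - snd p)) / (2 * of_real pi * \<i>)" for p
  have f1: "cmod (f p) \<le> 1" if "p \<in> Dst s t" for p using f(2)[OF that] by simp
  have If: "I p = f p" if "p \<in> Dst s t" "p \<in> Dr \<tau>" for p
    using Cauchy_integral_pcircle[OF st(1) \<tau> f(1) f1, of "fst p" "snd p"] that
    by (cases p) (auto simp: I_def Dst_iff Dr_iff)
  have hw: "(\<lambda>w. I (z, w)) holomorphic_on {w. (z, w) \<in> Dr \<tau>}" if "cmod z < 1" for z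
    unfolding I_def using Cauchy_transform_holomorphic_snd[OF \<tau> f(1) that] by (auto intro!: holomorphic_intros)
  have hz: "(\<lambda>z. I (z, w)) holomorphic_on {z. (z, w) \<in> Dr \<tau>}" for w
    unfolding I_def using Cauchy_transform_holomorphic_fst[OF \<tau> f(1)] by (auto intro!: holomorphic_intros)
  have bound: "cmod (I (z, w)) < 1" if zw: "(z, w) \<in> Dr \<tau>" for z w
  proof (cases "s < pdist z w")
    case True
    hence "(z, w) \<in> Dst s t" using zw \<tau> by (simp add: Dst_iff Dr_iff)
    thus ?thesis using If f zw by simp
  next
    case False
    have z: "cmod z < 1" "cmod w < 1" using zw by (auto simp: Dr_iff)
    define \<sigma> where "\<sigma> = (s + \<tau>) / 2"
    have \<sigma>: "0 < \<sigma>" "\<sigma> < 1" "s < \<sigma>" "\<sigma> < \<tau>" using st \<tau> by (simp_all add: \<sigma>_def)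
    let ?B = "cball (disc_center \<sigma> z) (disc_radius \<sigma> z)"
    have B: "?B \<subseteq> {w. (z, w) \<in> Dr \<tau>}"
      using closed_pdisc_subset[OF \<sigma>(1,2) z(1)] z \<sigma> by (fastforce simp: Dr_iff)
    have R: "0 < disc_radius \<sigma> z" using disc_radius_pos \<sigma> z by simp
    have sph: "sphere (disc_center \<sigma> z) (disc_radius \<sigma> z) = path_image (pcircle \<sigma> z)"
      using R by (simp add: pcircle_def)
    have sD: "(z, v) \<in> Dst s t" "(z, v) \<in> Dr \<tau>" if "v \<in> path_image (pcircle \<sigma> z)" for v
      using that path_image_pcircle[OF \<sigma>(1,2) z(1)] z \<sigma> \<tau> by (auto simp: Dst_iff Dr_iff)
    have cp: "compact (path_image (pcircle \<sigma> z))" by (simp add: pcircle_def)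
    have "continuous_on (path_image (pcircle \<sigma> z)) (\<lambda>v. cmod (I (z, v)))"
      by (intro continuous_intros continuous_on_subset[OF holomorphic_on_imp_continuous_on[OF hw[OF z(1)]]])
         (use sD in blast)
    \<comment> \<open>The supremum on the circle is attained, which keeps the final bound
      strict.\<close>
    from continuous_attains_sup[OF cp path_image_nonempty this]
    obtain v where v: "v \<in> path_image (pcircle \<sigma> z)"
      "\<And>v'. v' \<in> path_image (pcircle \<sigma> z) \<Longrightarrow> cmod (I (z, v')) \<le> cmod (I (z, v))"
      by blast
    have "cmod (I (z, w)) \<le> cmod (I (z, v))"
    proof (rule maximum_modulus_frontier[of "\<lambda>w. I (z, w)" ?B])
      show "(\<lambda>w. I (z, w)) holomorphic_on interior ?B"
        by (rule holomorphic_on_subset[OF hw[OF z(1)]]) (use B interior_subset in blast)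
      show "continuous_on (closure ?B) (\<lambda>w. I (z, w))"
        using continuous_on_subset[OF holomorphic_on_imp_continuous_on[OF hw[OF z(1)]] B] by simp
      show "cmod (I (z, x)) \<le> cmod (I (z, v))" if "x \<in> frontier ?B" for x
        using that sph R v(2) by (simp add: frontier_cball)
      have "pdist z w < \<sigma>" using False \<sigma> by simp
      thus "w \<in> ?B" using mem_pdisc_iff[OF \<sigma>(1,2) z(1), of w] z by (simp add: Dr_iff)
    qed auto
    also have "\<dots> < 1" using If[OF sD[OF v(1)]] f(2)[OF sD(1)[OF v(1)]] by simp
    finally show ?thesis .
  qed
  have hI: "hol2 I (Dr \<tau>)"
    unfolding hol2_def
  proof
    fix p assume p: "p \<in> Dr \<tau>"
    obtain z0 w0 where p0: "p = (z0, w0)" by fastforce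
    obtain A B where AB: "open A" "open B" "p \<in> A \<times> B" "A \<times> B \<subseteq> Dr \<tau>"
      using open_prod_elim[OF open_Dr p] by metis
    obtain d1 where d1: "d1 > 0" "ball z0 d1 \<subseteq> A" using AB p0 by (auto elim: openE)
    obtain d2 where d2: "d2 > 0" "ball w0 d2 \<subseteq> B" using AB p0 by (auto elim: openE)
    define d where "d = min d1 d2"
    have d: "d > 0" using d1 d2 by (simp add: d_def)
    have dD: "(z, w) \<in> Dr \<tau>" if "z \<in> ball z0 d" "w \<in> ball w0 d" for z w
    proof -
      have "z \<in> ball z0 d1" "w \<in> ball w0 d2" using that by (auto simp: d_def)
      thus ?thesis using d1(2) d2(2) AB(4) by blast
    qed
    show "\<exists>a b. (I has_derivative (\<lambda>w. a * fst w + b * snd w)) (at p)"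
      unfolding p0
    proof (rule Osgood[OF d, where M = 1])
      show "(\<lambda>z. I (z, w)) holomorphic_on ball z0 d" if "w \<in> ball w0 d" for w
        by (rule holomorphic_on_subset[OF hz]) (use dD that in auto)
      show "(\<lambda>w. I (z, w)) holomorphic_on ball w0 d" if "z \<in> ball z0 d" for z
      proof (rule holomorphic_on_subset[OF hw])
        show "cmod z < 1" using dD[OF that, of w0] d by (simp add: Dr_iff)
        show "ball w0 d \<subseteq> {w. (z, w) \<in> Dr \<tau>}" using dD[OF that] by blast
      qed
      show "cmod (I (z, w)) \<le> 1" if "z \<in> ball z0 d" "w \<in> ball w0 d" for z w
        using bound[OF dD[OF that]] by simp
    qed
  qed
  define g where "g p = (if p \<in> Dst s t then f p else I p)" for p
  have un: "Dr t \<subseteq> Dst s t \<union> Dr \<tau>" using \<tau> by (auto simp: Dr_def Dst_def)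
  have gI: "g p = I p" if "p \<in> Dr \<tau>" for p using If that by (simp add: g_def)
  have "hol2 g (Dst s t)" using f(1) hol2_cong[OF open_Dst, of s t g f] by (simp add: g_def)
  moreover have "hol2 g (Dr \<tau>)" using hI hol2_cong[OF open_Dr, of \<tau> g I] gI by simp
  ultimately have "hol2 g (Dr t)" using un unfolding hol2_def by blast
  moreover have "cmod (g p) < 1" if "p \<in> Dr t" for p
  proof (cases "p \<in> Dst s t")
    case True
    thus ?thesis using f by (simp add: g_def)
  next
    case False
    hence "p \<in> Dr \<tau>" using un that by blast
    thus ?thesis using gI bound by (cases p) simp
  qed
  ultimately show thesis by (intro that[of g]) (auto simp: g_def)
qed

text \<open>Transported by diagonal automorphisms, the affine peak functions of Dr r stand in for the
  plurisubharmonicity of log pdist.\<close>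

lemma pdist_maximum_principle:
  fixes t :: real
  assumes S: "open S" "cball c R \<subseteq> S" "0 < R" and fg: "f holomorphic_on S" "g holomorphic_on S"
    and D: "\<And>z. z \<in> S \<Longrightarrow> cmod (f z) < 1" "\<And>z. z \<in> S \<Longrightarrow> cmod (g z) < 1"
    and t: "0 < t" and bd: "\<And>z. z \<in> sphere c R \<Longrightarrow> pdist (f z) (g z) < t"
    and z: "z \<in> cball c R"
  shows "pdist (f z) (g z) < t"
proof (rule ccontr)
  assume neg: "\<not> pdist (f z) (g z) < t"
  have cont: "continuous_on S (\<lambda>z. pdist (f z) (g z))"
  proof -
    have "continuous_on S (\<lambda>z. (f z, g z))"
      by (intro continuous_on_Pair holomorphic_on_imp_continuous_on fg)
    moreover have "(\<lambda>z. (f z, g z)) ` S \<subseteq> unit_disc \<times> unit_disc" using D by auto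
    ultimately show ?thesis using continuous_on_compose2[OF continuous_on_pdist] by fastforce
  qed
  obtain z0 where z0: "z0 \<in> cball c R" "\<And>z. z \<in> cball c R \<Longrightarrow> pdist (f z) (g z) \<le> pdist (f z0) (g z0)"
    using continuous_attains_sup[OF compact_cball _ continuous_on_subset[OF cont S(2)]] S(3) by fastforce
  define r where "r = pdist (f z0) (g z0)"
  have z0S: "z0 \<in> S" using z0 S by blast
  have r: "0 < r" "r < 1" "t \<le> r"
    using z0(2)[OF z] neg t pdist_less_1[OF D(1)[OF z0S] D(2)[OF z0S]] by (auto simp: r_def)
  have z0b: "z0 \<in> ball c R"
  proof (rule ccontr)
    assume "z0 \<notin> ball c R"
    hence "z0 \<in> sphere c R" using z0 by auto
    thus False using bd r by (fastforce simp: r_def)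
  qed
  obtain \<phi> where \<phi>: "\<phi> \<in> aut_disc" "\<phi> (f z0) = 0" "\<phi> (g z0) = of_real r"
    using move_to_axis[OF D(1)[OF z0S] D(2)[OF z0S]] unfolding r_def by blast
  obtain \<psi> where \<psi>: "\<phi> holomorphic_on unit_disc" "\<And>z. cmod z < 1 \<Longrightarrow> cmod (\<phi> z) < 1"
    using aut_discE[OF \<phi>(1)] by metis
  define p where "p = \<phi> \<circ> f"
  define q where "q = \<phi> \<circ> g"
  have hp: "p holomorphic_on S" "q holomorphic_on S" unfolding p_def q_def
    using D by (auto intro!: holomorphic_on_compose_gen[OF _ \<psi>(1)] fg)
  have pq: "cmod (p z) < 1" "cmod (q z) < 1" "pdist (p z) (q z) = pdist (f z) (g z)" if "z \<in> S" for z
    using \<psi>(2) D that pdist_aut_disc[OF \<phi>(1)] by (auto simp: p_def q_def)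
  \<comment> \<open>After \<open>\<phi>\<close> the maximal pair is \<open>(0, r)\<close>. On the
    disc \<open>\<eta>\<close> has modulus at most \<open>r\<close>, and it equals \<open>r\<close>
    at the interior point \<open>z0\<close>, so it is constant.\<close>
  define \<eta> where "\<eta> z = q z - of_real (1 - r^2) * p z" for z
  have egg: "cmod (\<eta> z) \<le> r * (1 - (1 - r^2) * (cmod (p z))^2 / (1 + r * cmod (p z)))" if "z \<in> cball c R" for z
    unfolding \<eta>_def using pq[of z] that S(2) z0(2)[OF that] r by (intro Dr_subset_egg) (auto simp: r_def)
  have \<kappa>: "0 < 1 - r^2" using r by (simp add: power_less_one_iff)
  have eggr: "cmod (\<eta> z) \<le> r" if "z \<in> cball c R" for z
  proof -
    have "0 \<le> (1 - r^2) * (cmod (p z))^2 / (1 + r * cmod (p z))"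
      using \<kappa> r by (intro divide_nonneg_nonneg mult_nonneg_nonneg) auto
    hence "r * (1 - (1 - r^2) * (cmod (p z))^2 / (1 + r * cmod (p z))) \<le> r * 1" using r by (intro mult_left_mono) auto
    thus ?thesis using egg[OF that] by simp
  qed
  have \<eta>0: "\<eta> z0 = of_real r" by (simp add: \<eta>_def p_def q_def \<phi>)
  have h\<eta>: "\<eta> holomorphic_on S" unfolding \<eta>_def[abs_def] by (intro holomorphic_intros hp)
  have "\<eta> constant_on ball c R"
  proof (rule maximum_modulus_principle[of \<eta> "ball c R" "ball c R" z0])
    show "\<eta> holomorphic_on ball c R" by (rule holomorphic_on_subset[OF h\<eta>]) (use S(2) ball_subset_cball in blast)
    show "cmod (\<eta> z) \<le> cmod (\<eta> z0)" if "z \<in> ball c R" for z using eggr[of z] that r by (simp add: \<eta>0)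
  qed (use z0b in auto)
  hence \<eta>c: "\<eta> z = of_real r" if "z \<in> ball c R" for z using that z0b \<eta>0 unfolding constant_on_def by metis
  have \<eta>cc: "\<eta> z = of_real r" if "z \<in> cball c R" for z
  proof (rule continuous_constant_on_closure[of "ball c R" \<eta>])
    show "continuous_on (closure (ball c R)) \<eta>"
      using continuous_on_subset[OF holomorphic_on_imp_continuous_on[OF h\<eta>] S(2)] S(3) by simp
    show "z \<in> closure (ball c R)" using that S(3) by simp
  qed (use \<eta>c in auto)
  \<comment> \<open>A point of the bounding circle. There \<open>\<eta> = r\<close> leaves room in
    \<open>egg\<close> only for \<open>p e = 0\<close>, so \<open>pdist\<close> equals
    \<open>r\<close> at \<open>e\<close>, against the strict bound by
    \<open>t \<le> r\<close>.\<close>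
  define e where "e = c + of_real R"
  have e: "e \<in> sphere c R" "e \<in> cball c R" using S(3) by (auto simp: e_def dist_norm)
  have "r \<le> r * (1 - (1 - r^2) * (cmod (p e))^2 / (1 + r * cmod (p e)))" using egg[OF e(2)] \<eta>cc[OF e(2)] r by simp
  hence "(1 - r^2) * (cmod (p e))^2 / (1 + r * cmod (p e)) \<le> 0" using r by (simp add: mult_le_cancel_left1)
  moreover have "0 < 1 + r * cmod (p e)" using r by (intro add_pos_nonneg) auto
  ultimately have "(1 - r^2) * (cmod (p e))^2 \<le> 0" by (simp add: divide_le_0_iff)
  hence pe: "p e = 0" using \<kappa> by (simp add: mult_le_0_iff)
  hence "q e = of_real r" using \<eta>cc[OF e(2)] by (simp add: \<eta>_def)
  hence "pdist (p e) (q e) = r" using pe r by (simp add: pdist_def)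
  moreover have "e \<in> S" using e S by blast
  ultimately have "pdist (f e) (g e) = r" using pq(3) by simp
  thus False using bd[OF e(1)] r by simp
qed

text \<open>The components extend one at a time, which leaves open whether the pair stays in
  \<open>Dr t\<close>. This follows from \<open>pdist_maximum_principle\<close> on a fibre disc
  covering the hole, whose bounding circle lies in \<open>Dst s t\<close>.\<close>

lemma extend_map:
  fixes s t :: real
  assumes st: "0 \<le> s" "s < t" "t \<le> 1" and F: "holo2_on F (Dst s t)" "F ` Dst s t \<subseteq> Dst s t"
  obtains G where "holo2_on G (Dr t)" "\<And>p. p \<in> Dst s t \<Longrightarrow> G p = F p" "G ` Dr t \<subseteq> Dr t"
proof -
  have h: "hol2 (\<lambda>p. fst (F p)) (Dst s t)" "hol2 (\<lambda>p. snd (F p)) (Dst s t)"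
    using F by (simp_all add: holo2_on_iff)
  have FD: "cmod (fst (F p)) < 1" "cmod (snd (F p)) < 1" "pdist (fst (F p)) (snd (F p)) < t" if "p \<in> Dst s t" for p
    using F(2) that Dst_iff[of "fst (F p)" "snd (F p)" s t] by auto
  obtain g1 where g1: "hol2 g1 (Dr t)" "\<And>p. p \<in> Dst s t \<Longrightarrow> g1 p = fst (F p)" "\<And>p. p \<in> Dr t \<Longrightarrow> cmod (g1 p) < 1"
    using bounded_extension[OF st h(1) FD(1)] by blast
  obtain g2 where g2: "hol2 g2 (Dr t)" "\<And>p. p \<in> Dst s t \<Longrightarrow> g2 p = snd (F p)" "\<And>p. p \<in> Dr t \<Longrightarrow> cmod (g2 p) < 1"
    using bounded_extension[OF st h(2) FD(2)] by blast
  have pd: "pdist (g1 (z, w)) (g2 (z, w)) < t" if zw: "(z, w) \<in> Dr t" for z w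
  proof (cases "s < pdist z w")
    case True
    hence "(z, w) \<in> Dst s t" using zw by (simp add: Dst_iff Dr_iff)
    thus ?thesis using g1 g2 FD by simp
  next
    case False
    have z: "cmod z < 1" "cmod w < 1" using zw by (auto simp: Dr_iff)
    define \<sigma> where "\<sigma> = (s + t) / 2"
    have \<sigma>: "0 < \<sigma>" "\<sigma> < 1" "s < \<sigma>" "\<sigma> < t" using st by (simp_all add: \<sigma>_def)
    have R: "0 < disc_radius \<sigma> z" using disc_radius_pos \<sigma> z by simp
    show ?thesis
    proof (rule pdist_maximum_principle[of "{w. (z, w) \<in> Dr t}" "disc_center \<sigma> z" "disc_radius \<sigma> z" "\<lambda>w. g1 (z, w)" "\<lambda>w. g2 (z, w)"])
      show "cball (disc_center \<sigma> z) (disc_radius \<sigma> z) \<subseteq> {w. (z, w) \<in> Dr t}"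
        using closed_pdisc_subset[OF \<sigma>(1,2) z(1)] z \<sigma> by (fastforce simp: Dr_iff)
      show "(\<lambda>w. g1 (z, w)) holomorphic_on {w. (z, w) \<in> Dr t}" "(\<lambda>w. g2 (z, w)) holomorphic_on {w. (z, w) \<in> Dr t}"
        by (rule hol2_disc[OF g1(1)] hol2_disc[OF g2(1)]; use open_slice_Dr in \<open>auto intro!: holomorphic_intros\<close>)+
      show "pdist (g1 (z, x)) (g2 (z, x)) < t" if "x \<in> sphere (disc_center \<sigma> z) (disc_radius \<sigma> z)" for x
      proof -
        have "x \<in> path_image (pcircle \<sigma> z)" using that R by (simp add: pcircle_def)
        hence "(z, x) \<in> Dst s t" using path_image_pcircle[OF \<sigma>(1,2) z(1)] z \<sigma> by (auto simp: Dst_iff)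
        thus ?thesis using g1 g2 FD by simp
      qed
      have "pdist z w < \<sigma>" using False \<sigma> by simp
      thus "w \<in> cball (disc_center \<sigma> z) (disc_radius \<sigma> z)"
        using mem_pdisc_iff[OF \<sigma>(1,2) z(1), of w] z by (simp add: Dr_iff)
    qed (use open_slice_Dr R st g1 g2 in auto)
  qed
  show thesis
  proof (rule that[of "\<lambda>p. (g1 p, g2 p)"])
    show "holo2_on (\<lambda>p. (g1 p, g2 p)) (Dr t)" using g1 g2 by (simp add: holo2_on_iff)
    show "(g1 p, g2 p) = F p" if "p \<in> Dst s t" for p using g1 g2 that by simp
    show "(\<lambda>p. (g1 p, g2 p)) ` Dr t \<subseteq> Dr t" using g1(3) g2(3) pd by (auto simp: Dr_iff)
  qed
qed

text \<open>Fibre by fibre: the disc of radius \<open>\<sigma>\<close> about \<open>z\<close> is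
  connected and meets the fibre of \<open>Dst s t\<close> in a nonempty open set, as the circle of
  radius \<open>\<rho>\<close> shows.\<close>

lemma hol2_identity_Dst:
  fixes s t :: real
  assumes st: "0 \<le> s" "s < t" "t \<le> 1" and f: "hol2 f (Dr t)" "hol2 g (Dr t)"
    and eq: "\<And>p. p \<in> Dst s t \<Longrightarrow> f p = g p" and p: "p \<in> Dr t"
  shows "f p = g p"
proof (cases "p \<in> Dst s t")
  case False
  obtain z w where p0: "p = (z, w)" by fastforce
  have z: "cmod z < 1" "cmod w < 1" "pdist z w \<le> s" using p False by (auto simp: p0 Dr_iff Dst_iff)
  define \<sigma> where "\<sigma> = (s + t) / 2"
  define \<rho> where "\<rho> = (s + \<sigma>) / 2"
  have \<sigma>: "0 < \<sigma>" "\<sigma> < 1" "s < \<sigma>" "\<sigma> < t" using st by (simp_all add: \<sigma>_def)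
  have \<rho>: "0 < \<rho>" "\<rho> < 1" "s < \<rho>" "\<rho> < \<sigma>" using st \<sigma> by (simp_all add: \<rho>_def)
  let ?S = "ball (disc_center \<sigma> z) (disc_radius \<sigma> z)"
  have S: "?S = {w. (z, w) \<in> Dr \<sigma>}" using mem_pdisc_iff[OF \<sigma>(1,2) z(1)] by blast
  have St: "?S \<subseteq> {w. (z, w) \<in> Dr t}" unfolding S using \<sigma> by (auto simp: Dr_iff)
  let ?T = "{w. (z, w) \<in> Dst s t} \<inter> ?S"
  have h: "(\<lambda>w. f (z, w)) holomorphic_on ?S" "(\<lambda>w. g (z, w)) holomorphic_on ?S"
    by (rule hol2_disc[OF f(1)] hol2_disc[OF f(2)]; use St in \<open>auto intro!: holomorphic_intros\<close>)+
  have "pathstart (pcircle \<rho> z) \<in> path_image (pcircle \<rho> z)" by (rule pathstart_in_path_image)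
  hence "pathstart (pcircle \<rho> z) \<in> ?T"
    unfolding S path_image_pcircle[OF \<rho>(1,2) z(1)] using z \<sigma> \<rho> by (auto simp: Dst_iff Dr_iff)
  hence ne: "?T \<noteq> {}" by blast
  have "f (z, w) = g (z, w)"
  proof (rule analytic_continuation_open[OF _ open_ball ne connected_ball _ h])
    show "open ?T" by (intro open_Int open_fibre open_ball)
    show "w \<in> ?S" unfolding S using z \<sigma> by (simp add: Dr_iff)
    show "f (z, x) = g (z, x)" if "x \<in> ?T" for x using eq that by blast
  qed simp
  thus ?thesis by (simp add: p0)
qed (use eq in auto)

lemma extend_automorphism:
  fixes s t :: real
  assumes st: "0 \<le> s" "s < t" "t \<le> 1" and F: "biholo2 (Dst s t) F K"
  obtains F' K' where "biholo2 (Dr t) F' K'" "\<And>p. p \<in> Dst s t \<Longrightarrow> F' p = F p" "\<And>p. p \<in> Dst s t \<Longrightarrow> K' p = K p"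
proof -
  have F: "holo2_on F (Dst s t)" "F ` Dst s t \<subseteq> Dst s t" "holo2_on K (Dst s t)" "K ` Dst s t \<subseteq> Dst s t"
    and inv: "\<And>p. p \<in> Dst s t \<Longrightarrow> K (F p) = p" "\<And>p. p \<in> Dst s t \<Longrightarrow> F (K p) = p"
    using F by (auto simp: biholo2_def)
  obtain F' where F': "holo2_on F' (Dr t)" "\<And>p. p \<in> Dst s t \<Longrightarrow> F' p = F p" "F' ` Dr t \<subseteq> Dr t"
    using extend_map[OF st F(1,2)] by blast
  obtain K' where K': "holo2_on K' (Dr t)" "\<And>p. p \<in> Dst s t \<Longrightarrow> K' p = K p" "K' ` Dr t \<subseteq> Dr t"
    using extend_map[OF st F(3,4)] by blast
  have id: "B (A p) = p" if A: "holo2_on A (Dr t)" "A ` Dr t \<subseteq> Dr t" and B: "holo2_on B (Dr t)"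
      and AB: "\<And>p. p \<in> Dst s t \<Longrightarrow> B (A p) = p" and p: "p \<in> Dr t" for A B p
  proof -
    have c: "hol2 (\<lambda>p. fst (B (A p))) (Dr t)" "hol2 (\<lambda>p. snd (B (A p))) (Dr t)"
      using holo2_compose[OF A(1) B A(2)] by (simp_all add: holo2_on_iff)
    have "fst (B (A p)) = fst p" by (rule hol2_identity_Dst[OF st c(1) hol2_fst _ p]) (simp add: AB)
    moreover have "snd (B (A p)) = snd p" by (rule hol2_identity_Dst[OF st c(2) hol2_snd _ p]) (simp add: AB)
    ultimately show ?thesis by (simp add: prod_eq_iff)
  qed
  have "K' (F' p) = p" if "p \<in> Dr t" for p
    by (rule id[OF F'(1,3) K'(1) _ that]) (use F' K' F inv in \<open>auto simp: image_subset_iff\<close>)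
  moreover have "F' (K' p) = p" if "p \<in> Dr t" for p
    by (rule id[OF K'(1,3) F'(1) _ that]) (use F' K' F inv in \<open>auto simp: image_subset_iff\<close>)
  ultimately have "biholo2 (Dr t) F' K'" using F' K' by (auto simp: biholo2_def)
  thus thesis using that F'(2) K'(2) by blast
qed

subsection \<open>Automorphisms of the bidisc\<close>

lemma Dr_1: "Dr 1 = unit_disc \<times> unit_disc"
  using pdist_less_1 by (auto simp: Dr_def)

text \<open>Points of modulus at most \<open>x\<close> whose phases align both summands give the
  value 1 if \<open>x\<close> is the reciprocal of the sum of moduli; with \<open>sgn 0 = 0\<close>
  a vanishing coefficient needs no separate treatment in the final sum.\<close>

lemma linear_functional_bidisc:
  assumes "\<And>z w. cmod z < 1 \<Longrightarrow> cmod w < 1 \<Longrightarrow> cmod (p * z + q * w) < 1"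
  shows "cmod p + cmod q \<le> 1"
proof (rule ccontr)
  assume "\<not> cmod p + cmod q \<le> 1"
  hence N: "1 < cmod p + cmod q" by simp
  define x where "x = 1 / (cmod p + cmod q)"
  have x: "0 < x" "x < 1" "x * (cmod p + cmod q) = 1" using N by (simp_all add: x_def)
  have sg: "p * (of_real x * cnj (sgn p)) = of_real (x * cmod p)" for p :: complex
  proof (cases "p = 0")
    case False
    hence "p * cnj (sgn p) = of_real (cmod p)"
      by (simp add: sgn_eq complex_norm_square[symmetric] power2_eq_square)
    thus ?thesis by (simp add: mult.left_commute)
  qed simp
  have n: "cmod (of_real x * cnj (sgn p)) < 1" for p :: complex
    using x by (simp add: norm_mult norm_sgn)
  have "cmod (p * (of_real x * cnj (sgn p)) + q * (of_real x * cnj (sgn q))) < 1"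
    by (rule assms[OF n n])
  also have "p * (of_real x * cnj (sgn p)) + q * (of_real x * cnj (sgn q)) = of_real (x * (cmod p + cmod q))"
    unfolding sg by (simp add: distrib_left)
  finally show False using x by simp
qed

text \<open>The rows of both matrices have entries with sum of moduli at most 1. Since
  \<open>K\<close> inverts \<open>F\<close>, each column of the matrix of \<open>F\<close> must
  contain an entry of modulus at least 1, and the row bounds leave only a permutation with
  unimodular entries.\<close>

lemma linear_automorphism_bidisc:
  assumes F: "biholo2 (Dr 1) F K" and 0: "F 0 = 0"
  obtains p v where "cmod p = 1" "cmod v = 1"
    "(\<forall>z\<in>Dr 1. F z = (p * fst z, v * snd z)) \<or> (\<forall>z\<in>Dr 1. F z = (p * snd z, v * fst z))"
proof -
  have z0: "0 \<in> Dr 1" by (rule zero_mem_Dr) simp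
  have K: "biholo2 (Dr 1) K F" and K0: "K 0 = 0"
    using F 0 z0 biholo2_sym by (auto simp: biholo2_def)
  have nb: "norm z \<le> 2" if "z \<in> Dr 1" for z using that by (rule norm_Dr_le)
  obtain p q u v where L: "\<And>z. z \<in> Dr 1 \<Longrightarrow> F z = (p * fst z + q * snd z, u * fst z + v * snd z)"
    using Cartan_linear[OF open_Dr balanced2_Dr z0 nb F 0] by blast
  obtain p' q' u' v' where M: "\<And>z. z \<in> Dr 1 \<Longrightarrow> K z = (p' * fst z + q' * snd z, u' * fst z + v' * snd z)"
    using Cartan_linear[OF open_Dr balanced2_Dr z0 nb K K0] by blast
  have D: "(z, w) \<in> Dr 1" if "cmod z < 1" "cmod w < 1" for z w using that by (simp add: Dr_1)
  have FD: "F z \<in> Dr 1" "K z \<in> Dr 1" "K (F z) = z" if "z \<in> Dr 1" for z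
    using F that by (auto simp: biholo2_def)
  have Fb: "cmod (p * z + q * w) < 1" "cmod (u * z + v * w) < 1" if "cmod z < 1" "cmod w < 1" for z w
    using FD(1)[OF D[OF that]] L[OF D[OF that]] by (auto simp: Dr_1)
  have Kb: "cmod (p' * z + q' * w) < 1" "cmod (u' * z + v' * w) < 1" if "cmod z < 1" "cmod w < 1" for z w
    using FD(2)[OF D[OF that]] M[OF D[OF that]] by (auto simp: Dr_1)
  have rows: "cmod p + cmod q \<le> 1" "cmod u + cmod v \<le> 1" "cmod p' + cmod q' \<le> 1" "cmod u' + cmod v' \<le> 1"
    using linear_functional_bidisc[OF Fb(1)] linear_functional_bidisc[OF Fb(2)]
      linear_functional_bidisc[OF Kb(1)] linear_functional_bidisc[OF Kb(2)] by blast+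
  have KF: "p' * (p * z + q * w) + q' * (u * z + v * w) = z" "u' * (p * z + q * w) + v' * (u * z + v * w) = w"
    if "cmod z < 1" "cmod w < 1" for z w
    using FD(3)[OF D[OF that]] L[OF D[OF that]] M[OF D[OF Fb[OF that]]] by simp_all
  have half: "x = 1" if "x * (1 / 2) = 1 / 2" for x :: complex using that by simp
  have "(p' * p + q' * u) * (1 / 2) = p' * (p * (1 / 2) + q * 0) + q' * (u * (1 / 2) + v * 0)"
    by (simp add: algebra_simps)
  also have "\<dots> = 1 / 2" by (rule KF(1)) simp_all
  finally have e1: "p' * p + q' * u = 1" by (rule half)
  have "(u' * q + v' * v) * (1 / 2) = u' * (p * 0 + q * (1 / 2)) + v' * (u * 0 + v * (1 / 2))"
    by (simp add: algebra_simps)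
  also have "\<dots> = 1 / 2" by (rule KF(2)) simp_all
  finally have e2: "u' * q + v' * v = 1" by (rule half)
  have big: "1 \<le> cmod a \<or> 1 \<le> cmod b" if "x * a + y * b = 1" "cmod x + cmod y \<le> 1" for x y a b
  proof (rule ccontr)
    assume "\<not> (1 \<le> cmod a \<or> 1 \<le> cmod b)"
    hence ab: "cmod a < 1" "cmod b < 1" by auto
    define m where "m = max (cmod a) (cmod b)"
    have m: "cmod a \<le> m" "cmod b \<le> m" "m < 1" "0 \<le> m" using ab by (auto simp: m_def le_max_iff_disj)
    have "1 = cmod (x * a + y * b)" using that by simp
    also have "\<dots> \<le> cmod x * cmod a + cmod y * cmod b"
      using norm_triangle_ineq[of "x * a" "y * b"] by (simp add: norm_mult)
    also have "\<dots> \<le> cmod x * m + cmod y * m" using m by (intro add_mono mult_left_mono) auto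
    also have "\<dots> = (cmod x + cmod y) * m" by (simp add: distrib_right)
    also have "\<dots> \<le> 1 * m" using that m by (intro mult_right_mono) auto
    finally show False using m by simp
  qed
  have n: "0 \<le> cmod p" "0 \<le> cmod q" "0 \<le> cmod u" "0 \<le> cmod v" by auto
  from big[OF e1 rows(3)] big[OF e2 rows(4)] rows n
  consider "cmod p = 1" "cmod q = 0" "cmod u = 0" "cmod v = 1" | "cmod p = 0" "cmod q = 1" "cmod u = 1" "cmod v = 0"
    by linarith
  thus thesis
  proof cases
    case 1
    thus ?thesis using that[of p v] L by simp
  next
    case 2
    thus ?thesis using that[of q u] L by simp
  qed
qed

lemma automorphism_bidisc:
  assumes F: "biholo2 (Dr 1) F K"
  obtains \<phi> \<psi> where "\<phi> \<in> aut_disc" "\<psi> \<in> aut_disc"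
    "(\<forall>z\<in>Dr 1. F z = (\<phi> (fst z), \<psi> (snd z))) \<or> (\<forall>z\<in>Dr 1. F z = (\<phi> (snd z), \<psi> (fst z)))"
proof -
  have z0: "0 \<in> Dr 1" by (rule zero_mem_Dr) simp
  obtain a b where ab: "F 0 = (a, b)" by fastforce
  have FD: "F z \<in> Dr 1" if "z \<in> Dr 1" for z using F that by (auto simp: biholo2_def)
  have a: "cmod a < 1" "cmod b < 1" using FD[OF z0] by (auto simp: ab Dr_1)
  let ?M = "Moebius_function 0"
  have hol: "?M c holomorphic_on unit_disc" if "cmod c < 1" for c
    using Moebius_function_holomorphic[OF that] by (simp add: unit_disc_def)
  define N where "N c d = (\<lambda>z :: complex \<times> complex. (?M c (fst z), ?M d (snd z)))" for c d
  have "biholo2 (Dr 1) (N a b) (N (- a) (- b))"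
    unfolding biholo2_def N_def using a hol holo2_diag_map[of _ _ "Dr 1"] Moebius_function_norm_lt_1
      Moebius_function_inverse by (auto simp: Dr_1)
  from biholo2_comp[OF this F] have B: "biholo2 (Dr 1) (\<lambda>z. N a b (F z)) (\<lambda>z. K (N (- a) (- b) z))" .
  have N0: "N a b (F 0) = 0" by (simp add: N_def ab Moebius_function_eq_zero) (simp add: zero_prod_def)
  obtain p v where pv: "cmod p = 1" "cmod v = 1"
    "(\<forall>z\<in>Dr 1. N a b (F z) = (p * fst z, v * snd z)) \<or> (\<forall>z\<in>Dr 1. N a b (F z) = (p * snd z, v * fst z))"
    using linear_automorphism_bidisc[OF B N0] by blast
  have unN: "N (- a) (- b) (N a b (F z)) = F z" if "z \<in> Dr 1" for z
    using FD[OF that] a Moebius_function_inverse(1) by (cases "F z") (auto simp: N_def Dr_1)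
  show thesis
  proof (rule that[of "?M (- a) \<circ> (\<lambda>z. p * z)" "?M (- b) \<circ> (\<lambda>z. v * z)"])
    show "?M (- a) \<circ> (\<lambda>z. p * z) \<in> aut_disc" "?M (- b) \<circ> (\<lambda>z. v * z) \<in> aut_disc"
      using aut_disc_comp Moebius_function_aut_disc rotation_aut_disc a pv by simp_all
    show "(\<forall>z\<in>Dr 1. F z = ((?M (- a) \<circ> (\<lambda>z. p * z)) (fst z), (?M (- b) \<circ> (\<lambda>z. v * z)) (snd z)))
        \<or> (\<forall>z\<in>Dr 1. F z = ((?M (- a) \<circ> (\<lambda>z. p * z)) (snd z), (?M (- b) \<circ> (\<lambda>z. v * z)) (fst z)))"
      using pv(3)
    proof (elim disjE)
      assume "\<forall>z\<in>Dr 1. N a b (F z) = (p * fst z, v * snd z)"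
      hence "F z = N (- a) (- b) (p * fst z, v * snd z)" if "z \<in> Dr 1" for z using unN that by metis
      thus ?thesis by (simp add: N_def)
    next
      assume "\<forall>z\<in>Dr 1. N a b (F z) = (p * snd z, v * fst z)"
      hence "F z = N (- a) (- b) (p * snd z, v * fst z)" if "z \<in> Dr 1" for z using unN that by metis
      thus ?thesis by (simp add: N_def)
    qed
  qed
qed

section \<open>Annular domains and the final theorem\<close>

lemma eq_of_bounded_pdist:
  fixes s :: real
  assumes \<psi>: "\<psi> holomorphic_on unit_disc" "\<And>z. cmod z < 1 \<Longrightarrow> cmod (\<psi> z) < 1"
    and s: "0 \<le> s" "s < 1" and le: "\<And>z. cmod z < 1 \<Longrightarrow> pdist z (\<psi> z) \<le> s" and z: "cmod z < 1"
  shows "\<psi> z = z"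
proof -
  have "z - \<psi> z = 0"
  proof (rule holomorphic_zero_of_boundary_limit[OF _ _ z])
    show "(\<lambda>z. z - \<psi> z) holomorphic_on ball 0 1"
      using \<psi>(1) by (auto intro!: holomorphic_intros simp: unit_disc_def)
    fix e :: real assume e: "e > 0"
    have s2: "0 < 1 - s^2" using s by (simp add: power_less_one_iff)
    define d where "d = e^2 * (1 - s^2) / 2"
    have d: "d > 0" using e s2 by (simp add: d_def)
    have "cmod (z - \<psi> z) \<le> e" if z: "1 - d < cmod z" "cmod z < 1" for z
    proof -
      have "(cmod (z - \<psi> z))^2 \<le> (1 - (cmod z)^2) / (1 - s^2)"
        using z \<psi>(2) le s by (intro cmod_diff_le_of_pdist) auto
      also have "\<dots> \<le> (2 * d) / (1 - s^2)"
      proof (intro divide_right_mono)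
        have "1 - (cmod z)^2 \<le> 2 * (1 - cmod z)" by (rule one_minus_square_le)
        thus "1 - (cmod z)^2 \<le> 2 * d" using z by argo
      qed (use s2 in auto)
      also have "\<dots> = e^2" using s2 by (simp add: d_def)
      finally show ?thesis using e by (simp add: power2_le_iff_abs_le)
    qed
    thus "\<exists>R<1. \<forall>z. R < cmod z \<and> cmod z < 1 \<longrightarrow> cmod (z - \<psi> z) \<le> e"
      using d by (intro exI[of _ "1 - d"]) auto
  qed
  thus ?thesis by simp
qed

text \<open>If \<open>pdist (\<phi> z) (\<psi> z)\<close> exceeded \<open>s\<close>, the diagonal
  point \<open>(z, z)\<close> would be the image under \<open>K'\<close> of a point of
  \<open>Dst s 1\<close> and so lie in it. Hence \<open>\<psi>\<close> composed with the inverse of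
  \<open>\<phi>\<close> moves points by at most \<open>s < 1\<close> in \<open>pdist\<close> and is
  the identity.\<close>

lemma automorphism_Dst_1:
  fixes s :: real
  assumes s: "0 \<le> s" "s < 1" and F: "biholo2 (Dst s 1) F K"
  shows "\<exists>\<phi>\<in>aut_disc. (\<forall>z\<in>Dst s 1. F z = diag_map \<phi> z) \<or> (\<forall>z\<in>Dst s 1. F z = (diag_map \<phi> \<circ> sigma) z)"
proof -
  obtain F' K' where F': "biholo2 (Dr 1) F' K'" "\<And>p. p \<in> Dst s 1 \<Longrightarrow> F' p = F p" "\<And>p. p \<in> Dst s 1 \<Longrightarrow> K' p = K p"
    using extend_automorphism[OF s(1,2) order_refl F] by blast
  obtain \<phi> \<psi> where pq: "\<phi> \<in> aut_disc" "\<psi> \<in> aut_disc"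
    "(\<forall>z\<in>Dr 1. F' z = (\<phi> (fst z), \<psi> (snd z))) \<or> (\<forall>z\<in>Dr 1. F' z = (\<phi> (snd z), \<psi> (fst z)))"
    using automorphism_bidisc[OF F'(1)] by blast
  obtain \<phi>' where \<phi>': "\<phi>' \<in> aut_disc" "\<phi> holomorphic_on unit_disc" "\<phi>' holomorphic_on unit_disc"
    "\<And>z. cmod z < 1 \<Longrightarrow> cmod (\<phi> z) < 1" "\<And>z. cmod z < 1 \<Longrightarrow> cmod (\<phi>' z) < 1"
    "\<And>z. cmod z < 1 \<Longrightarrow> \<phi>' (\<phi> z) = z" "\<And>z. cmod z < 1 \<Longrightarrow> \<phi> (\<phi>' z) = z"
    using aut_discE[OF pq(1)] by blast
  obtain \<psi>' where \<psi>: "\<psi>' \<in> aut_disc" "\<psi> holomorphic_on unit_disc" "\<psi>' holomorphic_on unit_disc"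
    "\<And>z. cmod z < 1 \<Longrightarrow> cmod (\<psi> z) < 1" "\<And>z. cmod z < 1 \<Longrightarrow> cmod (\<psi>' z) < 1"
    "\<And>z. cmod z < 1 \<Longrightarrow> \<psi>' (\<psi> z) = z" "\<And>z. cmod z < 1 \<Longrightarrow> \<psi> (\<psi>' z) = z"
    using aut_discE[OF pq(2)] by blast
  have le: "pdist (\<phi> z) (\<psi> z) \<le> s" if z: "cmod z < 1" for z
  proof (rule ccontr)
    assume "\<not> pdist (\<phi> z) (\<psi> z) \<le> s"
    hence "(\<phi> z, \<psi> z) \<in> Dst s 1" using \<phi>'(4) \<psi>(4) z pdist_less_1 by (simp add: Dst_iff)
    moreover have zz: "(z, z) \<in> Dr 1" using z by (simp add: Dr_1)
    moreover have "F' (z, z) = (\<phi> z, \<psi> z)" using pq(3) zz by auto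
    ultimately have "K' (F' (z, z)) \<in> Dst s 1" using F'(3) F by (simp add: biholo2_def image_subset_iff)
    hence "(z, z) \<in> Dst s 1" using F'(1) zz by (simp add: biholo2_def)
    thus False using s by (simp add: Dst_iff pdist_def)
  qed
  have fixed: "(\<psi> \<circ> \<phi>') x = x" if x: "cmod x < 1" for x
  proof (rule eq_of_bounded_pdist[OF _ _ s _ x])
    show "\<psi> \<circ> \<phi>' holomorphic_on unit_disc"
      by (rule holomorphic_on_compose_gen[OF \<phi>'(3) \<psi>(2)]) (use \<phi>'(5) in auto)
    show "cmod ((\<psi> \<circ> \<phi>') z) < 1" if "cmod z < 1" for z using that \<psi>(4) \<phi>'(5) by simp
    show "pdist z ((\<psi> \<circ> \<phi>') z) \<le> s" if "cmod z < 1" for z using le[OF \<phi>'(5)[OF that]] \<phi>'(7)[OF that] by simp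
  qed
  have eq: "\<psi> z = \<phi> z" if "cmod z < 1" for z
    using fixed[OF \<phi>'(4)[OF that]] \<phi>'(6)[OF that] by simp
  have sub: "Dst s 1 \<subseteq> Dr 1" by (auto simp: Dst_def Dr_def)
  have "(\<forall>z\<in>Dst s 1. F z = diag_map \<phi> z) \<or> (\<forall>z\<in>Dst s 1. F z = (diag_map \<phi> \<circ> sigma) z)"
    using pq(3)
  proof (elim disjE)
    assume h: "\<forall>z\<in>Dr 1. F' z = (\<phi> (fst z), \<psi> (snd z))"
    have "F z = diag_map \<phi> z" if "z \<in> Dst s 1" for z
    proof -
      obtain x y where xy: "z = (x, y)" by fastforce
      have "cmod x < 1" "cmod y < 1" using that by (auto simp: xy Dst_iff)
      moreover have "F z = (\<phi> x, \<psi> y)"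
        using h[rule_format, OF subsetD[OF sub that]] F'(2)[OF that] by (simp add: xy)
      ultimately show ?thesis by (simp add: xy eq)
    qed
    thus ?thesis by blast
  next
    assume h: "\<forall>z\<in>Dr 1. F' z = (\<phi> (snd z), \<psi> (fst z))"
    have "F z = (diag_map \<phi> \<circ> sigma) z" if "z \<in> Dst s 1" for z
    proof -
      obtain x y where xy: "z = (x, y)" by fastforce
      have "cmod x < 1" "cmod y < 1" using that by (auto simp: xy Dst_iff)
      moreover have "F z = (\<phi> y, \<psi> x)"
        using h[rule_format, OF subsetD[OF sub that]] F'(2)[OF that] by (simp add: xy)
      ultimately show ?thesis by (simp add: xy eq)
    qed
    thus ?thesis by blast
  qed
  thus ?thesis using pq(1) by blast
qed

lemma automorphism_Dst:
  fixes s t :: real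
  assumes st: "0 \<le> s" "s < t" "t \<le> 1" and F: "biholo2 (Dst s t) F K"
  shows "\<exists>\<phi>\<in>aut_disc. (\<forall>z\<in>Dst s t. F z = diag_map \<phi> z) \<or> (\<forall>z\<in>Dst s t. F z = (diag_map \<phi> \<circ> sigma) z)"
proof (cases "t = 1")
  case True
  thus ?thesis using automorphism_Dst_1 st F by blast
next
  case False
  hence t: "0 < t" "t < 1" using st by auto
  obtain F' K' where F': "biholo2 (Dr t) F' K'" "\<And>p. p \<in> Dst s t \<Longrightarrow> F' p = F p"
    "\<And>p. p \<in> Dst s t \<Longrightarrow> K' p = K p"
    using extend_automorphism[OF st F] by blast
  have sub: "Dst s t \<subseteq> Dr t" by (auto simp: Dst_def Dr_def)
  obtain \<phi> where \<phi>: "\<phi> \<in> aut_disc"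
    "(\<forall>z\<in>Dr t. F' z = diag_map \<phi> z) \<or> (\<forall>z\<in>Dr t. F' z = (diag_map \<phi> \<circ> sigma) z)"
    using automorphism_Dr[OF t F'(1)] by blast
  from \<phi>(2) sub have "(\<forall>z\<in>Dst s t. F' z = diag_map \<phi> z) \<or> (\<forall>z\<in>Dst s t. F' z = (diag_map \<phi> \<circ> sigma) z)"
    by blast
  hence "(\<forall>z\<in>Dst s t. F z = diag_map \<phi> z) \<or> (\<forall>z\<in>Dst s t. F z = (diag_map \<phi> \<circ> sigma) z)"
    by (simp only: F'(2) cong: ball_cong)
  thus ?thesis using \<phi>(1) by blast
qed

lemma diag_map_mem_aut2:
  assumes U: "U = Dr r \<or> U = Dst s t" and \<phi>: "\<phi> \<in> aut_disc"
    and F: "(\<forall>z\<in>U. F z = diag_map \<phi> z) \<or> (\<forall>z\<in>U. F z = (diag_map \<phi> \<circ> sigma) z)"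
  shows "F \<in> aut2 U"
proof -
  have op: "open U" using U open_Dr open_Dst by blast
  obtain \<psi> where "\<psi> \<in> aut_disc" "\<And>z. cmod z < 1 \<Longrightarrow> \<psi> (\<phi> z) = z"
    "\<And>z. cmod z < 1 \<Longrightarrow> \<phi> (\<psi> z) = z" and b: "biholo2 U (diag_map \<phi>) (diag_map \<psi>)"
    using biholo2_diag_map[OF \<phi> U] by blast
  from F show ?thesis
  proof
    assume "\<forall>z\<in>U. F z = diag_map \<phi> z"
    hence "biholo2 U F (diag_map \<psi>)" using biholo2_cong[OF op _ b, of F] by simp
    thus ?thesis using aut2_iff[OF op] by blast
  next
    assume "\<forall>z\<in>U. F z = (diag_map \<phi> \<circ> sigma) z"
    hence "biholo2 U F (\<lambda>z. sigma (diag_map \<psi> z))"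
      using biholo2_cong[OF op _ biholo2_comp[OF b biholo2_sigma[OF U]], of F] by simp
    thus ?thesis using aut2_iff[OF op] by blast
  qed
qed

theorem theorem2p2:
  fixes r s t :: real
  assumes "0 < r" "r < 1" "0 \<le> s" "s < t" "t \<le> 1"
  shows "(\<forall>F. F \<in> aut2 (Dr r) \<longleftrightarrow>
            (\<exists>\<phi>\<in>aut_disc. (\<forall>z\<in>Dr r. F z = diag_map \<phi> z)
                          \<or> (\<forall>z\<in>Dr r. F z = (diag_map \<phi> \<circ> sigma) z)))
       \<and> (\<forall>F. F \<in> aut2 (Dst s t) \<longleftrightarrow>
            (\<exists>\<phi>\<in>aut_disc. (\<forall>z\<in>Dst s t. F z = diag_map \<phi> z)
                          \<or> (\<forall>z\<in>Dst s t. F z = (diag_map \<phi> \<circ> sigma) z)))"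
proof (intro conjI allI iffI)
  fix F assume "F \<in> aut2 (Dr r)"
  then obtain K where "biholo2 (Dr r) F K" using aut2_iff[OF open_Dr] by blast
  thus "\<exists>\<phi>\<in>aut_disc. (\<forall>z\<in>Dr r. F z = diag_map \<phi> z) \<or> (\<forall>z\<in>Dr r. F z = (diag_map \<phi> \<circ> sigma) z)"
    by (rule automorphism_Dr[OF assms(1,2)])
next
  fix F assume "\<exists>\<phi>\<in>aut_disc. (\<forall>z\<in>Dr r. F z = diag_map \<phi> z) \<or> (\<forall>z\<in>Dr r. F z = (diag_map \<phi> \<circ> sigma) z)"
  thus "F \<in> aut2 (Dr r)" using diag_map_mem_aut2[of "Dr r" r] by blast
next
  fix F assume "F \<in> aut2 (Dst s t)"
  then obtain K where "biholo2 (Dst s t) F K" using aut2_iff[OF open_Dst] by blast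
  thus "\<exists>\<phi>\<in>aut_disc. (\<forall>z\<in>Dst s t. F z = diag_map \<phi> z) \<or> (\<forall>z\<in>Dst s t. F z = (diag_map \<phi> \<circ> sigma) z)"
    by (rule automorphism_Dst[OF assms(3-5)])
next
  fix F assume "\<exists>\<phi>\<in>aut_disc. (\<forall>z\<in>Dst s t. F z = diag_map \<phi> z) \<or> (\<forall>z\<in>Dst s t. F z = (diag_map \<phi> \<circ> sigma) z)"
  thus "F \<in> aut2 (Dst s t)" using diag_map_mem_aut2[of "Dst s t" _ s t] by blast
qed

end
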